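(* Let $H$ be an $r$-uniform hypergraph, fix $\delta>0$, and let $X_H$ denote the number of copies of $H$ in the random hypergraph $G^{(r)}_{n,p}$, where $p=p(n)$ satisfies $p > n^{-\frac{1}{6|E(H)|}}\log n$ and $p=o(1)$. Then \[ \mathbb{P}(X_H \ge (1+\delta)\mathbb{E}X_H) = \exp\big(-(1+o(1))\,\phi(H,n,p,\delta)\big). \]
   Context: $G^{(r)}_{n,p}$: each $r$-subset of $[n]$ is an edge independently with probability $p$. An edge-weighted $r$-graph $G$ on $[n]$ is a symmetric function $G:[n]^r\to[0,1]$ (invariant under permuting its arguments) with $G(i_1,\dots,i_r)=0$ unless $i_1,\dots,i_r$ are distinct. For an $r$-graph $H$ with vertex set $V(H)$, $t(H,G) = n^{-|V(H)|}\sum_{x\in[n]^{V(H)}}\prod_{e\in E(H)} G(x_e)$, where $x_e$ is the restriction of $x$ to the vertices of $e$. With $I_p(x)=x\log\frac xp+(1-x)\log\frac{1-x}{1-p}$, set $I_p(G)=\sum_{1\le i_1<\dots<i_r\le n} I_p(G(i_1,\dots,i_r))$, and $\phi(H,n,p,\delta)=\inf\{I_p(G): G \text{ an edge-weighted } r\text{-graph on } [n],\ t(H,G)\ge(1+\delta)p^{|E(H)|}\}$. Asymptotics are as $n\to\infty$. *)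

theory Defs
  imports "HOL-Probability.Probability"
begin

definition uniform_hypergraph :: "nat \<Rightarrow> 'a set \<Rightarrow> 'a set set \<Rightarrow> bool" where
  "uniform_hypergraph r V E \<longleftrightarrow> finite V \<and> (\<forall>e\<in>E. e \<subseteq> V \<and> card e = r)"

definition hypergraph_iso ::
    "'a set \<Rightarrow> 'a set set \<Rightarrow> 'b set \<Rightarrow> 'b set set \<Rightarrow> bool" where
  "hypergraph_iso V E W F \<longleftrightarrow> (\<exists>f. bij_betw f V W \<and> (\<lambda>e. f ` e) ` E = F)"

text \<open>A copy of \<open>H = (V, E)\<close> in a hypergraph on \<open>[n]\<close> with edge set \<open>D\<close> is a (not necessarily
  induced) subhypergraph \<open>(W, F)\<close> isomorphic to \<open>H\<close>.\<close>

definition copies :: "'a set \<Rightarrow> 'a set set \<Rightarrow> nat \<Rightarrow> nat set set \<Rightarrow> nat" where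
  "copies V E n D = card {(W, F). W \<subseteq> {1..n} \<and> F \<subseteq> D \<and> hypergraph_iso V E W F}"

definition r_subsets :: "nat \<Rightarrow> nat \<Rightarrow> nat set set" where
  "r_subsets r n = {e. e \<subseteq> {1..n} \<and> card e = r}"

definition random_hypergraph :: "nat \<Rightarrow> nat \<Rightarrow> real \<Rightarrow> nat set set pmf" where
  "random_hypergraph r n p =
     map_pmf (\<lambda>b. {e \<in> r_subsets r n. b e})
       (Pi_pmf (r_subsets r n) False (\<lambda>_. bernoulli_pmf p))"

text \<open>An element of \<open>[n]\<^sup>r\<close> is a list of length \<open>r\<close> with entries in \<open>{1..n}\<close>; two such lists
  are permutations of each other iff they have the same multiset of entries. The values of \<open>G\<close>
  outside \<open>tuples r n\<close> play no role.\<close>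

definition tuples :: "nat \<Rightarrow> nat \<Rightarrow> nat list set" where
  "tuples r n = {xs. length xs = r \<and> set xs \<subseteq> {1..n}}"

definition weighted_graph :: "nat \<Rightarrow> nat \<Rightarrow> (nat list \<Rightarrow> real) \<Rightarrow> bool" where
  "weighted_graph r n G \<longleftrightarrow>
     (\<forall>xs\<in>tuples r n. 0 \<le> G xs \<and> G xs \<le> 1) \<and>
     (\<forall>xs\<in>tuples r n. \<forall>ys\<in>tuples r n. mset xs = mset ys \<longrightarrow> G xs = G ys) \<and>
     (\<forall>xs\<in>tuples r n. \<not> distinct xs \<longrightarrow> G xs = 0)"

text \<open>\<open>x\<^sub>e\<close> as a tuple: the vertices of \<open>e\<close> are listed in an arbitrary order, which is irrelevant
  by the symmetry of \<open>G\<close> (lemma \<open>weighted_graph_restr_tuple\<close>).\<close>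

definition restr_tuple :: "('a \<Rightarrow> nat) \<Rightarrow> 'a set \<Rightarrow> nat list" where
  "restr_tuple x e = map x (SOME vs. distinct vs \<and> set vs = e)"

lemma weighted_graph_restr_tuple:
  assumes G: "weighted_graph r n G" and H: "uniform_hypergraph r V E"
    and e: "e \<in> E" and x: "x \<in> V \<rightarrow>\<^sub>E {1..n}" and vs: "distinct vs" "set vs = e"
  shows "G (restr_tuple x e) = G (map x vs)"
proof -
  define us where "us = (SOME us. distinct us \<and> set us = e)"
  have us: "distinct us" "set us = e"
    using someI[of "\<lambda>us. distinct us \<and> set us = e" vs] vs unfolding us_def by auto
  have card: "card e = r" and sub: "e \<subseteq> V"
    using H e by (auto simp: uniform_hypergraph_def)
  have "mset us = mset vs"
    using us vs by (metis set_eq_iff_mset_eq_distinct)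
  hence m: "mset (map x us) = mset (map x vs)" by simp
  have "map x us \<in> tuples r n" "map x vs \<in> tuples r n"
    using us vs card sub x distinct_card[of us] distinct_card[of vs]
    by (auto simp: tuples_def)
  with m G show ?thesis
    unfolding weighted_graph_def restr_tuple_def us_def[symmetric] by blast
qed

definition hom_density ::
    "'a set \<Rightarrow> 'a set set \<Rightarrow> nat \<Rightarrow> (nat list \<Rightarrow> real) \<Rightarrow> real" where
  "hom_density V E n G =
     (\<Sum>x \<in> V \<rightarrow>\<^sub>E {1..n}. \<Prod>e\<in>E. G (restr_tuple x e)) / real n ^ card V"

text \<open>The convention \<open>0 log 0 = 0\<close> is automatic.\<close>

definition rel_entropy :: "real \<Rightarrow> real \<Rightarrow> real" where
  "rel_entropy p x = x * ln (x / p) + (1 - x) * ln ((1 - x) / (1 - p))"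

definition graph_entropy :: "nat \<Rightarrow> nat \<Rightarrow> real \<Rightarrow> (nat list \<Rightarrow> real) \<Rightarrow> real" where
  "graph_entropy r n p G =
     (\<Sum>xs \<in> {xs \<in> tuples r n. sorted_wrt (<) xs}. rel_entropy p (G xs))"

text \<open>For \<open>0 < p < 1\<close> the set is bounded below by \<open>0\<close>. When \<open>p = p(n)\<close> tends to \<open>0\<close> and \<open>E\<close> is
  nonempty it is nonempty for all large \<open>n\<close>: the complete \<open>r\<close>-graph has density tending to \<open>1\<close>.
  So the real infimum is the intended one for all large \<open>n\<close>.\<close>

definition upper_tail_phi ::
    "nat \<Rightarrow> 'a set \<Rightarrow> 'a set set \<Rightarrow> nat \<Rightarrow> real \<Rightarrow> real \<Rightarrow> real" where
  "upper_tail_phi r V E n p \<delta> =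
     Inf {graph_entropy r n p G | G.
            weighted_graph r n G \<and> hom_density V E n G \<ge> (1 + \<delta>) * p ^ card E}"

end

theory Submission
  imports Defs
begin

text \<open>
  For a convex set of weightings, the probability that the random hypergraph lies in it is at most
  \<open>exp (- I\<^sub>p(y))\<close> for some \<open>y\<close> in the set, namely the conditional mean (Gibbs' inequality). The
  upper bound therefore follows by covering all hypergraphs with few convex sets on which \<open>t(H, \<cdot>)\<close>
  is almost constant. Balls in a cut norm, whose tests are products of functions of \<open>r - 1\<close>
  variables, serve this purpose: the energy decrement argument of Frieze and Kannan covers with
  \<open>exp (O(p\<^bsup>-2|E|\<^esup> n\<^bsup>r-1\<^esup>))\<close> of them, whereas \<open>\<phi> \<ge> c p\<^bsup>2|E|\<^esup> n\<^sup>r\<close>, and \<open>n p\<^bsup>4|E|\<^esup>\<close> tends to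
  infinity. The lower bound tilts the measure to a near-optimal weighting, under which the count is
  concentrated by Chebyshev's inequality.

  Both bounds lose a little in \<open>\<delta>\<close>, so \<open>\<phi>\<close> has to be continuous in \<open>\<delta>\<close> uniformly in \<open>n\<close>. Given
  \<open>G = p + U\<close>, either much of the excess over \<open>p\<^bsup>|E|\<^esup>\<close> comes from terms with a small factor of \<open>U\<close>,
  and the small values of \<open>U\<close> are scaled by \<open>1 + \<kappa>\<close>; or it comes from large values of \<open>U\<close>, and a
  randomly permuted copy of a cheap piece of the large part of \<open>U\<close> is planted on top of \<open>G\<close>.
\<close>

section \<open>Product measures on subsets and relative entropy\<close>

text \<open>The level set of \<open>homs\<close> is not convex, so a conditional mean may leave it.
  Convexity is used only on a cut-norm ball, at the price of an error proportional to the radius.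
  The radius must be a small multiple of \<open>p ^ card E\<close>, the size of the density itself;
  this is why the energy argument takes about \<open>1 / p ^ (2 * card E)\<close> steps. Functions
  of \<open>r - 1\<close> variables are few enough to count, and still rich enough as tests, because
  an edge other than \<open>e\<close> always misses a vertex of \<open>e\<close>.

  Continuity in \<open>\<delta>\<close> is not automatic, since the feasible set is not convex.
  Scaling all of \<open>U\<close> fails near the value \<open>1\<close>, where weights cannot grow.
  Hence the cut at \<open>1 / 4\<close>: below it scaling is harmless, and above it each factor is
  bounded below, so a planted nonzero term is at least \<open>(1 / 4) ^ card E\<close>.

  \<open>hom_density\<close> sums over all maps, whereas copies correspond to injective ones. The
  difference is a fraction of order \<open>1 / n\<close> of all maps, negligible against
  \<open>p ^ card E\<close> because \<open>n * p ^ card E\<close> tends to infinity.\<close>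

definition subset_weight :: "'b set \<Rightarrow> ('b \<Rightarrow> real) \<Rightarrow> 'b set \<Rightarrow> real" where
  "subset_weight R g D = (\<Prod>d\<in>D. g d) * (\<Prod>d\<in>R - D. 1 - g d)"

lemma subset_weight_nonneg:
  assumes "\<And>d. d \<in> R \<Longrightarrow> 0 \<le> g d \<and> g d \<le> 1" "D \<subseteq> R"
  shows "0 \<le> subset_weight R g D"
  unfolding subset_weight_def using assms by (intro mult_nonneg_nonneg prod_nonneg) auto

lemma subset_weight_pos:
  assumes "0 < p" "p < 1"
  shows "0 < subset_weight R (\<lambda>_. p) D"
  unfolding subset_weight_def using assms by (intro mult_pos_pos prod_pos) auto

lemma sum_subset_weight:
  assumes "finite R"
  shows "(\<Sum>D\<in>Pow R. subset_weight R g D) = 1"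
proof -
  have "(\<Prod>d\<in>R. g d + (1 - g d)) = (\<Sum>D\<in>Pow R. subset_weight R g D)"
    unfolding subset_weight_def by (rule prod_add[OF assms])
  thus ?thesis by simp
qed

text \<open>The probability that a random subset contains \<open>F\<close>. Replacing
  \<open>1 - g d\<close> by \<open>0\<close> for \<open>d \<in> F\<close> in the expansion of the
  product removes exactly the subsets that do not contain \<open>F\<close>.\<close>

lemma sum_subset_weight_superset:
  assumes R: "finite R" and F: "F \<subseteq> R"
  shows "(\<Sum>D\<in>Pow R. subset_weight R g D * (if F \<subseteq> D then 1 else 0)) = (\<Prod>d\<in>F. g d)"
proof -
  have "(\<Prod>d\<in>R. g d + (if d \<in> F then 0 else 1 - g d)) =
      (\<Sum>D\<in>Pow R. (\<Prod>d\<in>D. g d) * (\<Prod>d\<in>R - D. if d \<in> F then 0 else 1 - g d))"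
    by (rule prod_add[OF R])
  also have "\<dots> = (\<Sum>D\<in>Pow R. subset_weight R g D * (if F \<subseteq> D then 1 else 0))"
  proof (rule sum.cong[OF refl])
    fix D assume D: "D \<in> Pow R"
    show "(\<Prod>d\<in>D. g d) * (\<Prod>d\<in>R - D. if d \<in> F then 0 else 1 - g d) =
       subset_weight R g D * (if F \<subseteq> D then 1 else 0)"
    proof (cases "F \<subseteq> D")
      case True
      have "(\<Prod>d\<in>R - D. if d \<in> F then 0 else 1 - g d) = (\<Prod>d\<in>R - D. 1 - g d)"
        using True by (intro prod.cong) auto
      thus ?thesis using True by (simp add: subset_weight_def)
    next
      case False
      then obtain d where "d \<in> F" "d \<notin> D" by auto
      hence "(\<Prod>d\<in>R - D. if d \<in> F then 0 else 1 - g d) = 0"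
        using F R by (intro prod_zero) (auto intro!: bexI[of _ d])
      thus ?thesis using False by simp
    qed
  qed
  finally have "(\<Sum>D\<in>Pow R. subset_weight R g D * (if F \<subseteq> D then 1 else 0))
      = (\<Prod>d\<in>R. g d + (if d \<in> F then 0 else 1 - g d))" by simp
  also have "\<dots> = (\<Prod>d\<in>F. g d + (if d \<in> F then 0 else 1 - g d))"
    using R F by (intro prod.mono_neutral_right) auto
  also have "\<dots> = (\<Prod>d\<in>F. g d)"
    by (intro prod.cong) auto
  finally show ?thesis .
qed

lemma ln_subset_weight_ratio:
  assumes R: "finite R" and D: "D \<subseteq> R" and p: "0 < p" "p < 1"
    and g: "\<And>d. d \<in> R \<Longrightarrow> 0 \<le> g d \<and> g d \<le> 1" and pos: "subset_weight R g D > 0"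
  shows "ln (subset_weight R g D / subset_weight R (\<lambda>_. p) D) =
    (\<Sum>d\<in>R. if d \<in> D then ln (g d / p) else ln ((1 - g d) / (1 - p)))"
proof -
  have finD: "finite D" using R D finite_subset by blast
  have nz: "(\<Prod>d\<in>D. g d) \<noteq> 0" "(\<Prod>d\<in>R - D. 1 - g d) \<noteq> 0"
    using pos unfolding subset_weight_def by auto
  have gp: "g d > 0" if "d \<in> D" for d
  proof -
    have "g d \<noteq> 0" using nz(1) that finD by auto
    thus ?thesis using g[of d] that D by force
  qed
  have gq: "1 - g d > 0" if "d \<in> R - D" for d
  proof -
    have "1 - g d \<noteq> 0" using nz(2) that R by auto
    thus ?thesis using g[of d] that by force
  qed
  have "subset_weight R g D / subset_weight R (\<lambda>_. p) D =
     (\<Prod>d\<in>D. g d / p) * (\<Prod>d\<in>R - D. (1 - g d) / (1 - p))"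
    unfolding subset_weight_def by (simp add: prod_dividef)
  also have "ln \<dots> = ln (\<Prod>d\<in>D. g d / p) + ln (\<Prod>d\<in>R - D. (1 - g d) / (1 - p))"
    using gp gq p by (intro ln_mult_pos prod_pos) auto
  also have "\<dots> = (\<Sum>d\<in>D. ln (g d / p)) + (\<Sum>d\<in>R - D. ln ((1 - g d) / (1 - p)))"
  proof -
    have "g d \<noteq> 0" if "d \<in> D" for d using gp[OF that] by simp
    moreover have "g d \<noteq> 1" if "d \<in> R" "d \<notin> D" for d using gq[of d] that by simp
    ultimately show ?thesis using p R finD by (subst (1 2) ln_prod) auto
  qed
  also have "\<dots> = (\<Sum>d\<in>R. if d \<in> D then ln (g d / p) else ln ((1 - g d) / (1 - p)))"
  proof -
    have "R \<inter> {d. d \<in> D} = D" "R \<inter> - {d. d \<in> D} = R - D" using D by auto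
    thus ?thesis by (subst sum.If_cases[OF R]) simp
  qed
  finally show ?thesis .
qed

text \<open>This is \<open>ln u \<le> u - 1\<close> at \<open>u = s / t\<close>; for
  \<open>t = 0\<close> the left side is \<open>0\<close>. Summed over outcomes it gives Gibbs'
  inequality for measures of possibly different mass, on which both entropy inequalities below
  rest.\<close>

lemma mult_ln_ratio_ge:
  fixes s t :: real
  assumes "0 \<le> t" "0 < s"
  shows "t * ln (t / s) \<ge> t - s"
proof (cases "t = 0")
  case False
  hence t: "t > 0" using assms by simp
  have "ln (s / t) \<le> s / t - 1" using t assms by (intro ln_le_minus_one) auto
  hence "t * ln (s / t) \<le> s - t" using t by (simp add: field_simps)
  moreover have "ln (t / s) = - ln (s / t)" using t assms by (simp add: ln_div)
  ultimately show ?thesis by simp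
qed (use assms in auto)

lemma rel_entropy_nonneg:
  assumes "0 < p" "p < 1" "0 \<le> x" "x \<le> 1"
  shows "rel_entropy p x \<ge> 0"
  using mult_ln_ratio_ge[of x p] mult_ln_ratio_ge[of "1 - x" "1 - p"] assms
  unfolding rel_entropy_def by simp

lemma rel_entropy_self: "0 < p \<Longrightarrow> p < 1 \<Longrightarrow> rel_entropy p p = 0"
  by (simp add: rel_entropy_def)

text \<open>Conditioning on a set of outcomes has relative entropy minus the logarithm of its
  probability, and among all laws with given marginals the product law is the cheapest.\<close>

lemma entropy_conditional_mean_le:
  fixes R :: "'b set" and p :: real
  assumes R: "finite R" and p: "0 < p" "p < 1" and S: "S \<subseteq> Pow R" "S \<noteq> {}"
  defines "Z \<equiv> (\<Sum>D\<in>S. subset_weight R (\<lambda>_. p) D)"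
  defines "y \<equiv> (\<lambda>d. (\<Sum>D\<in>S. subset_weight R (\<lambda>_. p) D / Z * (if d \<in> D then 1 else 0)))"
  shows "(\<Sum>d\<in>R. rel_entropy p (y d)) \<le> - ln Z"
proof -
  define q where "q D = subset_weight R (\<lambda>_. p) D / Z" for D
  have finS: "finite S" using S R finite_subset by blast
  have wpos: "subset_weight R (\<lambda>_. p) D > 0" for D using p by (rule subset_weight_pos)
  have Z: "Z > 0" unfolding Z_def using S finS wpos by (intro sum_pos) auto
  have q: "q D > 0" for D using Z wpos by (simp add: q_def)
  have qsum: "(\<Sum>D\<in>S. q D) = 1"
    unfolding q_def using Z by (simp add: sum_divide_distrib[symmetric] Z_def[symmetric])
  have y: "y d = (\<Sum>D\<in>S. q D * (if d \<in> D then 1 else 0))" for d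
    unfolding y_def q_def ..
  have y': "1 - y d = (\<Sum>D\<in>S. q D * (if d \<in> D then 0 else 1))" for d
  proof -
    have "(\<Sum>D\<in>S. q D) - y d = (\<Sum>D\<in>S. q D * (if d \<in> D then 0 else 1))"
      unfolding y sum_subtractf[symmetric] by (intro sum.cong) auto
    thus ?thesis using qsum by simp
  qed
  have y0: "0 \<le> y d" for d unfolding y using q by (intro sum_nonneg) (auto simp: less_imp_le)
  have y1: "y d \<le> 1" for d
  proof -
    have "0 \<le> 1 - y d" unfolding y' using q by (intro sum_nonneg) (auto simp: less_imp_le)
    thus ?thesis by simp
  qed
  \<comment> \<open>Every outcome in \<open>S\<close> has positive weight under the product law with
    marginals \<open>y\<close>, so the logarithms below are genuine.\<close>
  have yw: "subset_weight R y D > 0" if "D \<in> S" for D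
  proof -
    have a: "y d > 0" if "d \<in> D" for d
    proof -
      have "q D * (if d \<in> D then 1 else 0) \<le> y d"
        unfolding y using finS \<open>D \<in> S\<close> q by (intro member_le_sum) (auto simp: less_imp_le)
      thus ?thesis using that q[of D] by auto
    qed
    have b: "1 - y d > 0" if "d \<notin> D" for d
    proof -
      have "q D * (if d \<in> D then 0 else 1) \<le> 1 - y d"
        unfolding y' using finS \<open>D \<in> S\<close> q by (intro member_le_sum) (auto simp: less_imp_le)
      thus ?thesis using that q[of D] by auto
    qed
    show ?thesis unfolding subset_weight_def using a b by (intro mult_pos_pos prod_pos) auto
  qed
  \<comment> \<open>The log-ratio of two product weights is a sum over coordinates, so its mean
    under \<open>q\<close> depends only on the marginals \<open>y\<close>. Read backwards, this
    turns the sum of relative entropies into a mean over \<open>S\<close>.\<close>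
  have "(\<Sum>d\<in>R. rel_entropy p (y d)) =
     (\<Sum>d\<in>R. \<Sum>D\<in>S. q D * (if d \<in> D then ln (y d / p) else ln ((1 - y d) / (1 - p))))"
  proof (rule sum.cong[OF refl])
    fix d
    have "rel_entropy p (y d) = (\<Sum>D\<in>S. q D * (if d \<in> D then 1 else 0)) * ln (y d / p)
       + (\<Sum>D\<in>S. q D * (if d \<in> D then 0 else 1)) * ln ((1 - y d) / (1 - p))"
      unfolding rel_entropy_def y'[symmetric] y[symmetric] ..
    also have "\<dots> = (\<Sum>D\<in>S. q D * (if d \<in> D then ln (y d / p) else ln ((1 - y d) / (1 - p))))"
      unfolding sum_distrib_right sum.distrib[symmetric] by (intro sum.cong) auto
    finally show "rel_entropy p (y d) = \<dots>" .
  qed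
  also have "\<dots> = (\<Sum>D\<in>S. q D * (\<Sum>d\<in>R. if d \<in> D then ln (y d / p) else ln ((1 - y d) / (1 - p))))"
    unfolding sum_distrib_left by (rule sum.swap)
  also have "\<dots> = (\<Sum>D\<in>S. q D * ln (subset_weight R y D / subset_weight R (\<lambda>_. p) D))"
  proof (rule sum.cong[OF refl])
    fix D assume D: "D \<in> S"
    show "q D * (\<Sum>d\<in>R. if d \<in> D then ln (y d / p) else ln ((1 - y d) / (1 - p))) =
      q D * ln (subset_weight R y D / subset_weight R (\<lambda>_. p) D)"
      using ln_subset_weight_ratio[OF R _ p, of D y] D S y0 y1 yw by auto
  qed
  \<comment> \<open>As \<open>q\<close> is the original weight divided by \<open>Z\<close>, the
    log-ratio against the original weight equals the one against \<open>q\<close> minus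
    \<open>ln Z\<close>. Gibbs' inequality makes the mean of the former nonpositive.\<close>
  also have "\<dots> \<le> (\<Sum>D\<in>S. (subset_weight R y D - q D) + q D * (- ln Z))"
  proof (rule sum_mono)
    fix D assume D: "D \<in> S"
    have 1: "q D * ln (q D / subset_weight R y D) \<ge> q D - subset_weight R y D"
      using q[of D] yw[OF D] by (intro mult_ln_ratio_ge) auto
    have 2: "ln (subset_weight R y D / subset_weight R (\<lambda>_. p) D) =
       - ln (q D / subset_weight R y D) - ln Z"
      using yw[OF D] wpos[of D] Z by (simp add: q_def ln_div ln_mult_pos)
    show "q D * ln (subset_weight R y D / subset_weight R (\<lambda>_. p) D)
        \<le> (subset_weight R y D - q D) + q D * (- ln Z)"
      using 1 unfolding 2 right_diff_distrib by simp
  qed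
  also have "\<dots> = (\<Sum>D\<in>S. subset_weight R y D) - 1 - ln Z"
    by (simp add: sum.distrib sum_subtractf qsum sum_distrib_right[symmetric]
        sum_negf)
  also have "(\<Sum>D\<in>S. subset_weight R y D) \<le> (\<Sum>D\<in>Pow R. subset_weight R y D)"
    using R S y0 y1 by (intro sum_mono2 subset_weight_nonneg) auto
  also have "\<dots> = 1" by (rule sum_subset_weight[OF R])
  finally show ?thesis by simp
qed

text \<open>The data processing inequality for the indicator of \<open>S\<close>, with the binary entropy
  bounded by \<open>1\<close>.\<close>

lemma entropy_ge_tilted_prob:
  fixes R :: "'b set" and p :: real
  assumes R: "finite R" and p: "0 < p" "p < 1" and S: "S \<subseteq> Pow R"
    and g: "\<And>d. d \<in> R \<Longrightarrow> 0 \<le> g d \<and> g d \<le> 1"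
  defines "Z \<equiv> (\<Sum>D\<in>S. subset_weight R (\<lambda>_. p) D)"
  defines "a \<equiv> (\<Sum>D\<in>S. subset_weight R g D)"
  shows "(\<Sum>d\<in>R. rel_entropy p (g d)) \<ge> - a * ln Z - 1"
proof -
  let ?w = "subset_weight R g" and ?u = "subset_weight R (\<lambda>_. p)"
  have finP: "finite (Pow R)" and finS: "finite S" using S R finite_subset by blast+
  have upos: "?u D > 0" for D using p by (rule subset_weight_pos)
  have w0: "?w D \<ge> 0" if "D \<in> Pow R" for D using that g by (intro subset_weight_nonneg) auto
  have one: "(\<Sum>D\<in>Pow R. ?w D * (if d \<in> D then 1 else 0)) = g d" if "d \<in> R" for d
    using sum_subset_weight_superset[OF R, of "{d}" g] that by simp
  have two: "(\<Sum>D\<in>Pow R. ?w D * (if d \<in> D then 0 else 1)) = 1 - g d" if "d \<in> R" for d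
  proof -
    have "(\<Sum>D\<in>Pow R. ?w D) - (\<Sum>D\<in>Pow R. ?w D * (if d \<in> D then 1 else 0)) =
        (\<Sum>D\<in>Pow R. ?w D * (if d \<in> D then 0 else 1))"
      unfolding sum_subtractf[symmetric] by (intro sum.cong) auto
    thus ?thesis using one[OF that] sum_subset_weight[OF R, of g] by simp
  qed
  have "(\<Sum>d\<in>R. rel_entropy p (g d)) =
     (\<Sum>d\<in>R. \<Sum>D\<in>Pow R. ?w D * (if d \<in> D then ln (g d / p) else ln ((1 - g d) / (1 - p))))"
  proof (rule sum.cong[OF refl])
    fix d assume d: "d \<in> R"
    have "rel_entropy p (g d) = (\<Sum>D\<in>Pow R. ?w D * (if d \<in> D then 1 else 0)) * ln (g d / p)
       + (\<Sum>D\<in>Pow R. ?w D * (if d \<in> D then 0 else 1)) * ln ((1 - g d) / (1 - p))"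
      unfolding rel_entropy_def one[OF d] two[OF d] ..
    also have "\<dots> = (\<Sum>D\<in>Pow R. ?w D * (if d \<in> D then ln (g d / p) else ln ((1 - g d) / (1 - p))))"
      unfolding sum_distrib_right sum.distrib[symmetric] by (intro sum.cong) auto
    finally show "rel_entropy p (g d) = \<dots>" .
  qed
  also have "\<dots> = (\<Sum>D\<in>Pow R. ?w D * (\<Sum>d\<in>R. if d \<in> D then ln (g d / p) else ln ((1 - g d) / (1 - p))))"
    unfolding sum_distrib_left by (rule sum.swap)
  also have "\<dots> = (\<Sum>D\<in>Pow R. ?w D * ln (?w D / ?u D))"
  proof (rule sum.cong[OF refl])
    fix D assume D: "D \<in> Pow R"
    show "?w D * (\<Sum>d\<in>R. if d \<in> D then ln (g d / p) else ln ((1 - g d) / (1 - p))) =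
      ?w D * ln (?w D / ?u D)"
      using ln_subset_weight_ratio[OF R _ p, of D g] D g w0[OF D] by (cases "?w D = 0") auto
  qed
  also have "\<dots> = (\<Sum>D\<in>S. ?w D * ln (?w D / ?u D)) + (\<Sum>D\<in>Pow R - S. ?w D * ln (?w D / ?u D))"
    using sum.subset_diff[OF S finP, of "\<lambda>D. ?w D * ln (?w D / ?u D)"] by simp
  finally have eq: "(\<Sum>d\<in>R. rel_entropy p (g d)) =
     (\<Sum>D\<in>S. ?w D * ln (?w D / ?u D)) + (\<Sum>D\<in>Pow R - S. ?w D * ln (?w D / ?u D))" .
  have Z0: "Z \<ge> 0" unfolding Z_def by (intro sum_nonneg) (simp add: upos less_imp_le)
  have a0: "a \<ge> 0" unfolding a_def using S w0 by (intro sum_nonneg) auto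
  have a1: "a + (\<Sum>D\<in>Pow R - S. ?w D) = 1"
    unfolding a_def using sum.subset_diff[OF S finP, of ?w] sum_subset_weight[OF R, of g] by simp
  have z1: "Z + (\<Sum>D\<in>Pow R - S. ?u D) = 1"
    unfolding Z_def using sum.subset_diff[OF S finP, of ?u] sum_subset_weight[OF R, of "\<lambda>_. p"] by simp
  have "(\<Sum>D\<in>Pow R - S. ?w D * ln (?w D / ?u D)) \<ge> (\<Sum>D\<in>Pow R - S. ?w D - ?u D)"
    using w0 upos by (intro sum_mono mult_ln_ratio_ge) auto
  hence out: "(\<Sum>D\<in>Pow R - S. ?w D * ln (?w D / ?u D)) \<ge> Z - a"
    using a1 z1 by (simp add: sum_subtractf)
  \<comment> \<open>The log-sum inequality on \<open>S\<close>, followed by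
    \<open>a * ln a \<ge> a - 1\<close>. With the contribution \<open>Z - a\<close> from outside
    \<open>S\<close> this leaves \<open>- a * ln Z - 1 + Z\<close>.\<close>
  have inn: "(\<Sum>D\<in>S. ?w D * ln (?w D / ?u D)) \<ge> (a - 1) - a * ln Z"
  proof (cases "a = 0")
    case True
    hence "?w D = 0" if "D \<in> S" for D
      using that finS S w0 unfolding a_def by (subst (asm) sum_nonneg_eq_0_iff) auto
    thus ?thesis using True by simp
  next
    case False
    hence ap: "a > 0" using a0 by simp
    hence "S \<noteq> {}" unfolding a_def by auto
    hence Zp: "Z > 0" unfolding Z_def using finS upos by (intro sum_pos) auto
    \<comment> \<open>Rescaled by \<open>a / Z\<close>, the reference weights have total mass
      \<open>a\<close> on \<open>S\<close>, so the linear terms cancel in the sum.\<close>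
    have "?w D * ln (?w D / ?u D) \<ge> (?w D - ?u D * (a / Z)) + ?w D * ln (a / Z)" if "D \<in> S" for D
    proof (cases "?w D = 0")
      case True thus ?thesis using upos[of D] ap Zp by simp
    next
      case False
      hence wp: "?w D > 0" using w0[of D] that S by force
      have 1: "?w D * ln (?w D / (?u D * (a / Z))) \<ge> ?w D - ?u D * (a / Z)"
        using wp upos[of D] ap Zp by (intro mult_ln_ratio_ge) auto
      have 2: "ln (?w D / (?u D * (a / Z))) = ln (?w D / ?u D) - ln (a / Z)"
        using wp upos[of D] ap Zp by (simp add: ln_div ln_mult_pos)
      show ?thesis using 1 unfolding 2 right_diff_distrib by linarith
    qed
    hence "(\<Sum>D\<in>S. ?w D * ln (?w D / ?u D)) \<ge> (\<Sum>D\<in>S. (?w D - ?u D * (a / Z)) + ?w D * ln (a / Z))"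
      by (intro sum_mono) auto
    also have "(\<Sum>D\<in>S. (?w D - ?u D * (a / Z)) + ?w D * ln (a / Z)) =
        a - Z * (a / Z) + a * ln (a / Z)"
      by (simp only: sum.distrib sum_subtractf sum_distrib_right[symmetric]
          a_def[symmetric] Z_def[symmetric])
    also have "\<dots> = a * ln a - a * ln Z" using ap Zp by (simp add: ln_div algebra_simps)
    finally show ?thesis using mult_ln_ratio_ge[of a 1] ap by simp
  qed
  show ?thesis using eq inn out Z0 by simp
qed

section \<open>The random hypergraph\<close>

lemma finite_r_subsets [simp]: "finite (r_subsets r n)"
  unfolding r_subsets_def by (rule finite_subset[of _ "Pow {1..n}"]) auto

lemma card_r_subsets_le: "card (r_subsets r n) \<le> n ^ r"
proof -
  have "card (r_subsets r n) = n choose r"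
    unfolding r_subsets_def using n_subsets[of "{1..n}" r] by simp
  also have "\<dots> \<le> n ^ r"
    by (cases "r \<le> n") (auto simp: binomial_le_pow binomial_eq_0)
  finally show ?thesis .
qed

lemma pmf_random_hypergraph:
  assumes "0 \<le> p" "p \<le> 1" "D \<subseteq> r_subsets r n"
  shows "pmf (random_hypergraph r n p) D = subset_weight (r_subsets r n) (\<lambda>_. p) D"
proof -
  let ?R = "r_subsets r n"
  let ?P = "Pi_pmf ?R False (\<lambda>_. bernoulli_pmf p)"
  have "pmf (random_hypergraph r n p) D =
     measure_pmf.prob ?P ((\<lambda>b. {e \<in> ?R. b e}) -` {D})"
    unfolding random_hypergraph_def by (rule pmf_map)
  also have "\<dots> = measure_pmf.prob ?P {\<lambda>e. e \<in> D}"
  proof (rule measure_prob_cong_0)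
    fix b assume b: "b \<in> (\<lambda>b. {e \<in> ?R. b e}) -` {D} - {\<lambda>e. e \<in> D}"
    have "\<exists>e. e \<notin> ?R \<and> b e \<noteq> False"
    proof (rule ccontr)
      assume "\<not> ?thesis"
      hence "b = (\<lambda>e. e \<in> D)" using b by fastforce
      thus False using b by auto
    qed
    thus "pmf ?P b = 0" by (intro pmf_Pi_outside) auto
  next
    fix b assume "b \<in> {\<lambda>e. e \<in> D} - (\<lambda>b. {e \<in> ?R. b e}) -` {D}"
    thus "pmf ?P b = 0" using assms(3) by auto
  qed
  also have "\<dots> = pmf ?P (\<lambda>e. e \<in> D)" by (simp add: pmf.rep_eq)
  also have "\<dots> = (\<Prod>e\<in>?R. pmf (bernoulli_pmf p) (e \<in> D))"
    using assms(3) by (intro pmf_Pi') auto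
  also have "\<dots> = (\<Prod>e\<in>?R. if e \<in> D then p else 1 - p)"
    using assms by (intro prod.cong) auto
  also have "\<dots> = subset_weight ?R (\<lambda>_. p) D"
  proof -
    have "?R \<inter> {e. e \<in> D} = D" "?R \<inter> - {e. e \<in> D} = ?R - D" using assms(3) by auto
    thus ?thesis unfolding subset_weight_def by (subst prod.If_cases) auto
  qed
  finally show ?thesis .
qed

lemma set_pmf_random_hypergraph: "set_pmf (random_hypergraph r n p) \<subseteq> Pow (r_subsets r n)"
  unfolding random_hypergraph_def by auto

lemma prob_random_hypergraph:
  assumes "0 \<le> p" "p \<le> 1"
  shows "measure_pmf.prob (random_hypergraph r n p) A =
    (\<Sum>D\<in>Pow (r_subsets r n) \<inter> A. subset_weight (r_subsets r n) (\<lambda>_. p) D)"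
proof -
  have "measure_pmf.prob (random_hypergraph r n p) A =
      measure_pmf.prob (random_hypergraph r n p) (Pow (r_subsets r n) \<inter> A)"
    using set_pmf_random_hypergraph[of r n p]
    by (intro measure_prob_cong_0) (auto simp: set_pmf_iff)
  also have "\<dots> = (\<Sum>D\<in>Pow (r_subsets r n) \<inter> A. pmf (random_hypergraph r n p) D)"
    by (intro measure_measure_pmf_finite) auto
  also have "\<dots> = (\<Sum>D\<in>Pow (r_subsets r n) \<inter> A. subset_weight (r_subsets r n) (\<lambda>_. p) D)"
    using assms by (intro sum.cong pmf_random_hypergraph) auto
  finally show ?thesis .
qed

lemma expectation_random_hypergraph:
  assumes "0 \<le> p" "p \<le> 1"
  shows "measure_pmf.expectation (random_hypergraph r n p) f =
    (\<Sum>D\<in>Pow (r_subsets r n). subset_weight (r_subsets r n) (\<lambda>_. p) D * f D)"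
proof -
  have "measure_pmf.expectation (random_hypergraph r n p) f =
     (\<Sum>D\<in>Pow (r_subsets r n). f D * pmf (random_hypergraph r n p) D)"
    using set_pmf_random_hypergraph[of r n p] by (intro integral_measure_pmf_real) auto
  also have "\<dots> = (\<Sum>D\<in>Pow (r_subsets r n). subset_weight (r_subsets r n) (\<lambda>_. p) D * f D)"
    using assms by (intro sum.cong) (auto simp: pmf_random_hypergraph)
  finally show ?thesis .
qed

declare One_nat_def [simp del]

section \<open>Homomorphism counts\<close>

lemma sum_PiE_split:
  assumes "e \<subseteq> V"
  shows "(\<Sum>x\<in>V \<rightarrow>\<^sub>E A. f x) =
    (\<Sum>z\<in>(V - e) \<rightarrow>\<^sub>E A. \<Sum>y\<in>e \<rightarrow>\<^sub>E A. f (\<lambda>i. if i \<in> e then y i else z i))"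
  unfolding sum.cartesian_product
proof (rule sum.reindex_bij_witness[where i = "\<lambda>(z, y) i. if i \<in> e then y i else z i"
      and j = "\<lambda>x. (restrict x (V - e), restrict x e)"])
  fix x assume x: "x \<in> V \<rightarrow>\<^sub>E A"
  show eq: "(case (restrict x (V - e), restrict x e) of (z, y) \<Rightarrow> \<lambda>i. if i \<in> e then y i else z i) = x"
    using x by (auto simp: fun_eq_iff PiE_def extensional_def restrict_def)
  show "(restrict x (V - e), restrict x e) \<in> ((V - e) \<rightarrow>\<^sub>E A) \<times> (e \<rightarrow>\<^sub>E A)"
    using x assms by (auto simp: PiE_def Pi_def)
  show "(case (restrict x (V - e), restrict x e) of (z, y) \<Rightarrow> f (\<lambda>i. if i \<in> e then y i else z i)) = f x"
    using eq by simp
next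
  fix zy assume "zy \<in> ((V - e) \<rightarrow>\<^sub>E A) \<times> (e \<rightarrow>\<^sub>E A)"
  then obtain z y where zy: "zy = (z, y)" "z \<in> (V - e) \<rightarrow>\<^sub>E A" "y \<in> e \<rightarrow>\<^sub>E A" by auto
  let ?x = "case zy of (z, y) \<Rightarrow> \<lambda>i. if i \<in> e then y i else z i"
  show "?x \<in> V \<rightarrow>\<^sub>E A"
    using zy assms by (auto simp: PiE_def Pi_def extensional_def)
  have "restrict ?x (V - e) = z" "restrict ?x e = y"
    using zy by (auto simp: fun_eq_iff PiE_def extensional_def restrict_def)
  thus "(restrict ?x (V - e), restrict ?x e) = zy" using zy by simp
qed

definition weighting :: "nat \<Rightarrow> nat \<Rightarrow> (nat set \<Rightarrow> real) \<Rightarrow> bool" where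
  "weighting r n g \<longleftrightarrow> (\<forall>d\<in>r_subsets r n. 0 \<le> g d \<and> g d \<le> 1)"

definition entropy :: "nat \<Rightarrow> nat \<Rightarrow> real \<Rightarrow> (nat set \<Rightarrow> real) \<Rightarrow> real" where
  "entropy r n p g = (\<Sum>d\<in>r_subsets r n. rel_entropy p (g d))"

text \<open>Extension by \<open>0\<close>: a map that is not injective on an edge sends it to a set
  with fewer than \<open>r\<close> elements, so this reproduces the convention that \<open>G\<close>
  vanishes on tuples with repeated entries.\<close>

definition edge_value :: "nat \<Rightarrow> nat \<Rightarrow> (nat set \<Rightarrow> real) \<Rightarrow> nat set \<Rightarrow> real" where
  "edge_value r n g d = (if d \<in> r_subsets r n then g d else 0)"

lemma entropy_nonneg:
  assumes "0 < p" "p < 1" "weighting r n g"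
  shows "entropy r n p g \<ge> 0"
  unfolding entropy_def using assms
  by (intro sum_nonneg rel_entropy_nonneg) (auto simp: weighting_def)

locale hypergraph =
  fixes r :: nat and V :: "'a set" and E :: "'a set set"
  assumes r_pos: "r \<ge> 1" and uniform: "uniform_hypergraph r V E" and E_nonempty: "E \<noteq> {}"
begin

lemma finite_V [simp]: "finite V" and edge_subset: "e \<in> E \<Longrightarrow> e \<subseteq> V"
  and card_edge: "e \<in> E \<Longrightarrow> card e = r"
  using uniform by (auto simp: uniform_hypergraph_def)

lemma finite_E [simp]: "finite E"
  by (rule finite_subset[of _ "Pow V"]) (use edge_subset in auto)

lemma finite_edge: "e \<in> E \<Longrightarrow> finite e"
  using edge_subset finite_subset by fastforce

lemma card_E_pos: "card E \<ge> 1"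
  using E_nonempty by (simp add: One_nat_def Suc_le_eq card_gt_0_iff)

lemma r_le_card_V: "r \<le> card V"
proof -
  obtain e where "e \<in> E" using E_nonempty by auto
  thus ?thesis using card_edge edge_subset card_mono[OF finite_V] by metis
qed

lemma card_V_pos: "card V \<ge> 1"
  using r_le_card_V r_pos by simp

definition injections :: "nat \<Rightarrow> ('a \<Rightarrow> nat) set" where
  "injections n = {x \<in> V \<rightarrow>\<^sub>E {1..n}. inj_on x V}"

definition inj_homs :: "nat \<Rightarrow> (nat set \<Rightarrow> real) \<Rightarrow> real" where
  "inj_homs n g = (\<Sum>x\<in>injections n. \<Prod>e\<in>E. g (x ` e))"

text \<open>Up to normalisation this is \<open>t(H, g)\<close>, the quantity that the cut-norm tests
  control; \<open>inj_homs\<close> is the one that copies and expectations see.\<close>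

definition homs :: "nat \<Rightarrow> (nat set \<Rightarrow> real) \<Rightarrow> real" where
  "homs n g = (\<Sum>x\<in>V \<rightarrow>\<^sub>E {1..n}. \<Prod>e\<in>E. edge_value r n g (x ` e))"

lemma finite_maps [simp]: "finite (V \<rightarrow>\<^sub>E {1..n::nat})"
  by (intro finite_PiE) auto

lemma card_maps: "card (V \<rightarrow>\<^sub>E {1..n::nat}) = n ^ card V"
  by (simp add: card_PiE)

lemma finite_injections [simp]: "finite (injections n)"
  unfolding injections_def by (rule finite_subset[OF _ finite_maps]) auto

lemma injections_subset: "injections n \<subseteq> V \<rightarrow>\<^sub>E {1..n}"
  unfolding injections_def by auto

lemma card_injections_le: "real (card (injections n)) \<le> real n ^ card V"
proof -
  have "card (injections n) \<le> n ^ card V"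
    using card_mono[OF finite_maps injections_subset, of n] by (simp add: card_maps)
  thus ?thesis by (metis of_nat_le_iff of_nat_power)
qed

lemma map_edge_in_r_subsets:
  assumes "x \<in> V \<rightarrow>\<^sub>E {1..n}" "e \<in> E"
  shows "x ` e \<in> r_subsets r n \<longleftrightarrow> inj_on x e"
proof -
  have "x ` e \<subseteq> {1..n}" using assms edge_subset by fastforce
  moreover have "card (x ` e) = r \<longleftrightarrow> inj_on x e"
    using eq_card_imp_inj_on[OF finite_edge[OF assms(2)], of x] card_image[of x e]
      card_edge[OF assms(2)] by auto
  ultimately show ?thesis by (simp add: r_subsets_def)
qed

lemma injection_edge_in_r_subsets:
  assumes "x \<in> injections n" "e \<in> E"
  shows "x ` e \<in> r_subsets r n"
  using assms map_edge_in_r_subsets[of x n e] edge_subset inj_on_subset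
  by (fastforce simp: injections_def)

lemma injection_edge_inj:
  assumes "x \<in> injections n"
  shows "inj_on ((`) x) E"
  using assms edge_subset by (intro inj_onI) (auto simp: injections_def inj_on_image_eq_iff)

text \<open>Applied with \<open>f\<close> reading another coordinate, to count collisions, and with
  constant \<open>f\<close>, to count maps through a prescribed vertex.\<close>

lemma card_maps_determined_le:
  fixes n :: nat
  assumes i: "i \<in> V" and X: "X \<subseteq> V \<rightarrow>\<^sub>E {1..n}" and f: "\<And>x. x \<in> X \<Longrightarrow> x i = f (restrict x (V - {i}))"
  shows "card X \<le> n ^ (card V - 1)"
proof -
  have "inj_on (\<lambda>x. restrict x (V - {i})) X"
  proof (rule inj_onI)
    fix x y assume x: "x \<in> X" and y: "y \<in> X" and eq: "restrict x (V - {i}) = restrict y (V - {i})"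
    have "x k = y k" if "k \<in> V" for k
    proof (cases "k = i")
      case True thus ?thesis using f[OF x] f[OF y] eq by simp
    next
      case False thus ?thesis using fun_cong[OF eq, of k] that by simp
    qed
    thus "x = y" using PiE_ext[OF subsetD[OF X x] subsetD[OF X y]] by blast
  qed
  moreover have "(\<lambda>x. restrict x (V - {i})) ` X \<subseteq> (V - {i}) \<rightarrow>\<^sub>E {1..n}"
    using X by (auto simp: PiE_def Pi_def)
  ultimately have "card X \<le> card ((V - {i}) \<rightarrow>\<^sub>E {1..n})"
    by (intro card_inj_on_le) (auto intro!: finite_PiE)
  thus ?thesis using i by (simp add: card_PiE)
qed

lemma card_non_injections_le:
  assumes n: "n \<ge> 1"
  shows "real n ^ card V - real (card (injections n)) \<le> (real (card V))\<^sup>2 * real n ^ card V / real n"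
proof -
  define B where "B = (\<lambda>(i, j). {x \<in> V \<rightarrow>\<^sub>E {1..n}. x i = x j})"
  define I where "I = {(i, j) \<in> V \<times> V. i \<noteq> j}"
  have finI: "finite I" unfolding I_def by (rule finite_subset[of _ "V \<times> V"]) auto
  have cI: "card I \<le> card V * card V"
    unfolding I_def using card_mono[of "V \<times> V" "{(i, j) \<in> V \<times> V. i \<noteq> j}"]
    by (auto simp: card_cartesian_product)
  have cB: "card (B ij) \<le> n ^ (card V - 1)" if "ij \<in> I" for ij
  proof -
    obtain i j where ij: "ij = (i, j)" "i \<in> V" "j \<in> V" "i \<noteq> j" using \<open>ij \<in> I\<close> unfolding I_def by auto
    show ?thesis
    proof (rule card_maps_determined_le[OF ij(2), where f = "\<lambda>x. x j"])
      show "B ij \<subseteq> V \<rightarrow>\<^sub>E {1..n}" unfolding B_def ij(1) by blast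
      show "x i = restrict x (V - {i}) j" if "x \<in> B ij" for x using that ij by (simp add: B_def)
    qed
  qed
  have "(V \<rightarrow>\<^sub>E {1..n}) - injections n \<subseteq> (\<Union>ij\<in>I. B ij)"
  proof
    fix x assume x: "x \<in> (V \<rightarrow>\<^sub>E {1..n}) - injections n"
    then obtain i j where "i \<in> V" "j \<in> V" "i \<noteq> j" "x i = x j"
      unfolding injections_def inj_on_def by blast
    thus "x \<in> (\<Union>ij\<in>I. B ij)" using x unfolding I_def B_def by blast
  qed
  hence "card ((V \<rightarrow>\<^sub>E {1..n}) - injections n) \<le> card (\<Union>ij\<in>I. B ij)"
    using finI by (intro card_mono) (auto simp: B_def intro: finite_subset[OF _ finite_maps])
  also have "\<dots> \<le> (\<Sum>ij\<in>I. card (B ij))" by (rule card_UN_le[OF finI])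
  also have "\<dots> \<le> card I * n ^ (card V - 1)" using sum_bounded_above[of I "\<lambda>ij. card (B ij)", OF cB] by simp
  also have "\<dots> \<le> (card V * card V) * n ^ (card V - 1)" using cI by simp
  finally have "card ((V \<rightarrow>\<^sub>E {1..n}) - injections n) \<le> (card V * card V) * n ^ (card V - 1)" .
  moreover have "card ((V \<rightarrow>\<^sub>E {1..n}) - injections n) = n ^ card V - card (injections n)"
    using injections_subset by (subst card_Diff_subset) (auto simp: card_maps)
  ultimately have "n ^ card V - card (injections n) \<le> (card V * card V) * n ^ (card V - 1)" by simp
  hence "n ^ card V \<le> (card V * card V) * n ^ (card V - 1) + card (injections n)" by simp
  hence "real (n ^ card V) \<le> real ((card V * card V) * n ^ (card V - 1) + card (injections n))"
    by (rule of_nat_mono)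
  moreover have "real n ^ card V / real n = real n ^ (card V - 1)"
    using n card_V_pos by (simp add: power_diff)
  moreover have "(real (card V))\<^sup>2 * real n ^ card V / real n =
      (real (card V))\<^sup>2 * (real n ^ card V / real n)" by simp
  ultimately show ?thesis by (simp only:) (simp add: power2_eq_square)
qed

lemma weighting_edge_value: "weighting r n g \<Longrightarrow> 0 \<le> edge_value r n g d \<and> edge_value r n g d \<le> 1"
  by (simp add: weighting_def edge_value_def)

lemma homs_eq_inj_homs_plus:
  "homs n g = inj_homs n g + (\<Sum>x\<in>(V \<rightarrow>\<^sub>E {1..n}) - injections n. \<Prod>e\<in>E. edge_value r n g (x ` e))"
proof -
  have "(\<Sum>x\<in>injections n. \<Prod>e\<in>E. edge_value r n g (x ` e)) = inj_homs n g"
    unfolding inj_homs_def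
    by (intro sum.cong prod.cong) (auto simp: edge_value_def injection_edge_in_r_subsets)
  thus ?thesis unfolding homs_def
    using sum.subset_diff[OF injections_subset finite_maps,
        of "\<lambda>x. \<Prod>e\<in>E. edge_value r n g (x ` e)" n] by simp
qed

lemma inj_homs_le_homs:
  assumes "weighting r n g"
  shows "inj_homs n g \<le> homs n g"
  unfolding homs_eq_inj_homs_plus using weighting_edge_value[OF assms]
  by (simp add: sum_nonneg prod_nonneg)

lemma homs_le_inj_homs:
  assumes g: "weighting r n g" and n: "n \<ge> 1"
  shows "homs n g \<le> inj_homs n g + (real (card V))\<^sup>2 * real n ^ card V / real n"
proof -
  have "(\<Sum>x\<in>(V \<rightarrow>\<^sub>E {1..n}) - injections n. \<Prod>e\<in>E. edge_value r n g (x ` e)) \<le>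
     real (card ((V \<rightarrow>\<^sub>E {1..n}) - injections n)) * 1"
    using weighting_edge_value[OF g] by (intro sum_bounded_above prod_le_1) auto
  also have "\<dots> = real n ^ card V - real (card (injections n))"
    using injections_subset card_mono[OF finite_maps injections_subset, of n]
    by (subst card_Diff_subset) (auto simp: card_maps of_nat_diff)
  also have "\<dots> \<le> (real (card V))\<^sup>2 * real n ^ card V / real n"
    by (rule card_non_injections_le[OF n])
  finally show ?thesis unfolding homs_eq_inj_homs_plus by simp
qed

text \<open>An \<open>r\<close>-set is the image of at most \<open>r ^ r\<close> maps from
  \<open>e\<close>; this crude substitute for the factorial only affects constants.\<close>

lemma sum_edge_maps_le:
  assumes e: "e \<in> E" and f: "\<And>d. d \<in> r_subsets r n \<Longrightarrow> 0 \<le> f d"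
  shows "(\<Sum>y\<in>e \<rightarrow>\<^sub>E {1..n}. edge_value r n f (y ` e)) \<le> real (r ^ r) * (\<Sum>d\<in>r_subsets r n. f d)"
proof -
  have fin: "finite (e \<rightarrow>\<^sub>E {1..n})" using finite_edge[OF e] by (intro finite_PiE) auto
  have "(\<Sum>y\<in>e \<rightarrow>\<^sub>E {1..n}. edge_value r n f (y ` e)) =
     (\<Sum>y\<in>e \<rightarrow>\<^sub>E {1..n}. \<Sum>d\<in>r_subsets r n. if y ` e = d then f d else 0)"
    by (intro sum.cong) (auto simp: edge_value_def sum.delta')
  also have "\<dots> = (\<Sum>d\<in>r_subsets r n. \<Sum>y\<in>e \<rightarrow>\<^sub>E {1..n}. if y ` e = d then f d else 0)"
    by (rule sum.swap)
  also have "\<dots> \<le> (\<Sum>d\<in>r_subsets r n. real (r ^ r) * f d)"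
  proof (rule sum_mono)
    fix d assume d: "d \<in> r_subsets r n"
    hence find: "finite d" and cd: "card d = r" by (auto simp: r_subsets_def intro: finite_subset)
    have "(\<Sum>y\<in>e \<rightarrow>\<^sub>E {1..n}. if y ` e = d then f d else 0) =
       real (card {y \<in> e \<rightarrow>\<^sub>E {1..n}. y ` e = d}) * f d"
      using fin by (simp add: sum.If_cases Int_def)
    also have "\<dots> \<le> real (r ^ r) * f d"
    proof -
      have "card {y \<in> e \<rightarrow>\<^sub>E {1..n}. y ` e = d} \<le> card (e \<rightarrow>\<^sub>E d)"
        using find finite_edge[OF e] by (intro card_mono finite_PiE) (auto simp: PiE_def Pi_def)
      also have "\<dots> = r ^ r" using card_edge[OF e] finite_edge[OF e] cd by (simp add: card_PiE)
      finally show ?thesis using f[OF d] by (intro mult_right_mono) auto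
    qed
    finally show "(\<Sum>y\<in>e \<rightarrow>\<^sub>E {1..n}. if y ` e = d then f d else 0) \<le> real (r ^ r) * f d" .
  qed
  finally show ?thesis by (simp add: sum_distrib_left)
qed

lemma card_maps_off_edge:
  assumes "e \<in> E"
  shows "card ((V - e) \<rightarrow>\<^sub>E {1..n::nat}) = n ^ (card V - r)"
  using assms card_edge edge_subset finite_edge by (simp add: card_PiE card_Diff_subset)

lemma sum_maps_edge_le:
  assumes e: "e \<in> E" and f: "\<And>d. d \<in> r_subsets r n \<Longrightarrow> 0 \<le> f d"
  shows "(\<Sum>x\<in>V \<rightarrow>\<^sub>E {1..n}. edge_value r n f (x ` e)) \<le>
    real n ^ (card V - r) * real (r ^ r) * (\<Sum>d\<in>r_subsets r n. f d)"
proof -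
  have "(\<Sum>x\<in>V \<rightarrow>\<^sub>E {1..n}. edge_value r n f (x ` e)) =
    (\<Sum>z\<in>(V - e) \<rightarrow>\<^sub>E {1..n}. \<Sum>y\<in>e \<rightarrow>\<^sub>E {1..n}.
        edge_value r n f ((\<lambda>i. if i \<in> e then y i else z i) ` e))"
    by (rule sum_PiE_split[OF edge_subset[OF e]])
  also have "\<dots> = (\<Sum>z\<in>(V - e) \<rightarrow>\<^sub>E {1..n}. \<Sum>y\<in>e \<rightarrow>\<^sub>E {1..n}. edge_value r n f (y ` e))"
    by (intro sum.cong refl arg_cong[where f = "edge_value r n f"]) auto
  also have "\<dots> = real n ^ (card V - r) * (\<Sum>y\<in>e \<rightarrow>\<^sub>E {1..n}. edge_value r n f (y ` e))"
    by (simp add: card_maps_off_edge[OF e])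
  also have "\<dots> \<le> real n ^ (card V - r) * (real (r ^ r) * (\<Sum>d\<in>r_subsets r n. f d))"
    by (intro mult_left_mono sum_edge_maps_le[OF e f]) auto
  finally show ?thesis by (simp add: mult.assoc)
qed

subsection \<open>Edge-weighted graphs as functions on edges\<close>

definition edge_function :: "(nat list \<Rightarrow> real) \<Rightarrow> nat set \<Rightarrow> real" where
  "edge_function G d = G (sorted_list_of_set d)"

definition tuple_function :: "(nat set \<Rightarrow> real) \<Rightarrow> nat list \<Rightarrow> real" where
  "tuple_function g xs = (if distinct xs then g (set xs) else 0)"

lemma sorted_list_r_subset:
  assumes "d \<in> r_subsets r n"
  shows "sorted_list_of_set d \<in> tuples r n" "distinct (sorted_list_of_set d)"
    "set (sorted_list_of_set d) = d" "finite d"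
  using assms finite_subset[of d "{1..n}"] by (auto simp: r_subsets_def tuples_def)

lemma weighting_edge_function:
  assumes "weighted_graph r n G"
  shows "weighting r n (edge_function G)"
  using assms sorted_list_r_subset by (auto simp: weighting_def weighted_graph_def edge_function_def)

lemma weighted_graph_tuple_function:
  assumes "weighting r n g"
  shows "weighted_graph r n (tuple_function g)"
proof -
  have R: "set xs \<in> r_subsets r n" if "xs \<in> tuples r n" "distinct xs" for xs
    using that distinct_card[of xs] by (auto simp: tuples_def r_subsets_def)
  have M: "tuple_function g xs = tuple_function g ys" if "mset xs = mset ys" for xs ys
    using mset_eq_imp_distinct_iff[OF that] mset_eq_setD[OF that] by (simp add: tuple_function_def)
  show ?thesis unfolding weighted_graph_def
  proof (intro conjI ballI impI)
    fix xs assume xs: "xs \<in> tuples r n"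
    show "0 \<le> tuple_function g xs" "tuple_function g xs \<le> 1"
      using R[OF xs] assms by (simp_all add: tuple_function_def weighting_def)
    show "tuple_function g xs = 0" if "\<not> distinct xs" using that by (simp add: tuple_function_def)
    fix ys assume "mset xs = mset ys"
    thus "tuple_function g xs = tuple_function g ys" by (rule M)
  qed
qed

lemma edge_function_tuple_function:
  "d \<in> r_subsets r n \<Longrightarrow> edge_function (tuple_function g) d = g d"
  using sorted_list_r_subset[of d n] by (simp add: edge_function_def tuple_function_def)

lemma weighted_graph_restr_tuple_eq:
  assumes G: "weighted_graph r n G" and x: "x \<in> V \<rightarrow>\<^sub>E {1..n}" and e: "e \<in> E"
  shows "G (restr_tuple x e) = edge_value r n (edge_function G) (x ` e)"
proof -
  obtain vs where vs: "distinct vs" "set vs = e"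
    using finite_distinct_list[OF finite_edge[OF e]] by blast
  have eq: "G (restr_tuple x e) = G (map x vs)"
    by (rule weighted_graph_restr_tuple[OF G uniform e x vs])
  have tup: "map x vs \<in> tuples r n"
  proof -
    have "length vs = r" using distinct_card[OF vs(1)] vs(2) card_edge[OF e] by simp
    moreover have "x ` e \<subseteq> {1..n}" using edge_subset[OF e] x by blast
    ultimately show ?thesis using vs(2) by (simp add: tuples_def)
  qed
  show ?thesis
  proof (cases "inj_on x e")
    case True
    hence in_R: "x ` e \<in> r_subsets r n" using map_edge_in_r_subsets[OF x e] by simp
    have "distinct (map x vs)" "set (map x vs) = set (sorted_list_of_set (x ` e))"
      using True vs sorted_list_r_subset(3)[OF in_R] by (simp_all add: distinct_map)
    hence "mset (map x vs) = mset (sorted_list_of_set (x ` e))"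
      using sorted_list_r_subset(2)[OF in_R] set_eq_iff_mset_eq_distinct by blast
    hence "G (map x vs) = G (sorted_list_of_set (x ` e))"
      using G tup sorted_list_r_subset(1)[OF in_R] unfolding weighted_graph_def by blast
    thus ?thesis using eq in_R by (simp add: edge_value_def edge_function_def)
  next
    case False
    hence "\<not> distinct (map x vs)" using vs by (simp add: distinct_map)
    hence "G (map x vs) = 0" using tup G unfolding weighted_graph_def by blast
    thus ?thesis using eq False map_edge_in_r_subsets[OF x e] by (simp add: edge_value_def)
  qed
qed

lemma hom_density_eq:
  assumes "weighted_graph r n G"
  shows "hom_density V E n G = homs n (edge_function G) / real n ^ card V"
  unfolding hom_density_def homs_def
  by (intro arg_cong2[where f = "(/)"] sum.cong prod.cong refl weighted_graph_restr_tuple_eq[OF assms])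

lemma homs_cong:
  assumes "\<And>d. d \<in> r_subsets r n \<Longrightarrow> g d = h d"
  shows "homs n g = homs n h"
  unfolding homs_def edge_value_def using assms by (intro sum.cong prod.cong) auto

lemma graph_entropy_eq: "graph_entropy r n p G = entropy r n p (edge_function G)"
  unfolding graph_entropy_def entropy_def edge_function_def
proof (rule sum.reindex_bij_witness[where i = sorted_list_of_set and j = set])
  fix xs assume "xs \<in> {xs \<in> tuples r n. sorted_wrt (<) xs}"
  hence xs: "xs \<in> tuples r n" "sorted xs" "distinct xs"
    by (auto simp: strict_sorted_iff)
  show "sorted_list_of_set (set xs) = xs"
    using xs by (simp add: sorted_list_of_set.idem_if_sorted_distinct)
  show "set xs \<in> r_subsets r n"
    using xs distinct_card[of xs] by (auto simp: tuples_def r_subsets_def)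
  show "rel_entropy p (G (sorted_list_of_set (set xs))) = rel_entropy p (G xs)"
    using xs by (simp add: sorted_list_of_set.idem_if_sorted_distinct)
next
  fix d assume d: "d \<in> r_subsets r n"
  show "set (sorted_list_of_set d) = d" using sorted_list_r_subset[OF d] by simp
  show "sorted_list_of_set d \<in> {xs \<in> tuples r n. sorted_wrt (<) xs}"
    using sorted_list_r_subset[OF d] by simp
qed

lemma entropy_cong:
  assumes "\<And>d. d \<in> r_subsets r n \<Longrightarrow> g d = h d"
  shows "entropy r n p g = entropy r n p h"
  unfolding entropy_def using assms by (intro sum.cong) auto

lemma upper_tail_phi_eq:
  "upper_tail_phi r V E n p \<delta> =
     Inf {entropy r n p g | g. weighting r n g \<and> homs n g / real n ^ card V \<ge> (1 + \<delta>) * p ^ card E}"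
proof -
  have "{graph_entropy r n p G | G. weighted_graph r n G \<and> hom_density V E n G \<ge> (1 + \<delta>) * p ^ card E} =
     {entropy r n p g | g. weighting r n g \<and> homs n g / real n ^ card V \<ge> (1 + \<delta>) * p ^ card E}"
    (is "?A = ?B")
  proof (intro equalityI subsetI)
    fix t assume "t \<in> ?A"
    then obtain G where G: "t = graph_entropy r n p G" "weighted_graph r n G"
      "hom_density V E n G \<ge> (1 + \<delta>) * p ^ card E" by auto
    show "t \<in> ?B" unfolding mem_Collect_eq
      using G(1,3) weighting_edge_function[OF G(2)] hom_density_eq[OF G(2)] graph_entropy_eq[of n p G]
      by (intro exI[of _ "edge_function G"]) simp
  next
    fix t assume "t \<in> ?B"
    then obtain g where g: "t = entropy r n p g" "weighting r n g"
      "homs n g / real n ^ card V \<ge> (1 + \<delta>) * p ^ card E" by auto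
    have G: "weighted_graph r n (tuple_function g)" by (rule weighted_graph_tuple_function[OF g(2)])
    have "entropy r n p (edge_function (tuple_function g)) = entropy r n p g"
      by (rule entropy_cong) (rule edge_function_tuple_function)
    moreover have "homs n (edge_function (tuple_function g)) = homs n g"
      by (rule homs_cong) (rule edge_function_tuple_function)
    ultimately show "t \<in> ?A" unfolding mem_Collect_eq
      using g(1,3) G hom_density_eq[OF G] graph_entropy_eq[of n p "tuple_function g"]
      by (intro exI[of _ "tuple_function g"]) simp
  qed
  thus ?thesis unfolding upper_tail_phi_def by simp
qed

subsection \<open>Copies\<close>

definition automorphisms :: "('a \<Rightarrow> 'a) set" where
  "automorphisms = {f \<in> V \<rightarrow>\<^sub>E V. bij_betw f V V \<and> (\<lambda>e. f ` e) ` E = E}"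

lemma card_automorphisms_pos: "card automorphisms > 0"
proof -
  have "finite automorphisms"
    unfolding automorphisms_def by (rule finite_subset[of _ "V \<rightarrow>\<^sub>E V"]) (auto intro: finite_PiE)
  moreover have "restrict id V \<in> automorphisms"
  proof -
    have *: "restrict id V ` e = e" if "e \<in> E" for e
      using edge_subset[OF that] by force
    have "(\<lambda>e. restrict id V ` e) ` E = E" using * by simp
    thus ?thesis by (auto simp: automorphisms_def bij_betw_def inj_on_def)
  qed
  ultimately show ?thesis by (auto simp: card_gt_0_iff)
qed

text \<open>Sending an embedding to its image maps the embeddings into \<open>D\<close> onto the
  copies. Composition with a fixed isomorphism \<open>f\<close> identifies each fibre with the
  automorphisms, so all fibres have the same size.\<close>

lemma copies_eq:
  assumes D: "D \<subseteq> r_subsets r n"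
  shows "real (card automorphisms) * real (copies V E n D) =
    inj_homs n (\<lambda>d. if d \<in> D then 1 else 0)"
proof -
  define X where "X = {x \<in> injections n. \<forall>e\<in>E. x ` e \<in> D}"
  define K where "K = {(W, F). W \<subseteq> {1..n} \<and> F \<subseteq> D \<and> hypergraph_iso V E W F}"
  define c where "c x = (x ` V, (\<lambda>e. x ` e) ` E)" for x :: "'a \<Rightarrow> nat"
  have finX: "finite X" unfolding X_def by simp
  have "K \<subseteq> Pow {1..n} \<times> Pow D" unfolding K_def by auto
  moreover have "finite D" using D finite_subset by fastforce
  ultimately have finK: "finite K" by (auto intro: finite_subset)
  have cK: "c x \<in> K" if "x \<in> X" for x
    using that unfolding X_def K_def c_def injections_def hypergraph_iso_def
    by (auto simp: bij_betw_def intro!: exI[of _ x])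
  have fibre: "card {x \<in> X. c x = k} = card automorphisms" if "k \<in> K" for k
  proof -
    obtain W F where k: "k = (W, F)" by force
    obtain f where f: "bij_betw f V W" "(\<lambda>e. f ` e) ` E = F" and sub: "W \<subseteq> {1..n}" "F \<subseteq> D"
      using \<open>k \<in> K\<close> unfolding K_def k hypergraph_iso_def by auto
    define g where "g = inv_into V f"
    have fg: "f (g w) = w" if "w \<in> W" for w
      using f(1) that unfolding g_def by (simp add: bij_betw_inv_into_right)
    have gf: "g (f w) = w" if "w \<in> V" for w
      using f(1) that unfolding g_def by (simp add: bij_betw_inv_into_left)
    have gV: "g w \<in> V" if "w \<in> W" for w
      using f(1) that unfolding g_def by (metis bij_betw_def inv_into_into)
    have fW: "f w \<in> W" if "w \<in> V" for w using f(1) that by (auto simp: bij_betw_def)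
    have "bij_betw (\<lambda>h. restrict (f \<circ> h) V) automorphisms {x \<in> X. c x = k}"
    proof (rule bij_betw_byWitness[where f' = "\<lambda>x. restrict (g \<circ> x) V"])
      show "\<forall>h\<in>automorphisms. restrict (g \<circ> restrict (f \<circ> h) V) V = h"
        by (auto simp: automorphisms_def PiE_def extensional_def fun_eq_iff restrict_def gf Pi_def)
      show "\<forall>x\<in>{x \<in> X. c x = k}. restrict (f \<circ> restrict (g \<circ> x) V) V = x"
      proof
        fix x assume x: "x \<in> {x \<in> X. c x = k}"
        hence "x ` V = W" unfolding c_def k by simp
        hence "f (g (x v)) = x v" if "v \<in> V" for v using that fg by blast
        thus "restrict (f \<circ> restrict (g \<circ> x) V) V = x"
          using x by (auto simp: X_def injections_def PiE_def extensional_def fun_eq_iff restrict_def)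
      qed
      show "(\<lambda>h. restrict (f \<circ> h) V) ` automorphisms \<subseteq> {x \<in> X. c x = k}"
      proof (rule image_subsetI)
        fix h assume h: "h \<in> automorphisms"
        let ?x = "restrict (f \<circ> h) V"
        have hV: "h ` V = V" "inj_on h V" and hE: "(\<lambda>e. h ` e) ` E = E"
          using h by (auto simp: automorphisms_def bij_betw_def)
        have im: "?x ` e = f ` (h ` e)" if "e \<subseteq> V" for e using that by force
        have "?x ` V = W" using im[of V] hV f(1) by (simp add: bij_betw_def)
        moreover have "(\<lambda>e. ?x ` e) ` E = F"
        proof -
          have "(\<lambda>e. ?x ` e) ` E = (\<lambda>e. f ` (h ` e)) ` E"
            by (rule image_cong[OF refl]) (rule im[OF edge_subset])
          also have "\<dots> = (\<lambda>e. f ` e) ` ((\<lambda>e. h ` e) ` E)" by (simp only: image_image)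
          finally show ?thesis using hE f(2) by simp
        qed
        moreover have "inj_on ?x V"
          using comp_inj_on[OF hV(2), of f] hV(1) f(1) by (simp add: bij_betw_def inj_on_restrict_eq)
        moreover have "?x \<in> V \<rightarrow>\<^sub>E {1..n}"
        proof -
          have "f (h w) \<in> {1..n}" if "w \<in> V" for w using that hV(1) fW[of "h w"] sub(1) by blast
          thus ?thesis by auto
        qed
        ultimately show "?x \<in> {x \<in> X. c x = k}"
          using sub(2) unfolding X_def injections_def c_def k by blast
      qed
      show "(\<lambda>x. restrict (g \<circ> x) V) ` {x \<in> X. c x = k} \<subseteq> automorphisms"
      proof (rule image_subsetI)
        fix x assume x: "x \<in> {x \<in> X. c x = k}"
        let ?h = "restrict (g \<circ> x) V"
        have xV: "x ` V = W" "inj_on x V" and xE: "(\<lambda>e. x ` e) ` E = F"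
          using x by (auto simp: c_def k X_def injections_def)
        have gb: "bij_betw g W V" unfolding g_def using f(1) by (rule bij_betw_inv_into)
        have im: "?h ` e = g ` (x ` e)" if "e \<subseteq> V" for e using that by force
        have "?h ` V = V" using im[of V] xV gb by (simp add: bij_betw_def)
        moreover have "inj_on ?h V"
          using comp_inj_on[OF xV(2), of g] xV(1) gb by (simp add: bij_betw_def inj_on_restrict_eq)
        moreover have "(\<lambda>e. ?h ` e) ` E = E"
        proof -
          have "(\<lambda>e. ?h ` e) ` E = (\<lambda>e. g ` (x ` e)) ` E"
            by (rule image_cong[OF refl]) (rule im[OF edge_subset])
          also have "\<dots> = (\<lambda>e. g ` e) ` ((\<lambda>e. x ` e) ` E)" by (simp only: image_image)
          also have "\<dots> = (\<lambda>e. g ` (f ` e)) ` E" unfolding xE f(2)[symmetric] image_image ..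
          also have "\<dots> = (\<lambda>e. e) ` E"
          proof (rule image_cong[OF refl])
            fix e assume "e \<in> E"
            thus "g ` (f ` e) = e" using edge_subset[of e] gf by (force simp: image_image)
          qed
          finally show ?thesis by simp
        qed
        ultimately show "?h \<in> automorphisms"
          by (auto simp: automorphisms_def bij_betw_def)
      qed
    qed
    thus ?thesis by (simp add: bij_betw_same_card)
  qed
  have "card X = (\<Sum>k\<in>K. card {x \<in> X. c x = k})"
    using sum.group[OF finX finK image_subsetI[of X c K, OF cK], of "\<lambda>_. 1::nat"] by simp
  also have "\<dots> = card K * card automorphisms" using fibre by simp
  finally have "real (card X) = real (card automorphisms) * real (copies V E n D)"
    unfolding copies_def K_def[symmetric] by simp
  moreover have "inj_homs n (\<lambda>d. if d \<in> D then 1 else 0) = real (card X)"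
  proof -
    have "inj_homs n (\<lambda>d. if d \<in> D then 1 else 0) = (\<Sum>x\<in>injections n. if \<forall>e\<in>E. x ` e \<in> D then 1 else 0)"
      unfolding inj_homs_def by (intro sum.cong refl) (auto intro: prod_zero)
    thus ?thesis by (simp add: sum.If_cases Int_def X_def)
  qed
  ultimately show ?thesis by simp
qed

end

section \<open>Covering by cut-norm balls\<close>

lemma sum_UN_le:
  fixes f :: "'x \<Rightarrow> real"
  assumes "finite I" "\<And>i. i \<in> I \<Longrightarrow> finite (S i)" "\<And>x. 0 \<le> f x"
  shows "sum f (\<Union>i\<in>I. S i) \<le> (\<Sum>i\<in>I. sum f (S i))"
  using assms
proof (induction I rule: finite_induct)
  case (insert i I)
  have "sum f (S i \<union> (\<Union>i\<in>I. S i)) + sum f (S i \<inter> (\<Union>i\<in>I. S i)) = sum f (S i) + sum f (\<Union>i\<in>I. S i)"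
    using insert by (intro sum.union_inter) auto
  moreover have "sum f (S i \<inter> (\<Union>i\<in>I. S i)) \<ge> 0" using insert by (intro sum_nonneg) auto
  moreover have "sum f (\<Union>i\<in>I. S i) \<le> (\<Sum>i\<in>I. sum f (S i))" using insert by auto
  ultimately show ?case using insert.hyps by simp
qed simp

text \<open>All functions reached from \<open>0\<close> by at most \<open>k\<close> steps of size
  \<open>s\<close> along tests or their negatives. The family does not depend on the function to be
  approximated, which is what makes it a net.\<close>

primrec centres :: "real \<Rightarrow> ('b \<Rightarrow> real) set \<Rightarrow> nat \<Rightarrow> ('b \<Rightarrow> real) set" where
  "centres s \<T> 0 = {\<lambda>_. 0}"
| "centres s \<T> (Suc k) = centres s \<T> k \<union> (\<lambda>(B, T) d. B d + s * T d) ` (centres s \<T> k \<times> \<T>)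
     \<union> (\<lambda>(B, T) d. B d - s * T d) ` (centres s \<T> k \<times> \<T>)"

lemma finite_centres: "finite \<T> \<Longrightarrow> finite (centres s \<T> k)"
  by (induction k) auto

lemma card_centres_le:
  assumes "finite \<T>"
  shows "card (centres s \<T> k) \<le> (1 + 2 * card \<T>) ^ k"
proof (induction k)
  case (Suc k)
  let ?C = "centres s \<T> k"
  have fin: "finite (?C \<times> \<T>)" using assms finite_centres by blast
  have "card (centres s \<T> (Suc k)) \<le> card ?C + card (?C \<times> \<T>) + card (?C \<times> \<T>)"
    unfolding centres.simps
    by (intro order_trans[OF card_Un_le] add_mono card_image_le fin order_refl)
  also have "\<dots> = card ?C * (1 + 2 * card \<T>)" by (simp add: card_cartesian_product algebra_simps)
  also have "\<dots> \<le> (1 + 2 * card \<T>) ^ k * (1 + 2 * card \<T>)" by (intro mult_right_mono Suc) auto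
  finally show ?case by (simp add: mult.commute)
qed auto

text \<open>The energy decrement argument of Frieze and Kannan. Moving the approximation by a step of
  fixed length along a violated test decreases the squared distance by a fixed amount; because
  the steps are quantised, only finitely many centres are ever needed.\<close>

lemma centres_cover:
  fixes h :: "'b \<Rightarrow> real" and C N \<epsilon> :: real
  assumes R: "finite R" "real (card R) \<le> N" and h: "\<And>d. d \<in> R \<Longrightarrow> 0 \<le> h d \<and> h d \<le> 1"
    and T: "\<And>T d. T \<in> \<T> \<Longrightarrow> d \<in> R \<Longrightarrow> \<bar>T d\<bar> \<le> C"
    and pos: "C > 0" "N > 0" "\<epsilon> > 0" and k: "real k * \<epsilon>\<^sup>2 / (C\<^sup>2 * N) > N"
  shows "\<exists>B\<in>centres (\<epsilon> / (C\<^sup>2 * N)) \<T> k. \<forall>T\<in>\<T>. \<bar>\<Sum>d\<in>R. (h d - B d) * T d\<bar> \<le> \<epsilon>"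
proof -
  \<comment> \<open>A step \<open>t\<close> along a violated test changes the energy by at most
    \<open>- 2 * t * \<epsilon> + t\<^sup>2 * C\<^sup>2 * N\<close>. This \<open>s\<close> minimises
    the bound, with decrease \<open>\<epsilon>\<^sup>2 / (C\<^sup>2 * N)\<close>. The energy starts
    at most at \<open>N\<close>, so the assumption on \<open>k\<close> rules out \<open>k\<close>
    such steps.\<close>
  define s where "s = \<epsilon> / (C\<^sup>2 * N)"
  define good where "good B \<longleftrightarrow> (\<forall>T\<in>\<T>. \<bar>\<Sum>d\<in>R. (h d - B d) * T d\<bar> \<le> \<epsilon>)" for B
  have s: "s > 0" using pos by (simp add: s_def)
  have step: "(\<Sum>d\<in>R. (h d - (B d + t * T d))\<^sup>2) \<le> (\<Sum>d\<in>R. (h d - B d)\<^sup>2) - \<epsilon>\<^sup>2 / (C\<^sup>2 * N)"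
    if T': "T \<in> \<T>" and t: "t = s \<or> t = - s" and v: "t * (\<Sum>d\<in>R. (h d - B d) * T d) \<ge> s * \<epsilon>" for t B T
  proof -
    have "(\<Sum>d\<in>R. (h d - (B d + t * T d))\<^sup>2) =
       (\<Sum>d\<in>R. (h d - B d)\<^sup>2) - 2 * (t * (\<Sum>d\<in>R. (h d - B d) * T d)) + t\<^sup>2 * (\<Sum>d\<in>R. (T d)\<^sup>2)"
      unfolding sum_distrib_left sum_subtractf[symmetric] sum.distrib[symmetric]
      by (intro sum.cong) (auto simp: power2_eq_square algebra_simps)
    also have "(\<Sum>d\<in>R. (T d)\<^sup>2) \<le> real (card R) * C\<^sup>2"
    proof (rule sum_bounded_above)
      fix d assume "d \<in> R"
      thus "(T d)\<^sup>2 \<le> C\<^sup>2" using T[OF T', of d] power_mono[of "\<bar>T d\<bar>" C 2] by simp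
    qed
    also have "\<dots> \<le> N * C\<^sup>2" using R by (intro mult_right_mono) auto
    also have "t\<^sup>2 = s\<^sup>2" using t by auto
    finally have "(\<Sum>d\<in>R. (h d - (B d + t * T d))\<^sup>2) \<le>
        (\<Sum>d\<in>R. (h d - B d)\<^sup>2) - 2 * (s * \<epsilon>) + s\<^sup>2 * (N * C\<^sup>2)"
      using v by (auto simp: mult_left_mono)
    moreover have "s\<^sup>2 * (N * C\<^sup>2) = \<epsilon>\<^sup>2 / (C\<^sup>2 * N)" "s * \<epsilon> = \<epsilon>\<^sup>2 / (C\<^sup>2 * N)"
      using pos by (auto simp: s_def power2_eq_square field_simps)
    ultimately show ?thesis by linarith
  qed
  have "(\<exists>B\<in>centres s \<T> k. good B) \<or>
     (\<exists>B\<in>centres s \<T> k. (\<Sum>d\<in>R. (h d - B d)\<^sup>2) \<le> N - real k * (\<epsilon>\<^sup>2 / (C\<^sup>2 * N)))" for k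
  proof (induction k)
    case 0
    have "(\<Sum>d\<in>R. (h d)\<^sup>2) \<le> real (card R) * 1"
      using h by (intro sum_bounded_above) (auto simp: power_le_one)
    thus ?case using R by auto
  next
    case (Suc k)
    show ?case
    proof (cases "\<exists>B\<in>centres s \<T> k. good B")
      case True thus ?thesis by auto
    next
      case False
      then obtain B where B: "B \<in> centres s \<T> k" "\<not> good B"
        "(\<Sum>d\<in>R. (h d - B d)\<^sup>2) \<le> N - real k * (\<epsilon>\<^sup>2 / (C\<^sup>2 * N))" using Suc by auto
      obtain T where T': "T \<in> \<T>" "\<bar>\<Sum>d\<in>R. (h d - B d) * T d\<bar> > \<epsilon>"
        using B(2) unfolding good_def by auto
      have "\<exists>B'\<in>centres s \<T> (Suc k). (\<Sum>d\<in>R. (h d - B' d)\<^sup>2) \<le> (\<Sum>d\<in>R. (h d - B d)\<^sup>2) - \<epsilon>\<^sup>2 / (C\<^sup>2 * N)"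
      proof (cases "(\<Sum>d\<in>R. (h d - B d) * T d) \<ge> 0")
        case True
        have "(\<lambda>d. B d + s * T d) \<in> centres s \<T> (Suc k)"
          using B(1) T'(1) by force
        moreover have "s * (\<Sum>d\<in>R. (h d - B d) * T d) \<ge> s * \<epsilon>" using True T' s by (intro mult_left_mono) auto
        ultimately show ?thesis
          using step[OF T'(1), of s B] by (intro bexI[of _ "\<lambda>d. B d + s * T d"]) simp_all
      next
        case False
        have "(\<lambda>d. B d - s * T d) \<in> centres s \<T> (Suc k)"
          using B(1) T'(1) by force
        hence "(\<lambda>d. B d + - s * T d) \<in> centres s \<T> (Suc k)" by simp
        moreover have "s * (- (\<Sum>d\<in>R. (h d - B d) * T d)) \<ge> s * \<epsilon>"
          using False T' s by (intro mult_left_mono) auto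
        hence "- s * (\<Sum>d\<in>R. (h d - B d) * T d) \<ge> s * \<epsilon>" by simp
        ultimately show ?thesis
          using step[OF T'(1), of "- s" B] by (intro bexI[of _ "\<lambda>d. B d + - s * T d"]) simp_all
      qed
      then obtain B' where B': "B' \<in> centres s \<T> (Suc k)"
        "(\<Sum>d\<in>R. (h d - B' d)\<^sup>2) \<le> (\<Sum>d\<in>R. (h d - B d)\<^sup>2) - \<epsilon>\<^sup>2 / (C\<^sup>2 * N)" by blast
      have "real (Suc k) * (\<epsilon>\<^sup>2 / (C\<^sup>2 * N)) = real k * (\<epsilon>\<^sup>2 / (C\<^sup>2 * N)) + \<epsilon>\<^sup>2 / (C\<^sup>2 * N)"
        by (simp add: ring_distribs add_divide_distrib)
      hence "(\<Sum>d\<in>R. (h d - B' d)\<^sup>2) \<le> N - real (Suc k) * (\<epsilon>\<^sup>2 / (C\<^sup>2 * N))"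
        using B'(2) B(3) by linarith
      thus ?thesis using B'(1) by blast
    qed
  qed
  from this[of k] have "\<exists>B\<in>centres s \<T> k. good B"
  proof
    assume "\<exists>B\<in>centres s \<T> k. (\<Sum>d\<in>R. (h d - B d)\<^sup>2) \<le> N - real k * (\<epsilon>\<^sup>2 / (C\<^sup>2 * N))"
    then obtain B where "(\<Sum>d\<in>R. (h d - B d)\<^sup>2) \<le> N - real k * (\<epsilon>\<^sup>2 / (C\<^sup>2 * N))" by blast
    moreover have "(\<Sum>d\<in>R. (h d - B d)\<^sup>2) \<ge> 0" by (intro sum_nonneg) auto
    ultimately show ?thesis using k by simp
  qed
  thus ?thesis unfolding good_def s_def .
qed

text \<open>Grouped by the value of \<open>\<phi>\<close>, the sum is linear in \<open>c\<close>
  with values in \<open>[0, 1]\<close>, hence extremal at an indicator: of the fibres with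
  nonnegative sum if the total is nonnegative, of the others if not.\<close>

lemma sum_mult_le_indicator:
  fixes A :: "'x \<Rightarrow> real"
  assumes X: "finite X" and c: "\<And>d. 0 \<le> c d \<and> c d \<le> 1"
  shows "\<exists>D. \<bar>\<Sum>x\<in>X. A x * c (\<phi> x)\<bar> \<le> \<bar>\<Sum>x\<in>X. A x * (if \<phi> x \<in> D then 1 else 0)\<bar>"
proof -
  define B where "B d = (\<Sum>x\<in>{x \<in> X. \<phi> x = d}. A x)" for d
  have fin: "finite (\<phi> ` X)" using X by simp
  have grp: "(\<Sum>x\<in>X. A x * f (\<phi> x)) = (\<Sum>d\<in>\<phi> ` X. B d * f d)" for f
  proof -
    have "(\<Sum>x\<in>X. A x * f (\<phi> x)) = (\<Sum>d\<in>\<phi> ` X. \<Sum>x\<in>{x \<in> X. \<phi> x = d}. A x * f (\<phi> x))"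
      using sum.group[OF X fin subset_refl] by (simp add: eq_commute)
    also have "\<dots> = (\<Sum>d\<in>\<phi> ` X. B d * f d)"
      unfolding B_def sum_distrib_right by (intro sum.cong) auto
    finally show ?thesis .
  qed
  have up: "(\<Sum>d\<in>\<phi> ` X. B d * c d) \<le> (\<Sum>d\<in>\<phi> ` X. B d * (if d \<in> {d. B d \<ge> 0} then 1 else 0))"
  proof (rule sum_mono)
    fix d
    show "B d * c d \<le> B d * (if d \<in> {d. B d \<ge> 0} then 1 else 0)"
      using c[of d] mult_left_le[of "c d" "B d"] mult_nonpos_nonneg[of "B d" "c d"] by auto
  qed
  have lo: "(\<Sum>d\<in>\<phi> ` X. B d * c d) \<ge> (\<Sum>d\<in>\<phi> ` X. B d * (if d \<in> {d. B d < 0} then 1 else 0))"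
  proof (rule sum_mono)
    fix d
    show "B d * (if d \<in> {d. B d < 0} then 1 else 0) \<le> B d * c d"
      using c[of d] mult_left_le[of "c d" "- B d"] mult_nonneg_nonneg[of "B d" "c d"] by auto
  qed
  show ?thesis
  proof (cases "(\<Sum>d\<in>\<phi> ` X. B d * c d) \<ge> 0")
    case True
    thus ?thesis using up grp[of c] grp[of "\<lambda>d. if d \<in> {d. B d \<ge> 0} then 1 else 0"]
      by (intro exI[of _ "{d. B d \<ge> 0}"]) linarith
  next
    case False
    thus ?thesis using lo grp[of c] grp[of "\<lambda>d. if d \<in> {d. B d < 0} then 1 else 0"]
      by (intro exI[of _ "{d. B d < 0}"]) linarith
  qed
qed

text \<open>One factor is rounded at a time, the others being absorbed into \<open>A\<close>. Thus
  finitely many tests, built from indicators, control arbitrary factors in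
  \<open>[0, 1]\<close>.\<close>

lemma sum_mult_prod_le_indicators:
  fixes A :: "'x \<Rightarrow> real"
  assumes X: "finite X" and J: "finite J" and c: "\<And>j d. 0 \<le> c j d \<and> c j d \<le> 1"
  shows "\<exists>D. \<bar>\<Sum>x\<in>X. A x * (\<Prod>j\<in>J. c j (\<phi> j x))\<bar> \<le>
    \<bar>\<Sum>x\<in>X. A x * (\<Prod>j\<in>J. if \<phi> j x \<in> D j then 1 else 0)\<bar>"
  using J
proof (induction J arbitrary: A rule: finite_induct)
  case empty
  show ?case by simp
next
  case (insert i J)
  obtain D0 where D0: "\<bar>\<Sum>x\<in>X. (A x * (\<Prod>j\<in>J. c j (\<phi> j x))) * c i (\<phi> i x)\<bar> \<le>
     \<bar>\<Sum>x\<in>X. (A x * (\<Prod>j\<in>J. c j (\<phi> j x))) * (if \<phi> i x \<in> D0 then 1 else 0)\<bar>"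
    using sum_mult_le_indicator[OF X, of "c i" "\<lambda>x. A x * (\<Prod>j\<in>J. c j (\<phi> j x))" "\<phi> i"] c by blast
  obtain D where D: "\<bar>\<Sum>x\<in>X. (A x * (if \<phi> i x \<in> D0 then 1 else 0)) * (\<Prod>j\<in>J. c j (\<phi> j x))\<bar> \<le>
     \<bar>\<Sum>x\<in>X. (A x * (if \<phi> i x \<in> D0 then 1 else 0)) * (\<Prod>j\<in>J. if \<phi> j x \<in> D j then 1 else 0)\<bar>"
    using insert.IH[of "\<lambda>x. A x * (if \<phi> i x \<in> D0 then 1 else 0)"] by blast
  have "(\<Sum>x\<in>X. A x * (\<Prod>j\<in>insert i J. c j (\<phi> j x))) =
      (\<Sum>x\<in>X. (A x * (\<Prod>j\<in>J. c j (\<phi> j x))) * c i (\<phi> i x))"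
    using insert.hyps by (intro sum.cong) (auto simp: mult_ac)
  moreover have "(\<Sum>x\<in>X. (A x * (\<Prod>j\<in>J. c j (\<phi> j x))) * (if \<phi> i x \<in> D0 then 1 else 0)) =
      (\<Sum>x\<in>X. (A x * (if \<phi> i x \<in> D0 then 1 else 0)) * (\<Prod>j\<in>J. c j (\<phi> j x)))"
    by (intro sum.cong) (auto simp: mult_ac)
  moreover have "(\<Sum>x\<in>X. (A x * (if \<phi> i x \<in> D0 then 1 else 0)) * (\<Prod>j\<in>J. if \<phi> j x \<in> D j then 1 else 0)) =
     (\<Sum>x\<in>X. A x * (\<Prod>j\<in>insert i J. if \<phi> j x \<in> (D(i := D0)) j then 1 else 0))"
  proof (rule sum.cong[OF refl])
    fix x
    have "(\<Prod>j\<in>J. if \<phi> j x \<in> (D(i := D0)) j then 1 else 0) = (\<Prod>j\<in>J. if \<phi> j x \<in> D j then 1 else (0::real))"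
      using insert.hyps by (intro prod.cong) auto
    thus "(A x * (if \<phi> i x \<in> D0 then 1 else 0)) * (\<Prod>j\<in>J. if \<phi> j x \<in> D j then 1 else 0) =
      A x * (\<Prod>j\<in>insert i J. if \<phi> j x \<in> (D(i := D0)) j then 1 else 0)"
      using insert.hyps by simp
  qed
  ultimately show ?case using D0 D by (intro exI[of _ "D(i := D0)"]) linarith
qed

section \<open>The tests that define the cut norm, and the counting lemma\<close>

context hypergraph
begin

text \<open>Distinct edges have equal size, so such a vertex exists. The factor of the edge
  \<open>j\<close> ignores this vertex and hence sees at most \<open>r - 1\<close> vertices of
  \<open>e\<close>.\<close>

definition missed :: "'a set \<Rightarrow> 'a set \<Rightarrow> 'a" where
  "missed e j = (SOME i. i \<in> e \<and> i \<notin> j)"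

lemma missed:
  assumes "e \<in> E" "j \<in> E" "e \<noteq> j"
  shows "missed e j \<in> e" "missed e j \<notin> j"
proof -
  have "\<not> e \<subseteq> j" using assms card_edge finite_edge card_subset_eq by metis
  hence "\<exists>i. i \<in> e \<and> i \<notin> j" by auto
  thus "missed e j \<in> e" "missed e j \<notin> j"
    unfolding missed_def by (metis (mono_tags, lifting) someI_ex)+
qed

definition test_factor :: "'a set \<Rightarrow> ('a set \<Rightarrow> ('a \<Rightarrow> nat) set) \<Rightarrow> ('a \<Rightarrow> nat) \<Rightarrow> real" where
  "test_factor e Q y = (\<Prod>j\<in>E - {e}. if restrict y (e - {missed e j}) \<in> Q j then 1 else 0)"

text \<open>Summing over all labellings of \<open>d\<close> by \<open>e\<close> moves a function of
  maps to a function of \<open>r\<close>-sets, so that pairing it with \<open>h\<close> over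
  \<open>r\<close>-sets is the same as pairing over maps.\<close>

definition test :: "nat \<Rightarrow> 'a set \<Rightarrow> ('a set \<Rightarrow> ('a \<Rightarrow> nat) set) \<Rightarrow> nat set \<Rightarrow> real" where
  "test n e Q d = (\<Sum>y\<in>{y \<in> e \<rightarrow>\<^sub>E {1..n}. y ` e = d}. test_factor e Q y)"

definition test_params :: "nat \<Rightarrow> 'a set \<Rightarrow> ('a set \<Rightarrow> ('a \<Rightarrow> nat) set) set" where
  "test_params n e = PiE (E - {e}) (\<lambda>j. Pow ((e - {missed e j}) \<rightarrow>\<^sub>E {1..n}))"

definition tests :: "nat \<Rightarrow> (nat set \<Rightarrow> real) set" where
  "tests n = (\<Union>e\<in>E. test n e ` test_params n e)"

lemma test_factor_bounds: "0 \<le> test_factor e Q y" "test_factor e Q y \<le> 1"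
  unfolding test_factor_def by (intro prod_nonneg prod_le_1; simp)+

lemma finite_edge_maps: "e \<in> E \<Longrightarrow> finite (e \<rightarrow>\<^sub>E {1..n::nat})"
  using finite_edge by (intro finite_PiE) auto

lemma test_bound:
  assumes T: "T \<in> tests n" and d: "d \<in> r_subsets r n"
  shows "\<bar>T d\<bar> \<le> real (r ^ r)"
proof -
  obtain e Q where e: "e \<in> E" and TQ: "T = test n e Q" using T unfolding tests_def by auto
  have find: "finite d" and cd: "card d = r" using d by (auto simp: r_subsets_def intro: finite_subset)
  have "T d \<le> real (card {y \<in> e \<rightarrow>\<^sub>E {1..n}. y ` e = d}) * 1"
    unfolding TQ test_def by (intro sum_bounded_above test_factor_bounds)
  also have "card {y \<in> e \<rightarrow>\<^sub>E {1..n}. y ` e = d} \<le> card (e \<rightarrow>\<^sub>E d)"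
    using find finite_edge[OF e] by (intro card_mono finite_PiE) (auto simp: PiE_def Pi_def)
  also have "card (e \<rightarrow>\<^sub>E d) = r ^ r" using card_edge[OF e] finite_edge[OF e] cd by (simp add: card_PiE)
  finally have "T d \<le> real (r ^ r)" by simp
  moreover have "T d \<ge> 0" unfolding TQ test_def by (intro sum_nonneg test_factor_bounds)
  ultimately show ?thesis by simp
qed

text \<open>Each set \<open>Q j\<close> is chosen among subsets of a collection of
  \<open>n ^ (r - 1)\<close> maps. The exponent \<open>r - 1\<close> instead of \<open>r\<close> is
  what makes the union bound affordable.\<close>

lemma test_params_card:
  assumes e: "e \<in> E"
  shows "finite (test_params n e)"
    and "card (test_params n e) = 2 ^ (n ^ (r - 1) * (card E - 1))"
proof -
  have fin: "finite ((e - {missed e j}) \<rightarrow>\<^sub>E {1..n})" for j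
    using finite_edge[OF e] by (intro finite_PiE) auto
  show "finite (test_params n e)"
    unfolding test_params_def using fin by (intro finite_PiE) auto
  have "card (Pow ((e - {missed e j}) \<rightarrow>\<^sub>E {1..n})) = 2 ^ (n ^ (r - 1))" if "j \<in> E - {e}" for j
  proof -
    have "missed e j \<in> e" using missed[OF e, of j] that by auto
    hence "card (e - {missed e j}) = r - 1" using card_edge[OF e] by simp
    thus ?thesis using fin finite_edge[OF e] by (simp add: card_Pow card_PiE)
  qed
  hence "card (test_params n e) =
      (\<Prod>j\<in>E - {e}. 2 ^ (n ^ (r - 1)))"
    unfolding test_params_def by (simp add: card_PiE)
  thus "card (test_params n e) = 2 ^ (n ^ (r - 1) * (card E - 1))"
    using e by (simp add: power_mult)
qed

lemma finite_tests: "finite (tests n)"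
  unfolding tests_def by (intro finite_UN_I finite_E finite_imageI test_params_card(1))

lemma card_tests_le: "card (tests n) \<le> card E * 2 ^ (n ^ (r - 1) * (card E - 1))"
proof -
  have "card (tests n) \<le> (\<Sum>e\<in>E. card (test n e ` test_params n e))"
    unfolding tests_def by (rule card_UN_le) simp
  also have "\<dots> \<le> (\<Sum>e\<in>E. 2 ^ (n ^ (r - 1) * (card E - 1)))"
  proof (rule sum_mono)
    fix e assume e: "e \<in> E"
    show "card (test n e ` test_params n e) \<le>
        2 ^ (n ^ (r - 1) * (card E - 1))"
      using card_image_le[OF test_params_card(1)[OF e], of "test n e" n] test_params_card(2)[OF e, of n] by simp
  qed
  finally show ?thesis by simp
qed

lemma sum_test:
  assumes e: "e \<in> E"
  shows "(\<Sum>d\<in>r_subsets r n. h d * test n e Q d) =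
    (\<Sum>y\<in>e \<rightarrow>\<^sub>E {1..n}. edge_value r n h (y ` e) * test_factor e Q y)"
proof -
  have "(\<Sum>y\<in>e \<rightarrow>\<^sub>E {1..n}. edge_value r n h (y ` e) * test_factor e Q y) =
     (\<Sum>y\<in>e \<rightarrow>\<^sub>E {1..n}. \<Sum>d\<in>r_subsets r n. if y ` e = d then h d * test_factor e Q y else 0)"
    by (intro sum.cong) (auto simp: edge_value_def sum.delta')
  also have "\<dots> = (\<Sum>d\<in>r_subsets r n. \<Sum>y\<in>e \<rightarrow>\<^sub>E {1..n}. if y ` e = d then h d * test_factor e Q y else 0)"
    by (rule sum.swap)
  also have "\<dots> = (\<Sum>d\<in>r_subsets r n. h d * test n e Q d)"
    unfolding test_def sum_distrib_left
    by (rule sum.cong[OF refl]) (simp add: sum.inter_filter[OF finite_edge_maps[OF e]])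
  finally show ?thesis by simp
qed

text \<open>Once the vertices outside \<open>e\<close> are fixed, every other edge depends on at most
  \<open>r - 1\<close> of the vertices of \<open>e\<close>, so its factor is of the form allowed in a test.\<close>

lemma single_edge_bound:
  assumes e: "e \<in> E" and c: "\<And>j d. 0 \<le> c j d \<and> c j d \<le> 1"
    and K: "\<And>T. T \<in> tests n \<Longrightarrow> \<bar>\<Sum>d\<in>r_subsets r n. h d * T d\<bar> \<le> K"
  shows "\<bar>\<Sum>x\<in>V \<rightarrow>\<^sub>E {1..n}. edge_value r n h (x ` e) * (\<Prod>j\<in>E - {e}. c j (x ` j))\<bar> \<le>
    real n ^ (card V - r) * K"
proof -
  have ex: "\<exists>D. \<bar>\<Sum>x\<in>V \<rightarrow>\<^sub>E {1..n}. edge_value r n h (x ` e) * (\<Prod>j\<in>E - {e}. c j (x ` j))\<bar> \<le>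
    \<bar>\<Sum>x\<in>V \<rightarrow>\<^sub>E {1..n}. edge_value r n h (x ` e) * (\<Prod>j\<in>E - {e}. if x ` j \<in> D j then 1 else 0)\<bar>"
    by (rule sum_mult_prod_le_indicators[where c = c and \<phi> = "\<lambda>j x. x ` j"
            and A = "\<lambda>x. edge_value r n h (x ` e)", OF finite_maps[of n] finite_Diff[OF finite_E, of "{e}"] c])
  then obtain D where D: "\<bar>\<Sum>x\<in>V \<rightarrow>\<^sub>E {1..n}. edge_value r n h (x ` e) * (\<Prod>j\<in>E - {e}. c j (x ` j))\<bar> \<le>
    \<bar>\<Sum>x\<in>V \<rightarrow>\<^sub>E {1..n}. edge_value r n h (x ` e) * (\<Prod>j\<in>E - {e}. if x ` j \<in> D j then 1 else 0)\<bar>"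
    by blast
  define ind where "ind x = (\<Prod>j\<in>E - {e}. if x ` j \<in> D j then 1 else (0::real))" for x
  define mrg where "mrg = (\<lambda>(z :: 'a \<Rightarrow> nat) y i. if i \<in> e then y i else z i)"
  have split: "(\<Sum>x\<in>V \<rightarrow>\<^sub>E {1..n}. edge_value r n h (x ` e) * ind x) =
    (\<Sum>z\<in>(V - e) \<rightarrow>\<^sub>E {1..n}. \<Sum>y\<in>e \<rightarrow>\<^sub>E {1..n}.
       edge_value r n h (mrg z y ` e) * ind (mrg z y))"
    unfolding mrg_def by (rule sum_PiE_split[OF edge_subset[OF e]])
  have "\<bar>\<Sum>x\<in>V \<rightarrow>\<^sub>E {1..n}. edge_value r n h (x ` e) * ind x\<bar> \<le> (\<Sum>z\<in>(V - e) \<rightarrow>\<^sub>E {1..n}. \<bar>\<Sum>y\<in>e \<rightarrow>\<^sub>E {1..n}.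
       edge_value r n h (mrg z y ` e) * ind (mrg z y)\<bar>)"
    unfolding split by (rule sum_abs)
  also have "\<dots> \<le> real (card ((V - e) \<rightarrow>\<^sub>E {1..n})) * K"
  proof (rule sum_bounded_above)
    fix z assume z: "z \<in> (V - e) \<rightarrow>\<^sub>E {1..n}"
    \<comment> \<open>The restricted map \<open>w\<close> takes a default value at the missed
      vertex, but \<open>j\<close> does not contain that vertex, so the image of \<open>j\<close> is
      unaffected.\<close>
    define Q where "Q = (\<lambda>j\<in>E - {e}. {w \<in> (e - {missed e j}) \<rightarrow>\<^sub>E {1..n}. mrg z w ` j \<in> D j})"
    have "(\<Sum>y\<in>e \<rightarrow>\<^sub>E {1..n}.
       edge_value r n h (mrg z y ` e) * ind (mrg z y)) =
      (\<Sum>y\<in>e \<rightarrow>\<^sub>E {1..n}. edge_value r n h (y ` e) * test_factor e Q y)"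
    proof (rule sum.cong[OF refl])
      fix y assume y: "y \<in> e \<rightarrow>\<^sub>E {1..n}"
      have "mrg z y ` e = y ` e" by (rule image_cong) (simp_all add: mrg_def)
      moreover have "ind (mrg z y) = test_factor e Q y"
        unfolding test_factor_def ind_def
      proof (rule prod.cong[OF refl])
        fix j assume j: "j \<in> E - {e}"
        let ?w = "restrict y (e - {missed e j})"
        have w: "?w \<in> (e - {missed e j}) \<rightarrow>\<^sub>E {1..n}"
          using y by (intro restrict_PiE_iff[THEN iffD2] ballI) blast
        have nj: "missed e j \<notin> j" using missed(2)[OF e, of j] j by auto
        have "mrg z ?w ` j = mrg z y ` j"
        proof (rule image_cong[OF refl])
          fix i assume "i \<in> j"
          hence "i \<noteq> missed e j" using nj by auto
          thus "mrg z ?w i = mrg z y i" by (simp add: mrg_def)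
        qed
        moreover have "Q j = {w \<in> (e - {missed e j}) \<rightarrow>\<^sub>E {1..n}. mrg z w ` j \<in> D j}"
          using j by (simp only: Q_def restrict_apply if_True)
        ultimately have "?w \<in> Q j \<longleftrightarrow> mrg z y ` j \<in> D j" using w by (simp only: mem_Collect_eq) simp
        thus "(if mrg z y ` j \<in> D j then 1 else 0) = (if ?w \<in> Q j then 1 else (0::real))" by simp
      qed
      ultimately show "edge_value r n h (mrg z y ` e) * ind (mrg z y)
         = edge_value r n h (y ` e) * test_factor e Q y" by simp
    qed
    also have "\<dots> = (\<Sum>d\<in>r_subsets r n. h d * test n e Q d)" by (rule sum_test[OF e, symmetric])
    finally have eq: "(\<Sum>y\<in>e \<rightarrow>\<^sub>E {1..n}.
       edge_value r n h (mrg z y ` e) * ind (mrg z y)) =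
       (\<Sum>d\<in>r_subsets r n. h d * test n e Q d)" .
    show "\<bar>\<Sum>y\<in>e \<rightarrow>\<^sub>E {1..n}.
       edge_value r n h (mrg z y ` e) * ind (mrg z y)\<bar> \<le> K"
      unfolding eq
    proof (rule K)
      have "Q \<in> test_params n e"
        unfolding test_params_def Q_def by (intro restrict_PiE_iff[THEN iffD2] ballI) blast
      thus "test n e Q \<in> tests n" unfolding tests_def using e by blast
    qed
  qed
  also have "\<dots> = real n ^ (card V - r) * K" by (simp add: card_maps_off_edge[OF e])
  finally show ?thesis using D unfolding ind_def by linarith
qed

text \<open>Telescoping: \<open>b\<close> is replaced by \<open>a\<close> on one edge at a time.
  Each replacement changes the sum by a term with the difference \<open>a - b\<close> on a single
  edge and factors in \<open>[0, 1]\<close> on the others, which \<open>single_edge_bound\<close>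
  controls.\<close>

lemma counting_lemma:
  assumes a: "weighting r n a" and b: "weighting r n b"
    and K: "\<And>T. T \<in> tests n \<Longrightarrow> \<bar>\<Sum>d\<in>r_subsets r n. (a d - b d) * T d\<bar> \<le> K"
  shows "\<bar>homs n a - homs n b\<bar> \<le> real (card E) * (real n ^ (card V - r) * K)"
proof -
  define hyb where "hyb F = (\<Sum>x\<in>V \<rightarrow>\<^sub>E {1..n}. \<Prod>e\<in>E. edge_value r n (if e \<in> F then a else b) (x ` e))" for F
  have "\<bar>hyb F - hyb {}\<bar> \<le> real (card F) * (real n ^ (card V - r) * K)" if "F \<subseteq> E" for F
    using finite_subset[OF that finite_E] that
  proof (induction F rule: finite_induct)
    case (insert e F)
    hence e: "e \<in> E" by auto
    have split: "(\<Prod>j\<in>E. edge_value r n (if j \<in> G then a else b) (x ` j)) =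
       edge_value r n (if e \<in> G then a else b) (x ` e) *
       (\<Prod>j\<in>E - {e}. edge_value r n (if j \<in> G then a else b) (x ` j))" for G x
      using e by (intro prod.remove) auto
    have diff: "hyb (insert e F) - hyb F = (\<Sum>x\<in>V \<rightarrow>\<^sub>E {1..n}. edge_value r n (\<lambda>d. a d - b d) (x ` e) *
       (\<Prod>j\<in>E - {e}. edge_value r n (if j \<in> F then a else b) (x ` j)))"
      unfolding hyb_def sum_subtractf[symmetric]
    proof (rule sum.cong[OF refl])
      fix x
      have "(\<Prod>j\<in>E - {e}. edge_value r n (if j \<in> insert e F then a else b) (x ` j)) =
        (\<Prod>j\<in>E - {e}. edge_value r n (if j \<in> F then a else b) (x ` j))"
        by (intro prod.cong) auto
      thus "(\<Prod>j\<in>E. edge_value r n (if j \<in> insert e F then a else b) (x ` j)) -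
        (\<Prod>j\<in>E. edge_value r n (if j \<in> F then a else b) (x ` j)) =
        edge_value r n (\<lambda>d. a d - b d) (x ` e) *
        (\<Prod>j\<in>E - {e}. edge_value r n (if j \<in> F then a else b) (x ` j))"
        unfolding split using insert.hyps by (simp add: edge_value_def algebra_simps)
    qed
    have "\<bar>hyb (insert e F) - hyb F\<bar> \<le> real n ^ (card V - r) * K"
      unfolding diff using weighting_edge_value[OF a] weighting_edge_value[OF b]
      by (intro single_edge_bound[OF e, where c = "\<lambda>j. edge_value r n (if j \<in> F then a else b)"] K) auto
    moreover have "\<bar>hyb F - hyb {}\<bar> \<le> real (card F) * (real n ^ (card V - r) * K)"
      using insert by auto
    ultimately have "\<bar>hyb (insert e F) - hyb {}\<bar> \<le> (real (card F) + 1) * (real n ^ (card V - r) * K)"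
      by (simp only: ring_distribs)
    thus ?case using insert.hyps by (simp add: add.commute)
  qed simp
  from this[OF subset_refl] show ?thesis by (simp add: hyb_def homs_def)
qed

text \<open>A union bound over the balls around the centres. In each ball the conditional mean
  \<open>y\<close> given the tail event stays in the ball, by convexity, and the counting lemma
  shows that \<open>y\<close> almost satisfies the constraint; so its entropy is at least
  \<open>L\<close>, and the probability at most \<open>exp (- L)\<close>.\<close>

lemma upper_tail_cover_bound:
  fixes \<epsilon> \<tau> L p :: real
  assumes p: "0 < p" "p < 1" and n: "n \<ge> 1" and \<epsilon>: "\<epsilon> > 0"
    and k: "real k * \<epsilon>\<^sup>2 > (real (r ^ r))\<^sup>2"
    and L: "\<And>y. weighting r n y \<Longrightarrow> homs n y \<ge> \<tau> - 2 * real (card E) * \<epsilon> * real n ^ card V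
        \<Longrightarrow> L \<le> entropy r n p y"
  shows "(\<Sum>D\<in>{D \<in> Pow (r_subsets r n). homs n (\<lambda>d. if d \<in> D then 1 else 0) \<ge> \<tau>}.
      subset_weight (r_subsets r n) (\<lambda>_. p) D) \<le> real ((1 + 2 * card (tests n)) ^ k) * exp (- L)"
proof -
  let ?R = "r_subsets r n"
  let ?one = "\<lambda>D d. if d \<in> D then 1 else (0::real)"
  let ?w = "subset_weight ?R (\<lambda>_. p)"
  define N where "N = real n ^ r"
  define C where "C = real (r ^ r)"
  define s where "s = (\<epsilon> * N) / (C\<^sup>2 * N)"
  define A where "A = {D \<in> Pow ?R. homs n (?one D) \<ge> \<tau>}"
  define near where "near B h \<longleftrightarrow> (\<forall>T\<in>tests n. \<bar>\<Sum>d\<in>?R. (h d - B d) * T d\<bar> \<le> \<epsilon> * N)" for B h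
  define S where "S B = {D \<in> A. near B (?one D)}" for B
  have N: "N > 0" using n by (simp add: N_def)
  have C: "C > 0" using r_pos by (simp add: C_def)
  have finA: "finite A" unfolding A_def by simp
  have wpos: "?w D > 0" for D using p by (rule subset_weight_pos)
  have kk: "real k * (\<epsilon> * N)\<^sup>2 / (C\<^sup>2 * N) > N"
  proof -
    have "real k * (\<epsilon> * N)\<^sup>2 / (C\<^sup>2 * N) = (real k * \<epsilon>\<^sup>2) * (N / C\<^sup>2)"
      using N C by (simp add: power2_eq_square field_simps)
    also have "\<dots> > C\<^sup>2 * (N / C\<^sup>2)"
      using k N C unfolding C_def[symmetric] by (intro mult_strict_right_mono) auto
    finally show ?thesis using C by simp
  qed
  have cardR: "real (card ?R) \<le> N"
    unfolding N_def using card_r_subsets_le[of r n] by (metis of_nat_le_iff of_nat_power)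
  have sub: "A \<subseteq> (\<Union>B\<in>centres s (tests n) k. S B)"
  proof
    fix D assume D: "D \<in> A"
    have "\<exists>B\<in>centres ((\<epsilon> * N) / (C\<^sup>2 * N)) (tests n) k. \<forall>T\<in>tests n. \<bar>\<Sum>d\<in>?R. (?one D d - B d) * T d\<bar> \<le> \<epsilon> * N"
      using \<epsilon> N C kk cardR test_bound[of _ n] unfolding C_def
      by (intro centres_cover) auto
    thus "D \<in> (\<Union>B\<in>centres s (tests n) k. S B)"
      using D unfolding S_def near_def s_def by auto
  qed
  have ball: "(\<Sum>D\<in>S B. ?w D) \<le> exp (- L)" for B
  proof (cases "S B = {}")
    case False
    then obtain D0 where D0: "D0 \<in> S B" by auto
    define Z where "Z = (\<Sum>D\<in>S B. ?w D)"
    define q where "q D = ?w D / Z" for D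
    define y where "y = (\<lambda>d. \<Sum>D\<in>S B. q D * ?one D d)"
    have finS: "finite (S B)" unfolding S_def using finA by simp
    have Z: "Z > 0" unfolding Z_def using False finS wpos by (intro sum_pos) auto
    have q: "q D > 0" for D using Z wpos by (simp add: q_def)
    have qsum: "(\<Sum>D\<in>S B. q D) = 1"
      unfolding q_def using Z by (simp add: sum_divide_distrib[symmetric] Z_def[symmetric])
    have wy: "weighting r n y" unfolding weighting_def
    proof (intro ballI conjI)
      fix d
      show "0 \<le> y d" unfolding y_def using q by (intro sum_nonneg) (auto simp: less_imp_le)
      have "y d \<le> (\<Sum>D\<in>S B. q D)" unfolding y_def using q by (intro sum_mono) (auto simp: less_imp_le)
      thus "y d \<le> 1" using qsum by simp
    qed
    \<comment> \<open>Convexity of the ball: \<open>y - B\<close> is the \<open>q\<close>-average of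
      the differences between the members of \<open>S B\<close> and \<open>B\<close>.\<close>
    have near_y: "near B y" unfolding near_def
    proof
      fix T assume T: "T \<in> tests n"
      have "(\<Sum>d\<in>?R. (y d - B d) * T d) = (\<Sum>d\<in>?R. \<Sum>D\<in>S B. q D * ((?one D d - B d) * T d))"
      proof (rule sum.cong[OF refl])
        fix d
        have "y d - B d = (\<Sum>D\<in>S B. q D * (?one D d - B d))"
          unfolding y_def right_diff_distrib sum_subtractf sum_distrib_right[symmetric] qsum by simp
        thus "(y d - B d) * T d = (\<Sum>D\<in>S B. q D * ((?one D d - B d) * T d))"
          by (simp only: sum_distrib_right mult.assoc)
      qed
      also have "\<dots> = (\<Sum>D\<in>S B. q D * (\<Sum>d\<in>?R. (?one D d - B d) * T d))"
        unfolding sum_distrib_left by (rule sum.swap)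
      finally have eq: "(\<Sum>d\<in>?R. (y d - B d) * T d) =
        (\<Sum>D\<in>S B. q D * (\<Sum>d\<in>?R. (?one D d - B d) * T d))" .
      have "\<bar>\<Sum>d\<in>?R. (y d - B d) * T d\<bar> \<le> (\<Sum>D\<in>S B. \<bar>q D * (\<Sum>d\<in>?R. (?one D d - B d) * T d)\<bar>)" unfolding eq by (rule sum_abs)
      also have "\<dots> \<le> (\<Sum>D\<in>S B. q D * (\<epsilon> * N))"
      proof (rule sum_mono)
        fix D assume "D \<in> S B"
        hence "\<bar>\<Sum>d\<in>?R. (?one D d - B d) * T d\<bar> \<le> \<epsilon> * N" using T unfolding S_def near_def by blast
        thus "\<bar>q D * (\<Sum>d\<in>?R. (?one D d - B d) * T d)\<bar> \<le> q D * (\<epsilon> * N)"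
          using q[of D] by (simp only: abs_mult) (intro mult_mono; simp)
      qed
      also have "\<dots> = \<epsilon> * N" unfolding sum_distrib_right[symmetric] qsum by simp
      finally show "\<bar>\<Sum>d\<in>?R. (y d - B d) * T d\<bar> \<le> \<epsilon> * N" .
    qed
    \<comment> \<open>Both functions lie in the same ball, hence the factor \<open>2\<close>. Any
      single member \<open>D0\<close> suffices, as every member satisfies the constraint.\<close>
    have "\<bar>homs n (?one D0) - homs n y\<bar> \<le> real (card E) * (real n ^ (card V - r) * (2 * (\<epsilon> * N)))"
    proof (rule counting_lemma[OF _ wy])
      show "weighting r n (?one D0)" by (simp add: weighting_def)
      fix T assume T: "T \<in> tests n"
      have "\<bar>\<Sum>d\<in>?R. (?one D0 d - B d) * T d\<bar> \<le> \<epsilon> * N" "\<bar>\<Sum>d\<in>?R. (y d - B d) * T d\<bar> \<le> \<epsilon> * N"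
        using T D0 near_y unfolding S_def near_def by blast+
      moreover have "(\<Sum>d\<in>?R. (?one D0 d - y d) * T d) =
        (\<Sum>d\<in>?R. (?one D0 d - B d) * T d) - (\<Sum>d\<in>?R. (y d - B d) * T d)"
        unfolding sum_subtractf[symmetric] by (intro sum.cong) (auto simp: algebra_simps)
      ultimately show "\<bar>\<Sum>d\<in>?R. (?one D0 d - y d) * T d\<bar> \<le> 2 * (\<epsilon> * N)" by linarith
    qed
    also have "\<dots> = 2 * real (card E) * \<epsilon> * real n ^ card V"
    proof -
      have "real n ^ (card V - r) * N = real n ^ card V"
        unfolding N_def power_add[symmetric] using r_le_card_V by simp
      thus ?thesis by (metis (no_types, lifting) mult.assoc mult.commute)
    qed
    finally have "\<bar>homs n (?one D0) - homs n y\<bar> \<le> 2 * real (card E) * \<epsilon> * real n ^ card V" .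
    moreover have "homs n (?one D0) \<ge> \<tau>" using D0 unfolding S_def A_def by blast
    ultimately have "homs n y \<ge> \<tau> - 2 * real (card E) * \<epsilon> * real n ^ card V" by linarith
    hence "L \<le> entropy r n p y" by (rule L[OF wy])
    also have "\<dots> \<le> - ln Z"
      unfolding entropy_def y_def q_def Z_def
      using False by (intro entropy_conditional_mean_le p) (auto simp: S_def A_def)
    finally have "ln Z \<le> - L" by simp
    hence "Z \<le> exp (- L)" using Z by (metis exp_le_cancel_iff exp_ln)
    thus ?thesis unfolding Z_def .
  qed simp
  have "(\<Sum>D\<in>A. ?w D) \<le> (\<Sum>D\<in>(\<Union>B\<in>centres s (tests n) k. S B). ?w D)"
    using sub wpos finite_centres[OF finite_tests] finA
    by (intro sum_mono2) (auto simp: less_imp_le S_def)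
  also have "\<dots> \<le> (\<Sum>B\<in>centres s (tests n) k. \<Sum>D\<in>S B. ?w D)"
    using finA wpos finite_centres[OF finite_tests]
    by (intro sum_UN_le) (auto simp: S_def less_imp_le)
  also have "\<dots> \<le> real (card (centres s (tests n) k)) * exp (- L)"
    by (intro sum_bounded_above ball)
  also have "\<dots> \<le> real ((1 + 2 * card (tests n)) ^ k) * exp (- L)"
    by (intro mult_right_mono of_nat_mono card_centres_le finite_tests) auto
  finally show ?thesis unfolding A_def .
qed

end

section \<open>Estimates for the relative entropy of two Bernoulli laws\<close>

text \<open>A Pade bound: the difference vanishes at \<open>1\<close> and has derivative
  \<open>(x - 1)\<^sup>2 / (x * (x + 1)\<^sup>2)\<close>.\<close>

lemma ln_ge_pade:
  fixes t :: real
  assumes "t \<ge> 1"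
  shows "ln t \<ge> 2 * (t - 1) / (t + 1)"
proof -
  have "ln 1 - 2 * (1 - 1) / (1 + 1) \<le> ln t - 2 * (t - 1) / (t + 1)"
  proof (rule DERIV_nonneg_imp_nondecreasing[OF assms, where f = "\<lambda>t. ln t - 2 * (t - 1) / (t + 1)"])
    fix x :: real assume x: "1 \<le> x" "x \<le> t"
    have "((\<lambda>t. ln t - 2 * (t - 1) / (t + 1)) has_real_derivative
        (1 / x - (2 * (x + 1) - 2 * (x - 1)) / ((x + 1) * (x + 1)))) (at x)"
      using x by (auto intro!: derivative_eq_intros simp: field_simps)
    moreover have "1 / x - (2 * (x + 1) - 2 * (x - 1)) / ((x + 1) * (x + 1)) =
        (x - 1)\<^sup>2 / (x * ((x + 1) * (x + 1)))"
    proof -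
      have "x \<noteq> 0" "(x + 1) * (x + 1) \<noteq> 0" using x by auto
      thus ?thesis by (subst diff_frac_eq) (simp_all add: power2_eq_square algebra_simps)
    qed
    moreover have "(x - 1)\<^sup>2 / (x * ((x + 1) * (x + 1))) \<ge> 0" using x by simp
    ultimately show "\<exists>y. ((\<lambda>t. ln t - 2 * (t - 1) / (t + 1)) has_real_derivative y) (at x) \<and> 0 \<le> y"
      by metis
  qed
  thus ?thesis by simp
qed

text \<open>With the second summand of the entropy bounded below by \<open>p - x\<close>, the claim
  reduces exactly to \<open>ln_ge_pade\<close> at \<open>x / p\<close>. The logarithm is kept
  because the derivative of the entropy has the same factor.\<close>

lemma rel_entropy_ge_ln:
  assumes p: "0 < p" "p < 1" and x: "p \<le> x" "x \<le> 1"
  shows "rel_entropy p x \<ge> (x - p) / 2 * ln (x / p)"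
proof -
  have "2 * (x / p - 1) / (x / p + 1) \<le> ln (x / p)"
    using p x by (intro ln_ge_pade) simp
  moreover have "2 * (x / p - 1) / (x / p + 1) = 2 * (x - p) / (x + p)"
  proof -
    have "2 * (x / p - 1) = 2 * (x - p) / p" "x / p + 1 = (x + p) / p"
      using p by (simp_all add: field_simps)
    thus ?thesis using p by simp
  qed
  ultimately have "2 * (x - p) / (x + p) \<le> ln (x / p)" by simp
  hence "2 * (x - p) \<le> (x + p) * ln (x / p)"
    using p x by (simp add: pos_divide_le_eq mult.commute)
  moreover have "(1 - x) * ln ((1 - x) / (1 - p)) \<ge> (1 - x) - (1 - p)"
    using p x by (intro mult_ln_ratio_ge) auto
  ultimately show ?thesis unfolding rel_entropy_def by (simp add: field_simps)
qed

text \<open>A one-sided Pinsker-type bound: \<open>ln (x / p) \<ge> (x - p) / x \<ge> x - p\<close>,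
  inserted into \<open>rel_entropy_ge_ln\<close>.\<close>

lemma rel_entropy_ge_square:
  assumes p: "0 < p" "p < 1" and x: "0 \<le> x" "x \<le> 1"
  shows "rel_entropy p x \<ge> (max 0 (x - p))\<^sup>2 / 2"
proof (cases "x \<ge> p")
  case True
  have "ln (p / x) \<le> p / x - 1" using p True by (intro ln_le_minus_one) auto
  hence "ln (x / p) \<ge> (x - p) / x" using p True by (simp add: ln_div field_simps)
  moreover have "(x - p) / x \<ge> x - p"
    using p x True mult_left_le[of x "x - p"] by (simp add: pos_le_divide_eq)
  ultimately have "(x - p) / 2 * ln (x / p) \<ge> (x - p) / 2 * (x - p)"
    using True by (intro mult_left_mono) auto
  also have "(x - p) / 2 * (x - p) = (max 0 (x - p))\<^sup>2 / 2"
    using True by (simp add: power2_eq_square)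
  finally show ?thesis using rel_entropy_ge_ln[OF p True x(2)] by linarith
next
  case False
  thus ?thesis using rel_entropy_nonneg[OF p x] by simp
qed

text \<open>By convexity the increase from \<open>x\<close> to \<open>q\<close> is at most
  \<open>q - x = \<kappa> * u\<close> times the derivative at \<open>q\<close>. As
  \<open>q \<le> 1 / 8 + 2 / 4 = 5 / 8\<close> stays away from \<open>1\<close>, this derivative is
  at most \<open>3 * ln (q / p) \<le> 6 * ln (x / p)\<close>, and \<open>rel_entropy_ge_ln\<close>
  turns the product into the entropy at \<open>x\<close>, with the factor
  \<open>12 * \<kappa>\<close>.\<close>

lemma rel_entropy_scale:
  assumes p: "0 < p" "p \<le> 1 / 8" and u: "0 \<le> u" "u \<le> 1 / 4" and \<kappa>: "0 \<le> \<kappa>" "\<kappa> \<le> 1"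
  shows "rel_entropy p (p + (1 + \<kappa>) * u) \<le> (1 + 12 * \<kappa>) * rel_entropy p (p + u)"
proof -
  define x where "x = p + u"
  define w where "w = (1 + \<kappa>) * u"
  define q where "q = p + w"
  have w: "u \<le> w" "w \<le> 2 * u" using u \<kappa> by (auto simp: w_def algebra_simps mult_left_le_one_le)
  have q: "0 < q" "q \<le> 5 / 8" "p \<le> q" using p u w by (auto simp: q_def)
  have x: "0 < x" "x \<le> 1" "p \<le> x" using p u by (auto simp: x_def)
  \<comment> \<open>The Bregman identity: the error of the tangent at \<open>q\<close> is itself a
    relative entropy, hence nonnegative.\<close>
  have 1: "rel_entropy p q - rel_entropy p x =
      (q - x) * (ln (q / p) - ln ((1 - q) / (1 - p))) - rel_entropy q x"
    using p q x unfolding rel_entropy_def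
    by (cases "x = 1") (auto simp: ln_div algebra_simps)
  have 2: "ln (q / p) \<le> 2 * ln (x / p)"
  proof -
    have "q / p \<le> (x / p)\<^sup>2"
    proof -
      have "q * p \<le> (p + 2 * u) * p" using p w by (simp add: q_def)
      also have "\<dots> \<le> x\<^sup>2" using u by (simp add: x_def power2_eq_square algebra_simps)
      finally show ?thesis using p by (simp add: power2_eq_square field_simps)
    qed
    hence "ln (q / p) \<le> ln ((x / p)\<^sup>2)" using p q x by (subst ln_le_cancel_iff) auto
    thus ?thesis using p x by (simp add: ln_realpow)
  qed
  have 3: "- ln ((1 - q) / (1 - p)) \<le> 2 * ln (q / p)"
  proof -
    have "ln ((1 - p) / (1 - q)) \<le> (1 - p) / (1 - q) - 1" using p q by (intro ln_le_minus_one) auto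
    also have "(1 - p) / (1 - q) - 1 = w / (1 - q)" using q by (simp add: q_def field_simps)
    also have "\<dots> \<le> w / (3 / 8)" using q w u by (intro divide_left_mono) auto
    also have "\<dots> \<le> 2 * (w / (5 / 8))" using w u by simp
    also have "\<dots> \<le> 2 * (w / q)" using q w u by (intro mult_left_mono divide_left_mono) auto
    also have "w / q \<le> ln (q / p)"
    proof -
      have "ln (p / q) \<le> p / q - 1" using p q by (intro ln_le_minus_one) auto
      thus ?thesis using p q by (simp add: ln_div q_def field_simps)
    qed
    finally have "ln ((1 - p) / (1 - q)) \<le> 2 * ln (q / p)" by simp
    thus ?thesis using p q by (simp add: ln_div)
  qed
  have "rel_entropy p q - rel_entropy p x \<le> (q - x) * (ln (q / p) - ln ((1 - q) / (1 - p)))"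
    unfolding 1 using rel_entropy_nonneg[of q x] q x by simp
  also have "\<dots> \<le> (q - x) * (6 * ln (x / p))"
    using 2 3 w by (intro mult_left_mono) (auto simp: q_def x_def)
  also have "\<dots> = 12 * \<kappa> * ((x - p) / 2 * ln (x / p))"
    by (simp add: q_def x_def w_def algebra_simps)
  also have "\<dots> \<le> 12 * \<kappa> * rel_entropy p x"
    using rel_entropy_ge_ln[of p x] p x \<kappa> by (intro mult_left_mono) auto
  finally show ?thesis unfolding q_def w_def x_def by (simp add: algebra_simps)
qed

lemma prod_le_power_plus_sum:
  fixes a :: "'b \<Rightarrow> real"
  assumes "finite F" "\<And>e. e \<in> F \<Longrightarrow> 0 \<le> a e \<and> a e \<le> 1" "0 \<le> p" "p \<le> 1"
  shows "(\<Prod>e\<in>F. a e) \<le> p ^ card F + (\<Sum>e\<in>F. max 0 (a e - p))"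
  using assms
proof (induction F rule: finite_induct)
  case (insert e F)
  define P where "P = p ^ card F"
  define S where "S = (\<Sum>e\<in>F. max 0 (a e - p))"
  have P: "0 \<le> P" "P \<le> 1" using insert.prems by (auto simp: P_def power_le_one)
  have S: "0 \<le> S" by (auto simp: S_def intro: sum_nonneg)
  have a: "0 \<le> a e" "a e \<le> 1" using insert.prems by auto
  have IH: "(\<Prod>e\<in>F. a e) \<le> P + S" using insert by (simp add: P_def S_def)
  have "a e * (\<Prod>e\<in>F. a e) \<le> a e * (P + S)" using IH a by (intro mult_left_mono)
  also have "\<dots> = a e * P + a e * S" by (simp add: algebra_simps)
  also have "a e * S \<le> S" using a S mult_right_le_one_le[of S "a e"] by (simp add: mult.commute)
  also have "a e * P \<le> (p + max 0 (a e - p)) * P" using P by (intro mult_right_mono) auto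
  also have "\<dots> = p * P + max 0 (a e - p) * P" by (simp add: algebra_simps)
  also have "max 0 (a e - p) * P \<le> max 0 (a e - p)" using P by (intro mult_left_le) auto
  finally show ?case using insert.hyps by (simp add: P_def S_def)
qed simp

section \<open>The entropy cost of exceeding the typical count\<close>

context hypergraph
begin

text \<open>The count exceeds its typical value by at most a linear function of the total
  \<open>U\<close> of the upward deviations, so \<open>U\<close> is at least of order
  \<open>p ^ card E * n ^ r\<close>. Cauchy-Schwarz over at most \<open>n ^ r\<close> edges and the
  quadratic entropy bound finish. This scale dominates the number of balls and the additive constant
  in the tilting bound.\<close>

lemma entropy_lower_bound:
  fixes \<delta> p :: real
  assumes p: "0 < p" "p < 1" and n: "n \<ge> 1" and \<delta>: "\<delta> > 0" and g: "weighting r n g"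
    and large: "inj_homs n g \<ge> (1 + \<delta>) * p ^ card E * real n ^ card V"
  shows "entropy r n p g \<ge> (\<delta> / (real (card E) * real (r ^ r)))\<^sup>2 / 2 * p ^ (2 * card E) * real n ^ r"
proof -
  let ?R = "r_subsets r n"
  define u where "u d = max 0 (g d - p)" for d
  define U where "U = (\<Sum>d\<in>?R. u d)"
  have u0: "u d \<ge> 0" for d by (simp add: u_def)
  have m: "real (card E) > 0" using card_E_pos by simp
  have rr: "real (r ^ r) > 0" using r_pos by simp
  have np: "real n > 0" using n by simp
  have "inj_homs n g \<le> (\<Sum>x\<in>injections n. p ^ card E + (\<Sum>e\<in>E. u (x ` e)))"
    unfolding inj_homs_def u_def
    using g p injection_edge_in_r_subsets
    by (intro sum_mono prod_le_power_plus_sum) (auto simp: weighting_def)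
  also have "\<dots> = real (card (injections n)) * p ^ card E + (\<Sum>e\<in>E. \<Sum>x\<in>injections n. u (x ` e))"
    by (simp add: sum.distrib sum.swap[of _ E])
  also have "\<dots> \<le> real n ^ card V * p ^ card E +
      (\<Sum>e\<in>E. real n ^ (card V - r) * real (r ^ r) * U)"
  proof (intro add_mono mult_right_mono sum_mono card_injections_le)
    fix e assume e: "e \<in> E"
    have "(\<Sum>x\<in>injections n. u (x ` e)) = (\<Sum>x\<in>injections n. edge_value r n u (x ` e))"
      using e by (intro sum.cong) (auto simp: edge_value_def injection_edge_in_r_subsets)
    also have "\<dots> \<le> (\<Sum>x\<in>V \<rightarrow>\<^sub>E {1..n}. edge_value r n u (x ` e))"
      using u0 by (intro sum_mono2 injections_subset finite_maps) (auto simp: edge_value_def)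
    also have "\<dots> \<le> real n ^ (card V - r) * real (r ^ r) * U"
      unfolding U_def by (rule sum_maps_edge_le[OF e u0])
    finally show "(\<Sum>x\<in>injections n. u (x ` e)) \<le> real n ^ (card V - r) * real (r ^ r) * U" .
  qed (use p in auto)
  finally have "\<delta> * p ^ card E * real n ^ card V \<le>
      real (card E) * (real n ^ (card V - r) * real (r ^ r) * U)"
    using large by (simp add: algebra_simps)
  moreover have "real n ^ card V = real n ^ (card V - r) * real n ^ r"
    unfolding power_add[symmetric] using r_le_card_V by simp
  ultimately have "real n ^ (card V - r) * (\<delta> * p ^ card E * real n ^ r) \<le>
      real n ^ (card V - r) * (real (card E) * real (r ^ r) * U)"
    by (simp only: mult_ac)
  hence "\<delta> * p ^ card E * real n ^ r \<le> real (card E) * real (r ^ r) * U"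
    using np by (subst (asm) mult_le_cancel_left_pos) auto
  hence Ulow: "\<delta> / (real (card E) * real (r ^ r)) * p ^ card E * real n ^ r \<le> U"
    using m rr by (simp add: field_simps)
  have "U\<^sup>2 \<le> (\<Sum>d\<in>?R. (u d)\<^sup>2) * real (card ?R)"
    unfolding U_def using Cauchy_Schwarz_ineq_sum[of u "\<lambda>_. 1" ?R] by simp
  also have "\<dots> \<le> (\<Sum>d\<in>?R. (u d)\<^sup>2) * real n ^ r"
    using card_r_subsets_le[of r n]
    by (intro mult_left_mono) (auto intro: sum_nonneg simp flip: of_nat_power)
  finally have "U\<^sup>2 / real n ^ r \<le> (\<Sum>d\<in>?R. (u d)\<^sup>2)" using np by (simp add: field_simps)
  moreover have "(\<Sum>d\<in>?R. (u d)\<^sup>2 / 2) \<le> entropy r n p g"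
    unfolding entropy_def u_def using g p
    by (intro sum_mono rel_entropy_ge_square) (auto simp: weighting_def)
  hence "(\<Sum>d\<in>?R. (u d)\<^sup>2) / 2 \<le> entropy r n p g" by (simp add: sum_divide_distrib)
  moreover have "(\<delta> / (real (card E) * real (r ^ r)))\<^sup>2 * p ^ (2 * card E) * real n ^ r \<le> U\<^sup>2 / real n ^ r"
  proof -
    have "(\<delta> / (real (card E) * real (r ^ r)) * p ^ card E * real n ^ r)\<^sup>2 \<le> U\<^sup>2"
      using Ulow \<delta> p m rr np by (intro power_mono mult_nonneg_nonneg divide_nonneg_nonneg) auto
    moreover have "(\<delta> / (real (card E) * real (r ^ r)) * p ^ card E * real n ^ r)\<^sup>2 =
      (\<delta> / (real (card E) * real (r ^ r)))\<^sup>2 * p ^ (2 * card E) * real n ^ r * real n ^ r"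
      by (simp only: power_mult_distrib power_mult[symmetric] mult.commute[of 2])
         (simp add: power_mult power2_eq_square)
    ultimately show ?thesis using np by (simp add: pos_le_divide_eq)
  qed
  ultimately show ?thesis by linarith
qed

section \<open>The tilted measure\<close>

lemma prod_indicator_injection:
  "(\<Prod>e\<in>E. if x ` e \<in> D then 1 else (0::real)) = (if (`) x ` E \<subseteq> D then 1 else 0)"
proof (cases "(`) x ` E \<subseteq> D")
  case True
  hence "x ` e \<in> D" if "e \<in> E" for e using that by auto
  thus ?thesis using True by simp
next
  case False
  then obtain e where "e \<in> E" "x ` e \<notin> D" by auto
  hence "(\<Prod>e\<in>E. if x ` e \<in> D then 1 else (0::real)) = 0"
    by (intro prod_zero) (auto intro!: bexI[of _ e])
  thus ?thesis using False by simp
qed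

lemma image_edges_subset: "x \<in> injections n \<Longrightarrow> (`) x ` E \<subseteq> r_subsets r n"
  using injection_edge_in_r_subsets by auto

lemma expectation_inj_homs:
  "(\<Sum>D\<in>Pow (r_subsets r n). subset_weight (r_subsets r n) g D * inj_homs n (\<lambda>d. if d \<in> D then 1 else 0))
     = inj_homs n g"
proof -
  let ?R = "r_subsets r n"
  have "(\<Sum>D\<in>Pow ?R. subset_weight ?R g D * inj_homs n (\<lambda>d. if d \<in> D then 1 else 0)) =
     (\<Sum>x\<in>injections n. \<Sum>D\<in>Pow ?R. subset_weight ?R g D * (if (`) x ` E \<subseteq> D then 1 else 0))"
    unfolding inj_homs_def prod_indicator_injection sum_distrib_left by (rule sum.swap)
  also have "\<dots> = (\<Sum>x\<in>injections n. \<Prod>d\<in>(`) x ` E. g d)"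
    by (intro sum.cong refl sum_subset_weight_superset finite_r_subsets image_edges_subset)
  also have "\<dots> = inj_homs n g"
    unfolding inj_homs_def by (intro sum.cong refl) (simp add: prod.reindex[OF injection_edge_inj])
  finally show ?thesis .
qed

text \<open>Only pairs of injections that share an edge are correlated, and each contributes at most
  \<open>1\<close>. For fixed \<open>x\<close>, \<open>e\<close>, \<open>e'\<close> there are at
  most \<open>r ^ r * n ^ (card V - r)\<close> maps \<open>x'\<close> that send \<open>e'\<close>
  onto the image of \<open>e\<close>.\<close>

lemma variance_inj_homs_le:
  assumes g: "weighting r n g"
  shows "(\<Sum>D\<in>Pow (r_subsets r n). subset_weight (r_subsets r n) g D *
      (inj_homs n (\<lambda>d. if d \<in> D then 1 else 0) - inj_homs n g)\<^sup>2) \<le>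
    (real (card E))\<^sup>2 * real (r ^ r) * real n ^ (card V - r) * real n ^ card V"
proof -
  let ?R = "r_subsets r n"
  let ?w = "subset_weight ?R g"
  define T where "T D = inj_homs n (\<lambda>d. if d \<in> D then 1 else 0)" for D
  define A where "A x = (`) x ` E" for x :: "'a \<Rightarrow> nat"
  \<comment> \<open>The indicator that \<open>x'\<close> maps \<open>e'\<close> onto the image of
    \<open>e\<close> under \<open>x\<close>, in the form that \<open>sum_maps_edge_le\<close> can
    count.\<close>
  define hit where "hit x e x' e' = edge_value r n (\<lambda>d. if d = x ` e then 1 else 0) (x' ` e')"
    for x x' :: "'a \<Rightarrow> nat" and e e'
  define \<mu> where "\<mu> = inj_homs n g"
  have AR: "A x \<subseteq> ?R" if "x \<in> injections n" for x using that image_edges_subset A_def by auto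
  have finA: "finite (A x)" for x by (simp add: A_def)
  have g01: "0 \<le> g d" "g d \<le> 1" if "d \<in> ?R" for d using g that by (auto simp: weighting_def)
  have T: "T D = (\<Sum>x\<in>injections n. if A x \<subseteq> D then 1 else 0)" for D
    unfolding T_def inj_homs_def prod_indicator_injection A_def ..
  have mu: "\<mu> = (\<Sum>x\<in>injections n. \<Prod>d\<in>A x. g d)"
    unfolding \<mu>_def inj_homs_def A_def
    by (intro sum.cong refl) (simp add: prod.reindex[OF injection_edge_inj])
  have ET: "(\<Sum>D\<in>Pow ?R. ?w D * T D) = \<mu>" unfolding T_def \<mu>_def by (rule expectation_inj_homs)
  have ET2: "(\<Sum>D\<in>Pow ?R. ?w D * (T D)\<^sup>2) = (\<Sum>x\<in>injections n. \<Sum>x'\<in>injections n. \<Prod>d\<in>A x \<union> A x'. g d)"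
  proof -
    have sq: "(T D)\<^sup>2 = (\<Sum>x\<in>injections n. \<Sum>x'\<in>injections n. if A x \<union> A x' \<subseteq> D then 1 else 0)" for D
      unfolding power2_eq_square T sum_product by (intro sum.cong) auto
    have "(\<Sum>D\<in>Pow ?R. ?w D * (T D)\<^sup>2) =
      (\<Sum>D\<in>Pow ?R. \<Sum>x\<in>injections n. \<Sum>x'\<in>injections n. ?w D * (if A x \<union> A x' \<subseteq> D then 1 else 0))"
      unfolding sq sum_distrib_left ..
    also have "\<dots> = (\<Sum>x\<in>injections n. \<Sum>D\<in>Pow ?R. \<Sum>x'\<in>injections n. ?w D * (if A x \<union> A x' \<subseteq> D then 1 else 0))"
      by (rule sum.swap)
    also have "\<dots> = (\<Sum>x\<in>injections n. \<Sum>x'\<in>injections n. \<Sum>D\<in>Pow ?R. ?w D * (if A x \<union> A x' \<subseteq> D then 1 else 0))"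
      by (intro sum.cong refl sum.swap)
    also have "\<dots> = (\<Sum>x\<in>injections n. \<Sum>x'\<in>injections n. \<Prod>d\<in>A x \<union> A x'. g d)"
      by (intro sum.cong refl sum_subset_weight_superset finite_r_subsets Un_least AR)
    finally show ?thesis .
  qed
  have "(\<Sum>D\<in>Pow ?R. ?w D * (T D - \<mu>)\<^sup>2) =
     (\<Sum>D\<in>Pow ?R. ?w D * (T D)\<^sup>2) - 2 * \<mu> * (\<Sum>D\<in>Pow ?R. ?w D * T D) + \<mu>\<^sup>2 * (\<Sum>D\<in>Pow ?R. ?w D)"
    unfolding sum_distrib_left sum_subtractf[symmetric] sum.distrib[symmetric]
    by (intro sum.cong) (auto simp: power2_eq_square algebra_simps)
  also have "\<dots> = (\<Sum>D\<in>Pow ?R. ?w D * (T D)\<^sup>2) - \<mu>\<^sup>2"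
    unfolding ET sum_subset_weight[OF finite_r_subsets] by (simp add: power2_eq_square)
  also have "\<dots> = (\<Sum>x\<in>injections n. \<Sum>x'\<in>injections n. (\<Prod>d\<in>A x \<union> A x'. g d) - (\<Prod>d\<in>A x. g d) * (\<Prod>d\<in>A x'. g d))"
    unfolding ET2 mu by (simp only: power2_eq_square sum_product sum_subtractf)
  also have "\<dots> \<le> (\<Sum>x\<in>injections n. (real (card E))\<^sup>2 * real (r ^ r) * real n ^ (card V - r))"
  proof (rule sum_mono)
    fix x assume x: "x \<in> injections n"
    have "(\<Sum>x'\<in>injections n. (\<Prod>d\<in>A x \<union> A x'. g d) - (\<Prod>d\<in>A x. g d) * (\<Prod>d\<in>A x'. g d)) \<le>
      (\<Sum>x'\<in>injections n. \<Sum>e\<in>E. \<Sum>e'\<in>E. hit x e x' e')"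
    proof (rule sum_mono)
      fix x' assume x': "x' \<in> injections n"
      have nn: "0 \<le> hit x e x' e'" for e e'
        by (simp add: hit_def edge_value_def)
      show "(\<Prod>d\<in>A x \<union> A x'. g d) - (\<Prod>d\<in>A x. g d) * (\<Prod>d\<in>A x'. g d) \<le>
        (\<Sum>e\<in>E. \<Sum>e'\<in>E. hit x e x' e')"
      proof (cases "A x \<inter> A x' = {}")
        case True
        hence "(\<Prod>d\<in>A x \<union> A x'. g d) = (\<Prod>d\<in>A x. g d) * (\<Prod>d\<in>A x'. g d)"
          by (intro prod.union_disjoint finA)
        thus ?thesis using nn by (simp add: sum_nonneg)
      next
        case False
        then obtain e e' where e: "e \<in> E" "e' \<in> E" "x ` e = x' ` e'" unfolding A_def by auto
        have "1 = hit x e x' e'"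
          using e injection_edge_in_r_subsets[OF x' e(2)] by (simp add: hit_def edge_value_def)
        also have "\<dots> \<le> (\<Sum>e'\<in>E. hit x e x' e')"
          using e(2) by (intro member_le_sum nn finite_E)
        also have "\<dots> \<le> (\<Sum>e\<in>E. \<Sum>e'\<in>E. hit x e x' e')"
          using e nn by (intro member_le_sum[where f = "\<lambda>e. \<Sum>e'\<in>E. hit x e x' e'"])
            (auto intro: sum_nonneg)
        finally have 1: "1 \<le> (\<Sum>e\<in>E. \<Sum>e'\<in>E. hit x e x' e')" .
        have "(\<Prod>d\<in>A x \<union> A x'. g d) \<le> 1" using AR[OF x] AR[OF x'] g01 by (intro prod_le_1) auto
        moreover have "(\<Prod>d\<in>A x. g d) \<ge> 0" "(\<Prod>d\<in>A x'. g d) \<ge> 0"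
          using AR[OF x] AR[OF x'] g01 by (auto intro!: prod_nonneg)
        ultimately show ?thesis using 1 by (smt (verit) mult_nonneg_nonneg)
      qed
    qed
    also have "\<dots> = (\<Sum>e\<in>E. \<Sum>x'\<in>injections n. \<Sum>e'\<in>E. hit x e x' e')"
      by (rule sum.swap)
    also have "\<dots> = (\<Sum>e\<in>E. \<Sum>e'\<in>E. \<Sum>x'\<in>injections n. hit x e x' e')"
      by (intro sum.cong refl sum.swap)
    also have "\<dots> \<le> (\<Sum>e\<in>E. \<Sum>e'\<in>E. real n ^ (card V - r) * real (r ^ r))"
    proof (intro sum_mono)
      fix e e' assume e: "e \<in> E" "e' \<in> E"
      have "(\<Sum>x'\<in>injections n. hit x e x' e') \<le>
         (\<Sum>x'\<in>V \<rightarrow>\<^sub>E {1..n}. hit x e x' e')"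
        by (intro sum_mono2 injections_subset finite_maps) (auto simp: hit_def edge_value_def)
      also have "\<dots> \<le> real n ^ (card V - r) * real (r ^ r) * (\<Sum>d\<in>?R. if d = x ` e then 1 else 0)"
        unfolding hit_def using e by (intro sum_maps_edge_le) auto
      also have "(\<Sum>d\<in>?R. if d = x ` e then 1 else (0::real)) = 1"
        using injection_edge_in_r_subsets[OF x e(1)] by simp
      finally show "(\<Sum>x'\<in>injections n. hit x e x' e')
        \<le> real n ^ (card V - r) * real (r ^ r)" by simp
    qed
    also have "\<dots> = (real (card E))\<^sup>2 * real (r ^ r) * real n ^ (card V - r)"
      by (simp add: power2_eq_square)
    finally show "(\<Sum>x'\<in>injections n. (\<Prod>d\<in>A x \<union> A x'. g d) - (\<Prod>d\<in>A x. g d) * (\<Prod>d\<in>A x'. g d)) \<le>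
       (real (card E))\<^sup>2 * real (r ^ r) * real n ^ (card V - r)" .
  qed
  also have "\<dots> = (real (card E))\<^sup>2 * real (r ^ r) * real n ^ (card V - r) * real (card (injections n))"
    by simp
  also have "\<dots> \<le> (real (card E))\<^sup>2 * real (r ^ r) * real n ^ (card V - r) * real n ^ card V"
    by (intro mult_left_mono card_injections_le) auto
  finally show ?thesis unfolding T_def \<mu>_def .
qed

lemma tilted_prob_ge:
  assumes g: "weighting r n g" and \<tau>: "\<tau> < inj_homs n g"
  shows "(\<Sum>D\<in>{D \<in> Pow (r_subsets r n). inj_homs n (\<lambda>d. if d \<in> D then 1 else 0) \<ge> \<tau>}.
      subset_weight (r_subsets r n) g D) \<ge>
    1 - (real (card E))\<^sup>2 * real (r ^ r) * real n ^ (card V - r) * real n ^ card V / (inj_homs n g - \<tau>)\<^sup>2"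
proof -
  let ?R = "r_subsets r n"
  let ?w = "subset_weight ?R g"
  let ?T = "\<lambda>D. inj_homs n (\<lambda>d. if d \<in> D then 1 else 0)"
  define c where "c = (inj_homs n g - \<tau>)\<^sup>2"
  have c: "c > 0" using \<tau> by (simp add: c_def)
  have w0: "?w D \<ge> 0" if "D \<in> Pow ?R" for D
    using g that by (intro subset_weight_nonneg) (auto simp: weighting_def)
  have "(\<Sum>D\<in>Pow ?R. ?w D) - (\<Sum>D\<in>{D \<in> Pow ?R. ?T D \<ge> \<tau>}. ?w D) = (\<Sum>D\<in>{D \<in> Pow ?R. \<not> ?T D \<ge> \<tau>}. ?w D)"
  proof -
    have "(\<Sum>D\<in>Pow ?R. ?w D) = (\<Sum>D\<in>{D \<in> Pow ?R. ?T D \<ge> \<tau>} \<union> {D \<in> Pow ?R. \<not> ?T D \<ge> \<tau>}. ?w D)"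
      by (rule sum.cong) auto
    also have "\<dots> = (\<Sum>D\<in>{D \<in> Pow ?R. ?T D \<ge> \<tau>}. ?w D) + (\<Sum>D\<in>{D \<in> Pow ?R. \<not> ?T D \<ge> \<tau>}. ?w D)"
      by (intro sum.union_disjoint) auto
    finally show ?thesis by simp
  qed
  also have "\<dots> \<le> (\<Sum>D\<in>{D \<in> Pow ?R. \<not> ?T D \<ge> \<tau>}. ?w D * (?T D - inj_homs n g)\<^sup>2 / c)"
  proof (rule sum_mono)
    fix D assume D: "D \<in> {D \<in> Pow ?R. \<not> ?T D \<ge> \<tau>}"
    hence "inj_homs n g - \<tau> \<le> inj_homs n g - ?T D" by simp
    hence "c \<le> (inj_homs n g - ?T D)\<^sup>2" unfolding c_def using \<tau> by (intro power_mono) auto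
    hence "1 \<le> (?T D - inj_homs n g)\<^sup>2 / c" using c by (simp add: power2_commute)
    hence "?w D * 1 \<le> ?w D * ((?T D - inj_homs n g)\<^sup>2 / c)" using w0 D by (intro mult_left_mono) auto
    thus "?w D \<le> ?w D * (?T D - inj_homs n g)\<^sup>2 / c" by simp
  qed
  also have "\<dots> \<le> (\<Sum>D\<in>Pow ?R. ?w D * (?T D - inj_homs n g)\<^sup>2 / c)"
    using w0 c by (intro sum_mono2) auto
  also have "\<dots> = (\<Sum>D\<in>Pow ?R. ?w D * (?T D - inj_homs n g)\<^sup>2) / c"
    by (simp add: sum_divide_distrib)
  also have "\<dots> \<le> (real (card E))\<^sup>2 * real (r ^ r) * real n ^ (card V - r) * real n ^ card V / c"
    using c by (intro divide_right_mono variance_inj_homs_le[OF g]) auto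
  finally show ?thesis unfolding sum_subset_weight[OF finite_r_subsets] c_def by simp
qed

end

section \<open>Continuity of the variational problem\<close>

text \<open>Greedy: by averaging, some class has load at most \<open>\<tau>\<close>, and adding an
  element of weight at most \<open>\<tau>\<close> keeps it below \<open>2 * \<tau>\<close>.\<close>

lemma balanced_colouring:
  fixes D :: "'b \<Rightarrow> real" and K :: nat
  assumes "finite A" "\<And>u. u \<in> A \<Longrightarrow> 0 \<le> D u \<and> D u \<le> \<tau>" "(\<Sum>u\<in>A. D u) \<le> real K * \<tau>" "K \<ge> 1" "0 \<le> \<tau>"
  shows "\<exists>c :: 'b \<Rightarrow> nat. (\<forall>u\<in>A. c u < K) \<and> (\<forall>j. (\<Sum>u\<in>{u \<in> A. c u = j}. D u) \<le> 2 * \<tau>)"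
  using assms
proof (induction A rule: finite_induct)
  case (insert a A)
  have Da: "0 \<le> D a" "D a \<le> \<tau>" using insert.prems by auto
  have tot: "(\<Sum>u\<in>A. D u) \<le> real K * \<tau>" using insert.prems(2) insert.hyps Da by simp
  then obtain c :: "'b \<Rightarrow> nat" where c: "\<forall>u\<in>A. c u < K"
    "\<And>j. (\<Sum>u\<in>{u \<in> A. c u = j}. D u) \<le> 2 * \<tau>"
    using insert.IH insert.prems by auto
  have "\<exists>j<K. (\<Sum>u\<in>{u \<in> A. c u = j}. D u) \<le> \<tau>"
  proof (rule ccontr)
    assume "\<not> ?thesis"
    hence "(\<Sum>j\<in>{..<K}. \<tau>) < (\<Sum>j\<in>{..<K}. \<Sum>u\<in>{u \<in> A. c u = j}. D u)"
      using insert.prems(3) by (intro sum_strict_mono) (auto simp: not_le lessThan_empty_iff)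
    also have "\<dots> = (\<Sum>u\<in>A. D u)"
      using c(1) insert.hyps by (intro sum.group) auto
    finally show False using tot by simp
  qed
  then obtain j where j: "j < K" "(\<Sum>u\<in>{u \<in> A. c u = j}. D u) \<le> \<tau>" by auto
  define c' where "c' = c(a := j)"
  have other: "{u \<in> insert a A. c' u = i} = {u \<in> A. c u = i}" if "i \<noteq> j" for i
    using insert.hyps that by (auto simp: c'_def)
  have same: "{u \<in> insert a A. c' u = j} = insert a {u \<in> A. c u = j}"
    using insert.hyps by (auto simp: c'_def)
  have "(\<Sum>u\<in>{u \<in> insert a A. c' u = j}. D u) \<le> 2 * \<tau>"
    unfolding same using insert.hyps j Da by simp
  hence "(\<Sum>u\<in>{u \<in> insert a A. c' u = i}. D u) \<le> 2 * \<tau>" for i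
    using other[of i] c(2)[of i] by (cases "i = j") auto
  moreover have "\<forall>u\<in>insert a A. c' u < K" using c j by (auto simp: c'_def)
  ultimately show ?case by blast
qed auto

lemma permutation_extending:
  fixes x y :: "'b \<Rightarrow> nat"
  assumes "finite V" "inj_on x V" "inj_on y V" "x ` V \<subseteq> N" "y ` V \<subseteq> N" "finite N"
  shows "\<exists>\<sigma>. \<sigma> permutes N \<and> (\<forall>v\<in>V. \<sigma> (x v) = y v)"
proof -
  have "card (N - x ` V) = card (N - y ` V)"
    using assms by (simp add: card_Diff_subset card_image)
  then obtain f where f: "bij_betw f (N - x ` V) (N - y ` V)"
    using assms(6) finite_same_card_bij[of "N - x ` V" "N - y ` V"] by auto
  define s where "s d = (if d \<in> x ` V then y (inv_into V x d) else if d \<in> N then f d else d)" for d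
  have b1: "bij_betw s (x ` V) (y ` V)"
  proof -
    have "bij_betw (y \<circ> inv_into V x) (x ` V) (y ` V)"
      using assms by (intro bij_betw_trans[OF bij_betw_inv_into]) (auto simp: bij_betw_def)
    thus ?thesis by (rule bij_betw_cong[THEN iffD1, rotated]) (auto simp: s_def)
  qed
  have b2: "bij_betw s (N - x ` V) (N - y ` V)"
    using f by (rule bij_betw_cong[THEN iffD1, rotated]) (auto simp: s_def)
  have "bij_betw s (x ` V \<union> (N - x ` V)) (y ` V \<union> (N - y ` V))"
    by (rule bij_betw_combine[OF b1 b2]) auto
  hence "bij_betw s N N" using assms by (simp add: Un_absorb1)
  hence "s permutes N" using assms(4) by (intro bij_imp_permutes) (auto simp: s_def)
  moreover have "s (x v) = y v" if "v \<in> V" for v using that assms(2) by (simp add: s_def)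
  ultimately show ?thesis by auto
qed

section \<open>Expansion around the constant weighting \<open>p\<close>, and ways to increase the
  excess\<close>

context hypergraph
begin

definition nonempty_parts :: "'a set set set" where
  "nonempty_parts = Pow E - {{}}"

text \<open>The expansion of the product of \<open>p + W\<close> over all edges without its constant
  term \<open>p ^ card E\<close>; \<open>F\<close> is the set of edges that take the factor
  \<open>W\<close>.\<close>

definition local_excess :: "real \<Rightarrow> (nat set \<Rightarrow> real) \<Rightarrow> ('a \<Rightarrow> nat) \<Rightarrow> real" where
  "local_excess p W x = (\<Sum>F\<in>nonempty_parts. p ^ card (E - F) * (\<Prod>e\<in>F. W (x ` e)))"

definition excess :: "nat \<Rightarrow> real \<Rightarrow> (nat set \<Rightarrow> real) \<Rightarrow> real" where
  "excess n p W = (\<Sum>x\<in>injections n. local_excess p W x)"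

lemma finite_nonempty_parts [simp]: "finite nonempty_parts"
  by (simp add: nonempty_parts_def)

lemma nonempty_partD: "F \<in> nonempty_parts \<Longrightarrow> F \<subseteq> E \<and> F \<noteq> {} \<and> finite F"
  unfolding nonempty_parts_def using finite_subset[OF _ finite_E] by auto

lemma inj_homs_eq_excess:
  "inj_homs n (\<lambda>d. p + W d) = real (card (injections n)) * p ^ card E + excess n p W"
proof -
  have "(\<Prod>e\<in>E. p + W (x ` e)) = p ^ card E + local_excess p W x" for x
  proof -
    have "(\<Prod>e\<in>E. W (x ` e) + p) = (\<Sum>F\<in>Pow E. (\<Prod>e\<in>F. W (x ` e)) * (\<Prod>e\<in>E - F. p))"
      by (rule prod_add) simp
    also have "\<dots> = (\<Prod>e\<in>{}. W (x ` e)) * (\<Prod>e\<in>E - {}. p) +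
        (\<Sum>F\<in>Pow E - {{}}. (\<Prod>e\<in>F. W (x ` e)) * (\<Prod>e\<in>E - F. p))"
      by (intro sum.remove) auto
    finally show ?thesis
      by (simp add: local_excess_def nonempty_parts_def add.commute mult.commute)
  qed
  thus ?thesis unfolding inj_homs_def excess_def by (simp add: sum.distrib)
qed

lemma local_excess_nonneg:
  assumes "0 \<le> p" "x \<in> injections n" "\<And>d. d \<in> r_subsets r n \<Longrightarrow> 0 \<le> W d"
  shows "local_excess p W x \<ge> 0"
  unfolding local_excess_def
proof (intro sum_nonneg mult_nonneg_nonneg prod_nonneg)
  fix F e assume "F \<in> nonempty_parts" "e \<in> F"
  hence "e \<in> E" using nonempty_partD by blast
  thus "0 \<le> W (x ` e)" using assms injection_edge_in_r_subsets by blast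
qed (use assms in auto)

lemma local_excess_le:
  assumes p: "0 \<le> p" "p \<le> 1" and x: "x \<in> injections n"
    and W: "\<And>d. d \<in> r_subsets r n \<Longrightarrow> 0 \<le> W d \<and> W d \<le> 1"
  shows "local_excess p W x \<le> 2 ^ card E"
proof -
  have "local_excess p W x \<le> (\<Sum>F\<in>nonempty_parts. 1)"
    unfolding local_excess_def
  proof (rule sum_mono)
    fix F assume F: "F \<in> nonempty_parts"
    have We: "0 \<le> W (x ` e) \<and> W (x ` e) \<le> 1" if "e \<in> F" for e
      using W injection_edge_in_r_subsets[OF x, of e] that nonempty_partD[OF F] by blast
    have "(\<Prod>e\<in>F. W (x ` e)) \<le> 1" using We by (intro prod_le_1) auto
    moreover have "0 \<le> (\<Prod>e\<in>F. W (x ` e))" using We by (intro prod_nonneg) auto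
    moreover have "0 \<le> p ^ card (E - F)" "p ^ card (E - F) \<le> 1" using p by (auto simp: power_le_one)
    ultimately show "p ^ card (E - F) * (\<Prod>e\<in>F. W (x ` e)) \<le> 1" by (intro mult_le_one) auto
  qed
  also have "\<dots> \<le> real (card (Pow E))"
    using card_mono[of "Pow E" nonempty_parts] by (simp add: nonempty_parts_def)
  finally show ?thesis by (simp add: card_Pow)
qed

text \<open>Scaling up the small weights gains on every term that contains one of them.\<close>

lemma excess_scale:
  fixes p \<kappa> :: real
  assumes p: "0 \<le> p" and \<kappa>: "0 \<le> \<kappa>" and U: "\<And>d. d \<in> r_subsets r n \<Longrightarrow> 0 \<le> U d"
  shows "excess n p (\<lambda>d. if U d < 1 / 4 then (1 + \<kappa>) * U d else U d) \<ge>
    excess n p U + \<kappa> * (excess n p U - excess n p (\<lambda>d. if U d < 1 / 4 then 0 else U d))"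
proof -
  let ?S = "\<lambda>d. if U d < 1 / 4 then (1 + \<kappa>) * U d else U d"
  let ?B = "\<lambda>d. if U d < 1 / 4 then 0 else U d"
  have "excess n p U + \<kappa> * (excess n p U - excess n p ?B) =
    (\<Sum>x\<in>injections n. \<Sum>F\<in>nonempty_parts. p ^ card (E - F) *
       ((\<Prod>e\<in>F. U (x ` e)) + \<kappa> * ((\<Prod>e\<in>F. U (x ` e)) - (\<Prod>e\<in>F. ?B (x ` e)))))"
    unfolding excess_def local_excess_def
    by (simp add: sum.distrib sum_subtractf sum_distrib_left algebra_simps)
  also have "\<dots> \<le> (\<Sum>x\<in>injections n. \<Sum>F\<in>nonempty_parts. p ^ card (E - F) * (\<Prod>e\<in>F. ?S (x ` e)))"
  proof (intro sum_mono mult_left_mono)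
    fix x F assume x: "x \<in> injections n" and F: "F \<in> nonempty_parts"
    have finF: "finite F" using nonempty_partD[OF F] by blast
    have U0: "U (x ` e) \<ge> 0" if "e \<in> F" for e
      using U injection_edge_in_r_subsets[OF x, of e] that nonempty_partD[OF F] by blast
    show "(\<Prod>e\<in>F. U (x ` e)) + \<kappa> * ((\<Prod>e\<in>F. U (x ` e)) - (\<Prod>e\<in>F. ?B (x ` e))) \<le> (\<Prod>e\<in>F. ?S (x ` e))"
    proof (cases "\<exists>e\<in>F. U (x ` e) < 1 / 4")
      case False
      hence "(\<Prod>e\<in>F. ?B (x ` e)) = (\<Prod>e\<in>F. U (x ` e))" "(\<Prod>e\<in>F. ?S (x ` e)) = (\<Prod>e\<in>F. U (x ` e))"
        by (auto intro!: prod.cong)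
      thus ?thesis by simp
    next
      case True
      then obtain e where e: "e \<in> F" "U (x ` e) < 1 / 4" by blast
      have "(\<Prod>e\<in>F. ?B (x ` e)) = 0" using e finF by (intro prod_zero) auto
      moreover have "(1 + \<kappa>) * (\<Prod>e\<in>F. U (x ` e)) \<le> (\<Prod>e\<in>F. ?S (x ` e))"
      proof -
        have "(\<Prod>i\<in>F. U (x ` i)) = U (x ` e) * (\<Prod>i\<in>F - {e}. U (x ` i))"
          using e finF by (intro prod.remove)
        hence "(1 + \<kappa>) * (\<Prod>e\<in>F. U (x ` e)) = ?S (x ` e) * (\<Prod>i\<in>F - {e}. U (x ` i))"
          using e by simp
        also have "\<dots> \<le> ?S (x ` e) * (\<Prod>i\<in>F - {e}. ?S (x ` i))"
        proof (intro mult_left_mono prod_mono conjI)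
          fix i assume i: "i \<in> F - {e}"
          show "0 \<le> U (x ` i)" using i U0 by auto
          show "U (x ` i) \<le> ?S (x ` i)" using i U0[of i] \<kappa> by (auto simp: algebra_simps)
        next
          show "0 \<le> ?S (x ` e)" using e U0[of e] \<kappa> by simp
        qed
        also have "\<dots> = (\<Prod>e\<in>F. ?S (x ` e))"
          using e finF by (intro prod.remove[symmetric])
        finally show ?thesis .
      qed
      ultimately show ?thesis by (simp add: algebra_simps)
    qed
  qed (use p in auto)
  finally show ?thesis unfolding excess_def local_excess_def .
qed

text \<open>Only boundedly many vertices carry a fixed proportion of the cost, and these meet few
  injections. The other vertices split into boundedly many classes such that any \<open>card V\<close> of
  them carry little cost; since an injection meets at most \<open>card V\<close> classes, some union of
  that many classes keeps a constant proportion of the excess.\<close>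

lemma excess_restrict:
  fixes p A \<epsilon> :: real and K :: nat
  assumes n: "n \<ge> 1" and p: "0 \<le> p" "p \<le> 1" and U: "\<And>d. d \<in> r_subsets r n \<Longrightarrow> 0 \<le> U d \<and> U d \<le> 1"
    and a: "\<And>d. d \<in> r_subsets r n \<Longrightarrow> 0 \<le> a d" and tot: "(\<Sum>d\<in>r_subsets r n. a d) \<le> A" and A: "A > 0"
    and \<epsilon>: "\<epsilon> > 0" and K: "real K \<ge> 2 * real (card V) * real r / \<epsilon>" "K \<ge> 1"
  shows "\<exists>S. (\<Sum>d\<in>{d \<in> r_subsets r n. d \<subseteq> S}. a d) \<le> \<epsilon> * A \<and>
    real K ^ card V * excess n p (\<lambda>d. if d \<subseteq> S then U d else 0) \<ge>
      excess n p U - 2 ^ card E * real (card V) * real K * real n ^ card V / real n"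
proof -
  let ?R = "r_subsets r n"
  let ?v = "real (card V)"
  define Dg where "Dg u = (\<Sum>d\<in>?R. if u \<in> d then a d else 0)" for u
  \<comment> \<open>Classes will have load at most \<open>2 * \<tau>\<close>, and a union of at most
    \<open>card V\<close> of them may cost at most \<open>\<epsilon> * A\<close>.\<close>
  define \<tau> where "\<tau> = \<epsilon> * A / (2 * ?v)"
  define L where "L = {u \<in> {1..n}. Dg u \<le> \<tau>}"
  define H where "H = {u \<in> {1..n}. \<not> Dg u \<le> \<tau>}"
  have v: "?v > 0" using card_V_pos by simp
  have \<tau>: "\<tau> > 0" using A \<epsilon> v by (simp add: \<tau>_def)
  have Dg0: "Dg u \<ge> 0" for u unfolding Dg_def using a by (intro sum_nonneg) auto
  have fin: "finite L" "finite H" by (auto simp: L_def H_def)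
  have deg: "(\<Sum>u\<in>X. Dg u) = (\<Sum>d\<in>?R. real (card (d \<inter> X)) * a d)" if "finite X" for X
  proof -
    have "(\<Sum>u\<in>X. Dg u) = (\<Sum>d\<in>?R. \<Sum>u\<in>X. if u \<in> d then a d else 0)"
      unfolding Dg_def by (rule sum.swap)
    also have "\<dots> = (\<Sum>d\<in>?R. real (card (d \<inter> X)) * a d)"
      using that by (intro sum.cong refl) (simp add: sum.If_cases Int_commute Int_def)
    finally show ?thesis .
  qed
  have cR: "card d = r" "finite d" "d \<subseteq> {1..n}" if "d \<in> ?R" for d
    using that by (auto simp: r_subsets_def intro: finite_subset)
  have all: "(\<Sum>u\<in>X. Dg u) \<le> real r * A" if "finite X" for X
  proof -
    have "(\<Sum>u\<in>X. Dg u) \<le> (\<Sum>d\<in>?R. real r * a d)"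
      unfolding deg[OF that]
    proof (intro sum_mono mult_right_mono)
      fix d assume "d \<in> ?R"
      thus "real (card (d \<inter> X)) \<le> real r" "0 \<le> a d" using cR card_mono[of d "d \<inter> X"] a by auto
    qed
    also have "\<dots> \<le> real r * A" using tot by (simp add: sum_distrib_left[symmetric] mult_left_mono)
    finally show ?thesis .
  qed
  have Kt: "real r * A \<le> real K * \<tau>"
  proof -
    have "2 * ?v * real r / \<epsilon> * \<tau> \<le> real K * \<tau>" using K \<tau> by (intro mult_right_mono) auto
    moreover have "2 * ?v * real r / \<epsilon> * \<tau> = real r * A" using v \<epsilon> by (auto simp: \<tau>_def)
    ultimately show ?thesis by simp
  qed
  have cardH: "real (card H) \<le> real K"
  proof -
    have "real (card H) * \<tau> \<le> (\<Sum>u\<in>H. Dg u)"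
      by (rule sum_bounded_below) (auto simp: H_def)
    also have "\<dots> \<le> real K * \<tau>" using all[OF fin(2)] Kt by linarith
    finally show ?thesis using \<tau> by simp
  qed
  obtain c :: "nat \<Rightarrow> nat" where c: "\<forall>u\<in>L. c u < K"
    "\<And>j. (\<Sum>u\<in>{u \<in> L. c u = j}. Dg u) \<le> 2 * \<tau>"
    using balanced_colouring[OF fin(1), of Dg \<tau> K] Dg0 all[OF fin(1)] Kt K(2) \<tau>
    by (fastforce simp: L_def)
  \<comment> \<open>A pattern \<open>\<beta>\<close> prescribes the class of each vertex of
    \<open>H\<close>. Every injection that avoids the heavy set \<open>H\<close> of vertices has a
    pattern, and its whole local excess survives the restriction to
    \<open>S \<beta>\<close>.\<close>
  define S where "S \<beta> = {u \<in> L. c u \<in> \<beta> ` V}" for \<beta> :: "'a \<Rightarrow> nat"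
  define W where "W \<beta> = (\<lambda>d. if d \<subseteq> S \<beta> then U d else 0)" for \<beta> :: "'a \<Rightarrow> nat"
  have cost: "(\<Sum>d\<in>{d \<in> ?R. d \<subseteq> S \<beta>}. a d) \<le> \<epsilon> * A" for \<beta>
  proof -
    have finS: "finite (S \<beta>)" using fin by (simp add: S_def)
    have "(\<Sum>d\<in>{d \<in> ?R. d \<subseteq> S \<beta>}. a d) = (\<Sum>d\<in>?R. if d \<subseteq> S \<beta> then a d else 0)"
      by (simp add: sum.inter_filter)
    also have "\<dots> \<le> (\<Sum>d\<in>?R. real (card (d \<inter> S \<beta>)) * a d)"
    proof (rule sum_mono)
      fix d assume d: "d \<in> ?R"
      show "(if d \<subseteq> S \<beta> then a d else 0) \<le> real (card (d \<inter> S \<beta>)) * a d"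
      proof (cases "d \<subseteq> S \<beta>")
        case True
        hence "card (d \<inter> S \<beta>) = r" using cR[OF d] by (simp add: Int_absorb2)
        thus ?thesis using True r_pos a[OF d] mult_right_mono[of 1 "real r" "a d"] by simp
      next
        case False thus ?thesis using a[OF d] by simp
      qed
    qed
    also have "\<dots> = (\<Sum>u\<in>S \<beta>. Dg u)" by (rule deg[OF finS, symmetric])
    also have "\<dots> \<le> (\<Sum>j\<in>\<beta> ` V. \<Sum>u\<in>{u \<in> L. c u = j}. Dg u)"
    proof -
      have "S \<beta> = (\<Union>j\<in>\<beta> ` V. {u \<in> L. c u = j})" by (auto simp: S_def)
      thus ?thesis using sum_UN_le[of "\<beta> ` V" "\<lambda>j. {u \<in> L. c u = j}" Dg] fin Dg0 by simp
    qed
    also have "\<dots> \<le> real (card (\<beta> ` V)) * (2 * \<tau>)" by (intro sum_bounded_above c(2))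
    also have "\<dots> \<le> ?v * (2 * \<tau>)" using \<tau> card_image_le[OF finite_V, of \<beta>] by (intro mult_right_mono) auto
    also have "\<dots> = \<epsilon> * A" using v by (auto simp: \<tau>_def)
    finally show ?thesis .
  qed
  have W0: "0 \<le> W \<beta> d" if "d \<in> ?R" for \<beta> d using U[OF that] by (simp add: W_def)
  define light where "light = {x \<in> injections n. x ` V \<subseteq> L}"
  have finB: "finite (V \<rightarrow>\<^sub>E {..<K})" by (intro finite_PiE) auto
  have cardB: "card (V \<rightarrow>\<^sub>E {..<K}) = K ^ card V" by (simp add: card_PiE)
  have "(\<Sum>x\<in>light. local_excess p U x) \<le> (\<Sum>x\<in>light. \<Sum>\<beta>\<in>V \<rightarrow>\<^sub>E {..<K}. local_excess p (W \<beta>) x)"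
  proof (rule sum_mono)
    fix x assume x: "x \<in> light"
    hence xi: "x \<in> injections n" and xL: "x ` V \<subseteq> L" by (auto simp: light_def)
    define \<beta> where "\<beta> = restrict (c \<circ> x) V"
    have "c (x i) < K" if "i \<in> V" for i using c(1) xL that by blast
    hence \<beta>: "\<beta> \<in> V \<rightarrow>\<^sub>E {..<K}" by (auto simp: \<beta>_def)
    have "x ` e \<subseteq> S \<beta>" if e: "e \<in> E" for e
    proof
      fix u assume "u \<in> x ` e"
      then obtain i where i: "i \<in> V" "u = x i" using edge_subset[OF e] by blast
      have "\<beta> i = c u" using i by (simp add: \<beta>_def)
      hence "c u \<in> \<beta> ` V" using i(1) by (metis imageI)
      thus "u \<in> S \<beta>" using i xL by (auto simp: S_def)
    qed
    hence "local_excess p (W \<beta>) x = local_excess p U x"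
      unfolding local_excess_def W_def
      by (intro sum.cong refl arg_cong2[where f = "(*)"] prod.cong) (auto dest: nonempty_partD)
    thus "local_excess p U x \<le> (\<Sum>\<beta>\<in>V \<rightarrow>\<^sub>E {..<K}. local_excess p (W \<beta>) x)"
      using member_le_sum[OF \<beta>, of "\<lambda>\<beta>. local_excess p (W \<beta>) x"]
        local_excess_nonneg[OF p(1) xi W0] finB by simp
  qed
  also have "\<dots> \<le> (\<Sum>x\<in>injections n. \<Sum>\<beta>\<in>V \<rightarrow>\<^sub>E {..<K}. local_excess p (W \<beta>) x)"
    by (intro sum_mono2) (auto simp: light_def intro!: sum_nonneg local_excess_nonneg[OF p(1) _ W0])
  also have "\<dots> = (\<Sum>\<beta>\<in>V \<rightarrow>\<^sub>E {..<K}. excess n p (W \<beta>))"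
    unfolding excess_def by (rule sum.swap)
  finally have main: "(\<Sum>x\<in>light. local_excess p U x) \<le> (\<Sum>\<beta>\<in>V \<rightarrow>\<^sub>E {..<K}. excess n p (W \<beta>))" .
  have heavy: "excess n p U \<le> (\<Sum>x\<in>light. local_excess p U x) + 2 ^ card E * ?v * real K * real n ^ card V / real n"
  proof -
    have "excess n p U = (\<Sum>x\<in>injections n - light. local_excess p U x) + (\<Sum>x\<in>light. local_excess p U x)"
      unfolding excess_def by (intro sum.subset_diff) (auto simp: light_def)
    moreover have "(\<Sum>x\<in>injections n - light. local_excess p U x) \<le> real (card (injections n - light)) * 2 ^ card E"
      using U p by (intro sum_bounded_above local_excess_le) auto
    moreover have "real (card (injections n - light)) \<le> ?v * real K * (real n ^ card V / real n)"
    proof -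
      define B where "B = (\<lambda>(i, u). {x \<in> V \<rightarrow>\<^sub>E {1..n}. x i = u})"
      have cB: "card (B iu) \<le> n ^ (card V - 1)" if "iu \<in> V \<times> H" for iu
      proof (rule card_maps_determined_le[of "fst iu", where f = "\<lambda>_. snd iu"])
        show "fst iu \<in> V" using that by auto
        show "B iu \<subseteq> V \<rightarrow>\<^sub>E {1..n}" unfolding B_def by (cases iu) blast
        show "x (fst iu) = snd iu" if "x \<in> B iu" for x using that by (cases iu) (simp add: B_def)
      qed
      have "injections n - light \<subseteq> (\<Union>iu\<in>V \<times> H. B iu)"
      proof
        fix x assume x: "x \<in> injections n - light"
        then obtain i where i: "i \<in> V" "x i \<notin> L" unfolding light_def by blast
        have xV: "x \<in> V \<rightarrow>\<^sub>E {1..n}" using x injections_subset by blast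
        hence "x i \<in> H" using i unfolding H_def L_def by blast
        thus "x \<in> (\<Union>iu\<in>V \<times> H. B iu)" using i xV unfolding B_def by blast
      qed
      hence "card (injections n - light) \<le> card (\<Union>iu\<in>V \<times> H. B iu)"
        using fin by (intro card_mono) (auto simp: B_def intro: finite_subset[OF _ finite_maps])
      also have "\<dots> \<le> (\<Sum>iu\<in>V \<times> H. card (B iu))" using fin by (intro card_UN_le) auto
      also have "\<dots> \<le> card (V \<times> H) * n ^ (card V - 1)"
        using sum_bounded_above[of "V \<times> H" "\<lambda>iu. card (B iu)", OF cB] by simp
      finally have "real (card (injections n - light)) \<le> real (card (V \<times> H) * n ^ (card V - 1))"
        by (rule of_nat_mono)
      also have "\<dots> = ?v * real (card H) * real n ^ (card V - 1)"
        by (simp add: card_cartesian_product)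
      also have "\<dots> \<le> ?v * real K * real n ^ (card V - 1)"
        using cardH by (intro mult_right_mono mult_left_mono) auto
      also have "real n ^ (card V - 1) = real n ^ card V / real n"
        using n card_V_pos by (simp add: power_diff)
      finally show ?thesis .
    qed
    hence "real (card (injections n - light)) * 2 ^ card E \<le> ?v * real K * (real n ^ card V / real n) * 2 ^ card E"
      by (intro mult_right_mono) auto
    ultimately show ?thesis by (simp add: mult_ac)
  qed
  \<comment> \<open>Pigeonhole over the \<open>K ^ card V\<close> patterns.\<close>
  have "\<exists>\<beta>\<in>V \<rightarrow>\<^sub>E {..<K}. (\<Sum>\<beta>\<in>V \<rightarrow>\<^sub>E {..<K}. excess n p (W \<beta>)) \<le> real K ^ card V * excess n p (W \<beta>)"
  proof (rule ccontr)
    assume neg: "\<not> ?thesis"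
    define T where "T = (\<Sum>\<beta>\<in>V \<rightarrow>\<^sub>E {..<K}. excess n p (W \<beta>))"
    have ne: "V \<rightarrow>\<^sub>E {..<K} \<noteq> {}" using K(2) by (auto simp: PiE_eq_empty_iff lessThan_empty_iff)
    have "(\<Sum>\<beta>\<in>V \<rightarrow>\<^sub>E {..<K}. real K ^ card V * excess n p (W \<beta>)) < (\<Sum>\<beta>\<in>V \<rightarrow>\<^sub>E {..<K}. T)"
      using neg ne finB unfolding T_def by (intro sum_strict_mono) (auto simp: not_le)
    thus False unfolding sum_distrib_left[symmetric] T_def[symmetric] by (simp add: cardB)
  qed
  then obtain \<beta> where "(\<Sum>\<beta>\<in>V \<rightarrow>\<^sub>E {..<K}. excess n p (W \<beta>)) \<le> real K ^ card V * excess n p (W \<beta>)" by blast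
  hence "real K ^ card V * excess n p (W \<beta>) \<ge> excess n p U - 2 ^ card E * ?v * real K * real n ^ card V / real n"
    using main heavy by linarith
  thus ?thesis using cost[of \<beta>] unfolding W_def by blast
qed

section \<open>Permutations of the vertices acting on injections, and planting\<close>

definition act :: "(nat \<Rightarrow> nat) \<Rightarrow> ('a \<Rightarrow> nat) \<Rightarrow> 'a \<Rightarrow> nat" where
  "act \<sigma> x = restrict (\<sigma> \<circ> x) V"

lemma act_image: "e \<in> E \<Longrightarrow> act \<sigma> x ` e = \<sigma> ` x ` e"
  unfolding act_def image_image using edge_subset by (intro image_cong refl) auto

lemma act_injections:
  assumes "\<sigma> permutes {1..n}" "x \<in> injections n"
  shows "act \<sigma> x \<in> injections n"
proof -
  have "inj_on (\<sigma> \<circ> x) V"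
    using assms by (intro comp_inj_on) (auto simp: injections_def intro: permutes_inj_on)
  moreover have "\<sigma> (x i) \<in> {1..n}" if "i \<in> V" for i
  proof -
    have "x i \<in> {1..n}" using assms that by (auto simp: injections_def)
    thus ?thesis using permutes_in_image[OF assms(1)] by blast
  qed
  ultimately show ?thesis by (auto simp: injections_def act_def inj_on_restrict_eq)
qed

lemma sum_act:
  assumes "\<sigma> permutes {1..n}"
  shows "(\<Sum>x\<in>injections n. b (act \<sigma> x)) = (\<Sum>x\<in>injections n. b x)"
proof (rule sum.reindex_bij_witness[where j = "act \<sigma>" and i = "act (inv \<sigma>)"])
  have inv: "inv \<sigma> permutes {1..n}" using assms by (rule permutes_inv)
  fix x assume x: "x \<in> injections n"
  show "act (inv \<sigma>) (act \<sigma> x) = x" "act \<sigma> (act (inv \<sigma>) x) = x"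
    using x permutes_inverses[OF assms]
    by (auto simp: act_def injections_def PiE_def extensional_def fun_eq_iff)
  show "act \<sigma> x \<in> injections n" "act (inv \<sigma>) x \<in> injections n"
    using act_injections[OF assms x] act_injections[OF inv x] by auto
qed auto

text \<open>A uniformly random permutation carries a fixed injection to a uniformly random one. The
  sum over permutations is the same for every injection, since the action is transitive
  (\<open>permutation_extending\<close>); double counting then gives its value.\<close>

lemma sum_permutations_act:
  fixes b :: "('a \<Rightarrow> nat) \<Rightarrow> real"
  assumes x: "x \<in> injections n"
  shows "real (card (injections n)) * (\<Sum>\<sigma>\<in>{\<sigma>. \<sigma> permutes {1..n}}. b (act \<sigma> x)) =
    real (card {\<sigma>. \<sigma> permutes {1..n}}) * (\<Sum>y\<in>injections n. b y)"
proof -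
  let ?P = "{\<sigma>. \<sigma> permutes {1..n}}"
  have same: "(\<Sum>\<sigma>\<in>?P. b (act \<sigma> y)) = (\<Sum>\<sigma>\<in>?P. b (act \<sigma> x))" if y: "y \<in> injections n" for y
  proof -
    have xy: "inj_on x V" "inj_on y V" "x ` V \<subseteq> {1..n}" "y ` V \<subseteq> {1..n}"
      using x y by (auto simp: injections_def)
    obtain \<rho> where \<rho>: "\<rho> permutes {1..n}" "\<forall>v\<in>V. \<rho> (x v) = y v"
      using permutation_extending[OF finite_V xy] by auto
    have "act \<sigma> y = act (\<sigma> \<circ> \<rho>) x" for \<sigma>
      using \<rho>(2) by (auto simp: act_def fun_eq_iff)
    hence "(\<Sum>\<sigma>\<in>?P. b (act \<sigma> y)) = (\<Sum>\<sigma>\<in>?P. b (act (\<sigma> \<circ> \<rho>) x))" by simp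
    also have "\<dots> = (\<Sum>\<sigma>\<in>?P. b (act \<sigma> x))"
    proof (rule sum.reindex_bij_witness[where j = "\<lambda>\<sigma>. \<sigma> \<circ> \<rho>" and i = "\<lambda>\<sigma>. \<sigma> \<circ> inv \<rho>"])
      fix \<sigma> assume s: "\<sigma> \<in> ?P"
      show "\<sigma> \<circ> \<rho> \<circ> inv \<rho> = \<sigma>" "\<sigma> \<circ> inv \<rho> \<circ> \<rho> = \<sigma>"
        using permutes_inverses[OF \<rho>(1)] by (auto simp: fun_eq_iff)
      show "\<sigma> \<circ> \<rho> \<in> ?P" "\<sigma> \<circ> inv \<rho> \<in> ?P"
        using s \<rho>(1) permutes_compose permutes_inv by (metis mem_Collect_eq)+
    qed auto
    finally show ?thesis .
  qed
  have "real (card (injections n)) * (\<Sum>\<sigma>\<in>?P. b (act \<sigma> x)) = (\<Sum>y\<in>injections n. \<Sum>\<sigma>\<in>?P. b (act \<sigma> y))"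
    using same by simp
  also have "\<dots> = (\<Sum>\<sigma>\<in>?P. \<Sum>y\<in>injections n. b (act \<sigma> y))" by (rule sum.swap)
  also have "\<dots> = (\<Sum>\<sigma>\<in>?P. \<Sum>y\<in>injections n. b y)" by (intro sum.cong refl sum_act) auto
  finally show ?thesis by simp
qed

text \<open>A randomly permuted copy of \<open>W\<close> is planted on top of \<open>U\<close>. A term is lost only where both
  are present, which is unlikely because \<open>U\<close> has small homomorphism density.\<close>

lemma excess_plant:
  fixes p :: real
  assumes n: "injections n \<noteq> {}" and p: "0 \<le> p"
    and U: "\<And>d. d \<in> r_subsets r n \<Longrightarrow> 0 \<le> U d" and W: "\<And>d. d \<in> r_subsets r n \<Longrightarrow> W d = 0 \<or> W d \<ge> 1 / 4"
    and small: "\<And>F. F \<in> nonempty_parts \<Longrightarrow>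
      4 ^ card E * (\<Sum>x\<in>injections n. \<Prod>e\<in>F. U (x ` e)) \<le> real (card (injections n)) / 2"
  shows "\<exists>\<sigma>. \<sigma> permutes {1..n} \<and>
    excess n p (\<lambda>d. max (U d) (W (\<sigma> ` d))) \<ge> excess n p U + excess n p W / 2"
proof -
  let ?P = "{\<sigma>. \<sigma> permutes {1..n}}"
  let ?I = "injections n"
  have finP: "finite ?P" by (simp add: finite_permutations)
  have idP: "id \<in> ?P" by (simp add: permutes_id)
  have cI: "real (card ?I) > 0" using n by (simp add: card_gt_0_iff)
  have W0: "0 \<le> W d" if "d \<in> r_subsets r n" for d using W[OF that] by auto
  define tU where "tU F x = (\<Prod>e\<in>F. U (x ` e))" for F and x :: "'a \<Rightarrow> nat"
  define tW where "tW F x = (\<Prod>e\<in>F. W (x ` e))" for F and x :: "'a \<Rightarrow> nat"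
  \<comment> \<open>A lower bound for what planting adds to the term of \<open>F\<close> at
    \<open>x\<close>. Where the planted product is nonzero it is at least
    \<open>(1 / 4) ^ card E\<close>, so the subtracted product is at least \<open>tU F x\<close>,
    which pays for losing the old term.\<close>
  define net where "net F \<sigma> x = tW F (act \<sigma> x) - 4 ^ card E * (tU F x * tW F (act \<sigma> x))" for F \<sigma> x
  define c where "c F = p ^ card (E - F)" for F
  have c0: "c F \<ge> 0" for F using p by (simp add: c_def)
  define M where "M \<sigma> = (\<lambda>d. max (U d) (W (\<sigma> ` d)))" for \<sigma> :: "nat \<Rightarrow> nat"
  have tU0: "tU F x \<ge> 0" if "F \<in> nonempty_parts" "x \<in> ?I" for F x
    unfolding tU_def using U injection_edge_in_r_subsets that nonempty_partD by (intro prod_nonneg) blast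
  have tW0: "tW F x \<ge> 0" if "F \<in> nonempty_parts" "x \<in> ?I" for F x
    unfolding tW_def using W0 injection_edge_in_r_subsets that nonempty_partD by (intro prod_nonneg) blast
  have term_le: "tU F x + net F \<sigma> x \<le> (\<Prod>e\<in>F. M \<sigma> (x ` e))"
    if \<sigma>: "\<sigma> \<in> ?P" and F: "F \<in> nonempty_parts" and x: "x \<in> ?I" for \<sigma> F x
  proof -
    have FE: "F \<subseteq> E" and finF: "finite F" using nonempty_partD[OF F] by auto
    have ax: "act \<sigma> x \<in> ?I" using \<sigma> x act_injections by blast
    have eqW: "tW F (act \<sigma> x) = (\<Prod>e\<in>F. W (\<sigma> ` x ` e))"
      unfolding tW_def using FE by (intro prod.cong refl) (simp add: act_image subset_iff)
    have edge: "x ` e \<in> r_subsets r n" "\<sigma> ` x ` e \<in> r_subsets r n" if "e \<in> F" for e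
      using injection_edge_in_r_subsets[OF x, of e] injection_edge_in_r_subsets[OF ax, of e]
        act_image[of e \<sigma> x] that FE by auto
    have geU: "tU F x \<le> (\<Prod>e\<in>F. M \<sigma> (x ` e))"
      unfolding tU_def M_def using U edge by (intro prod_mono) auto
    have geW: "tW F (act \<sigma> x) \<le> (\<Prod>e\<in>F. M \<sigma> (x ` e))"
      unfolding eqW M_def using W0 edge by (intro prod_mono) auto
    show ?thesis
    proof (cases "tW F (act \<sigma> x) = 0")
      case True thus ?thesis using geU by (simp add: net_def)
    next
      case False
      have "(1 / 4) ^ card E \<le> tW F (act \<sigma> x)"
      proof -
        have "W (\<sigma> ` x ` e) \<noteq> 0" if "e \<in> F" for e
          using False that finF unfolding eqW by auto
        hence "(\<Prod>e\<in>F. 1 / 4) \<le> tW F (act \<sigma> x)"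
          unfolding eqW using W edge(2) by (intro prod_mono) fastforce
        moreover have "(1 / 4 :: real) ^ card E \<le> (1 / 4) ^ card F"
          using card_mono[OF finite_E FE] by (intro power_decreasing) auto
        ultimately show ?thesis unfolding prod_constant by linarith
      qed
      hence "4 ^ card E * (1 / 4) ^ card E \<le> 4 ^ card E * tW F (act \<sigma> x)" by (intro mult_left_mono) auto
      hence "1 \<le> 4 ^ card E * tW F (act \<sigma> x)" by (simp add: power_mult_distrib[symmetric])
      hence "tU F x * 1 \<le> tU F x * (4 ^ card E * tW F (act \<sigma> x))"
        using tU0[OF F x] by (intro mult_left_mono)
      thus ?thesis using geW by (simp add: net_def mult_ac)
    qed
  qed
  define gain where "gain F = (\<Sum>\<sigma>\<in>?P. \<Sum>x\<in>?I. net F \<sigma> x)" for F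
  have gain: "gain F \<ge> real (card ?P) * ((\<Sum>x\<in>?I. tW F x) / 2)" if F: "F \<in> nonempty_parts" for F
  proof -
    define sW where "sW = (\<Sum>x\<in>?I. tW F x)"
    define sU where "sU = (\<Sum>x\<in>?I. tU F x)"
    have sW0: "sW \<ge> 0" unfolding sW_def using tW0[OF F] by (intro sum_nonneg)
    have 1: "(\<Sum>\<sigma>\<in>?P. \<Sum>x\<in>?I. tW F (act \<sigma> x)) = real (card ?P) * sW"
      unfolding sW_def using sum_act[of _ n "tW F"] by simp
    \<comment> \<open>The average of the planted term over permutations does not depend on
      \<open>x\<close>, so the mean of the product factorises as for independent quantities. The
      smallness of \<open>U\<close> then limits the loss to half of the planted gain.\<close>
    have 2: "(\<Sum>\<sigma>\<in>?P. \<Sum>x\<in>?I. tU F x * tW F (act \<sigma> x)) = sU * (real (card ?P) * sW / real (card ?I))"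
    proof -
      have "(\<Sum>\<sigma>\<in>?P. \<Sum>x\<in>?I. tU F x * tW F (act \<sigma> x)) = (\<Sum>x\<in>?I. tU F x * (\<Sum>\<sigma>\<in>?P. tW F (act \<sigma> x)))"
        unfolding sum_distrib_left by (rule sum.swap)
      also have "\<dots> = (\<Sum>x\<in>?I. tU F x * (real (card ?P) * sW / real (card ?I)))"
      proof (rule sum.cong[OF refl])
        fix x assume "x \<in> ?I"
        from sum_permutations_act[OF this, of "tW F"]
        have "(\<Sum>\<sigma>\<in>?P. tW F (act \<sigma> x)) = real (card ?P) * sW / real (card ?I)"
          using cI unfolding sW_def by (subst nonzero_eq_divide_eq) (simp_all only: mult.commute)
        thus "tU F x * (\<Sum>\<sigma>\<in>?P. tW F (act \<sigma> x)) = tU F x * (real (card ?P) * sW / real (card ?I))" by simp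
      qed
      also have "\<dots> = sU * (real (card ?P) * sW / real (card ?I))"
        unfolding sU_def sum_distrib_right ..
      finally show ?thesis .
    qed
    have 3: "4 ^ card E * sU / real (card ?I) \<le> 1 / 2"
      using small[OF F] cI unfolding sU_def tU_def by (simp add: field_simps)
    have "gain F = real (card ?P) * sW - 4 ^ card E * (sU * (real (card ?P) * sW / real (card ?I)))"
      unfolding gain_def net_def sum_subtractf 1 2[symmetric] sum_distrib_left ..
    also have "\<dots> = real (card ?P) * sW * (1 - 4 ^ card E * sU / real (card ?I))"
      using cI by (simp add: field_simps)
    also have "\<dots> \<ge> real (card ?P) * sW * (1 / 2)"
      using 3 sW0 by (intro mult_left_mono) auto
    finally show ?thesis unfolding sW_def by simp
  qed
  have "(\<Sum>\<sigma>\<in>?P. excess n p U + excess n p W / 2) \<le> (\<Sum>\<sigma>\<in>?P. excess n p (M \<sigma>))"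
  proof -
    have low: "excess n p (M \<sigma>) \<ge> excess n p U +
        (\<Sum>F\<in>nonempty_parts. c F * (\<Sum>x\<in>?I. net F \<sigma> x))"
      if \<sigma>: "\<sigma> \<in> ?P" for \<sigma>
    proof -
      have "excess n p U +
        (\<Sum>F\<in>nonempty_parts. c F * (\<Sum>x\<in>?I. net F \<sigma> x)) =
        (\<Sum>x\<in>?I. \<Sum>F\<in>nonempty_parts. c F * tU F x) +
        (\<Sum>x\<in>?I. \<Sum>F\<in>nonempty_parts. c F * (net F \<sigma> x))"
        unfolding excess_def local_excess_def c_def tU_def sum_distrib_left
        by (intro arg_cong2[where f = "(+)"] refl sum.swap)
      also have "\<dots> = (\<Sum>x\<in>?I. \<Sum>F\<in>nonempty_parts. c F *
          (tU F x + net F \<sigma> x))"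
        unfolding sum.distrib[symmetric] by (intro sum.cong refl) (simp add: algebra_simps)
      also have "\<dots> \<le> (\<Sum>x\<in>?I. \<Sum>F\<in>nonempty_parts. c F * (\<Prod>e\<in>F. M \<sigma> (x ` e)))"
        using \<sigma> by (intro sum_mono mult_left_mono term_le c0)
      finally show ?thesis unfolding excess_def local_excess_def c_def .
    qed
    have "(\<Sum>\<sigma>\<in>?P. excess n p U + excess n p W / 2) = real (card ?P) * excess n p U +
       (\<Sum>F\<in>nonempty_parts. c F * (real (card ?P) * ((\<Sum>x\<in>?I. tW F x) / 2)))"
    proof -
      have "excess n p W = (\<Sum>F\<in>nonempty_parts. c F * (\<Sum>x\<in>?I. tW F x))"
        unfolding excess_def local_excess_def c_def tW_def sum_distrib_left by (rule sum.swap)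
      thus ?thesis by (simp add: ring_distribs sum_distrib_left sum_divide_distrib mult_ac)
    qed
    also have "\<dots> \<le> real (card ?P) * excess n p U + (\<Sum>F\<in>nonempty_parts. c F * gain F)"
      by (intro add_left_mono sum_mono mult_left_mono gain c0)
    also have "(\<Sum>F\<in>nonempty_parts. c F * gain F) =
       (\<Sum>\<sigma>\<in>?P. \<Sum>F\<in>nonempty_parts. c F * (\<Sum>x\<in>?I. net F \<sigma> x))"
    proof -
      have "(\<Sum>F\<in>nonempty_parts. c F * gain F) =
        (\<Sum>F\<in>nonempty_parts. \<Sum>\<sigma>\<in>?P. c F * (\<Sum>x\<in>?I. net F \<sigma> x))"
        unfolding gain_def by (intro sum.cong refl sum_distrib_left)
      also have "\<dots> = (\<Sum>\<sigma>\<in>?P. \<Sum>F\<in>nonempty_parts. c F * (\<Sum>x\<in>?I. net F \<sigma> x))"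
        by (rule sum.swap)
      finally show ?thesis .
    qed
    finally have "(\<Sum>\<sigma>\<in>?P. excess n p U + excess n p W / 2) \<le> (\<Sum>\<sigma>\<in>?P. excess n p U +
        (\<Sum>F\<in>nonempty_parts. c F * (\<Sum>x\<in>?I. net F \<sigma> x)))"
      by (simp add: sum.distrib)
    also have "\<dots> \<le> (\<Sum>\<sigma>\<in>?P. excess n p (M \<sigma>))" by (intro sum_mono low)
    finally show ?thesis .
  qed
  hence "\<exists>\<sigma>\<in>?P. excess n p U + excess n p W / 2 \<le> excess n p (M \<sigma>)"
    using sum_strict_mono[OF finP, of "\<lambda>\<sigma>. excess n p (M \<sigma>)" "\<lambda>_. excess n p U + excess n p W / 2"] idP
    by (metis (no_types, lifting) empty_iff linorder_not_le)
  thus ?thesis unfolding M_def by blast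
qed

lemma permutes_r_subsets:
  assumes "\<sigma> permutes {1..n}"
  shows "bij_betw ((`) \<sigma>) (r_subsets r n) (r_subsets r n)"
proof (rule bij_betw_byWitness[where f' = "(`) (inv \<sigma>)"])
  have inj: "inj \<sigma>" "inj (inv \<sigma>)"
    using assms permutes_inj permutes_inv by blast+
  show "\<forall>d\<in>r_subsets r n. inv \<sigma> ` \<sigma> ` d = d" "\<forall>d\<in>r_subsets r n. \<sigma> ` inv \<sigma> ` d = d"
    using permutes_inverses[OF assms] by (simp_all add: image_image)
  have sub: "\<rho> ` r' \<subseteq> {1..n}" if "\<rho> permutes {1..n}" "r' \<subseteq> {1..n}" for \<rho> r'
    using that permutes_in_image by fastforce
  have "\<rho> ` d \<in> r_subsets r n" if "\<rho> permutes {1..n}" "inj \<rho>" "d \<in> r_subsets r n" for \<rho> d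
    using sub[OF that(1), of d] that card_image[OF inj_on_subset[OF that(2), of d]]
    by (simp add: r_subsets_def)
  thus "(`) \<sigma> ` r_subsets r n \<subseteq> r_subsets r n" "(`) (inv \<sigma>) ` r_subsets r n \<subseteq> r_subsets r n"
    using assms permutes_inv[OF assms] inj by blast+
qed

text \<open>The constants depend only on \<open>H\<close>, \<open>\<delta>\<close> and
  \<open>\<epsilon>\<close>: raising the count by a fixed fraction of
  \<open>p ^ card E * n ^ card V\<close> costs a factor \<open>1 + \<epsilon>\<close>, uniformly in
  \<open>n\<close>, \<open>p\<close> and \<open>g\<close>. The cap \<open>1 + 4 * \<delta>\<close>
  on the target bounds the excess from above, as planting requires.\<close>

lemma entropy_continuity:
  fixes \<delta> \<epsilon> :: real
  assumes \<delta>: "\<delta> > 0" and \<epsilon>: "0 < \<epsilon>" "\<epsilon> \<le> 1"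
  shows "\<exists>\<eta> p0 Q. \<eta> > 0 \<and> p0 > 0 \<and> p0 \<le> 1 / 8 \<and> (\<forall>n p g \<tau>. n \<ge> 1 \<longrightarrow> 0 < p \<longrightarrow> p \<le> p0 \<longrightarrow>
     real n * p ^ card E \<ge> Q \<longrightarrow> weighting r n g \<longrightarrow>
     inj_homs n g \<ge> (1 + \<delta>) * p ^ card E * real n ^ card V \<longrightarrow>
     \<tau> \<le> inj_homs n g + \<eta> * p ^ card E * real n ^ card V \<longrightarrow>
     \<tau> \<le> (1 + 4 * \<delta>) * p ^ card E * real n ^ card V \<longrightarrow>
     (\<exists>g'. weighting r n g' \<and> inj_homs n g' \<ge> \<tau> \<and> entropy r n p g' \<le> (1 + \<epsilon>) * entropy r n p g))"
proof -
  define v where "v = real (card V)"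
  \<comment> \<open>Compensates the factor \<open>12\<close> of
    \<open>rel_entropy_scale\<close>.\<close>
  define \<kappa> where "\<kappa> = \<epsilon> / 12"
  define K where "K = nat \<lceil>2 * v * real r / \<epsilon>\<rceil> + 1"
  \<comment> \<open>The first entry is the gain from scaling. The second comes from planting: of an
    excess \<open>\<delta> / 2\<close> in large values, \<open>\<delta> / 4\<close> remains after
    the heavy vertices, the best pattern keeps a fraction \<open>1 / K ^ card V\<close>, and half of
    that survives.\<close>
  define \<eta> where "\<eta> = min (\<kappa> * \<delta> / 2) (\<delta> / (8 * real K ^ card V))"
  define p0 where "p0 = min (1 / 8) (1 / (4 * 4 ^ card E * (1 + 4 * \<delta>)))"
  \<comment> \<open>The first entry makes at least half of all maps injective; the second keeps the
    loss at heavy vertices below \<open>\<delta> / 4\<close> of the scale \<open>X\<close>.\<close>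
  define Q where "Q = max (2 * v\<^sup>2) (4 * 2 ^ card E * v * real K / \<delta>)"
  have K: "real K \<ge> 2 * real (card V) * real r / \<epsilon>" "K \<ge> 1"
    unfolding K_def v_def by linarith+
  have Kp: "real K ^ card V > 0" using K(2) by simp
  have \<kappa>: "0 < \<kappa>" "\<kappa> \<le> 1" using \<epsilon> by (auto simp: \<kappa>_def)
  have \<eta>: "\<eta> > 0" using \<kappa> \<delta> Kp by (simp add: \<eta>_def)
  have p0: "p0 > 0" "p0 \<le> 1 / 8" using \<delta> by (auto simp: p0_def)
  have "\<exists>g'. weighting r n g' \<and> inj_homs n g' \<ge> \<tau> \<and> entropy r n p g' \<le> (1 + \<epsilon>) * entropy r n p g"
    if n: "n \<ge> 1" and p: "0 < p" "p \<le> p0" and nQ: "real n * p ^ card E \<ge> Q" and g: "weighting r n g"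
      and large: "inj_homs n g \<ge> (1 + \<delta>) * p ^ card E * real n ^ card V"
      and \<tau>1: "\<tau> \<le> inj_homs n g + \<eta> * p ^ card E * real n ^ card V"
      and \<tau>2: "\<tau> \<le> (1 + 4 * \<delta>) * p ^ card E * real n ^ card V" for n p g \<tau>
  proof -
    let ?R = "r_subsets r n"
    define X where "X = p ^ card E * real n ^ card V"
    define U where "U d = max 0 (g d - p)" for d
    \<comment> \<open>Raising values below \<open>p\<close> to \<open>p\<close> removes their
      entropy and does not decrease the count, which reduces to deviations
      \<open>U \<ge> 0\<close>.\<close>
    define g1 where "g1 d = p + U d" for d
    define I where "I = real (card (injections n)) * p ^ card E"
    have np: "real n > 0" using n by simp
    have p8: "p \<le> 1 / 8" "p < 1" using p p0 by auto
    have X: "X > 0" using p np by (simp add: X_def)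
    have gR: "0 \<le> g d" "g d \<le> 1" if "d \<in> ?R" for d using g that by (auto simp: weighting_def)
    have U0: "0 \<le> U d" for d by (simp add: U_def)
    have U1: "U d \<le> 1 - p" if "d \<in> ?R" for d using gR[OF that] p8 by (simp add: U_def)
    have g1: "g1 d = max (g d) p" for d by (simp add: g1_def U_def)
    have wg1: "weighting r n g1" using gR p p8 by (simp add: weighting_def g1 max_def)
    have I: "I \<le> X" unfolding I_def X_def
      using card_injections_le[of n] p by (simp add: mult.commute mult_left_mono)
    have hom1: "inj_homs n g1 = I + excess n p U"
      unfolding g1_def I_def by (rule inj_homs_eq_excess)
    have ge1: "inj_homs n g \<le> inj_homs n g1"
      unfolding inj_homs_def using gR injection_edge_in_r_subsets
      by (intro sum_mono prod_mono) (auto simp: g1)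
    have ent1: "entropy r n p g1 \<le> entropy r n p g"
      unfolding entropy_def
    proof (rule sum_mono)
      fix d assume d: "d \<in> ?R"
      show "rel_entropy p (g1 d) \<le> rel_entropy p (g d)"
        using rel_entropy_nonneg[OF p(1) p8(2) gR[OF d]] rel_entropy_self[OF p(1) p8(2)]
        by (simp add: g1 max_def)
    qed
    show ?thesis
    proof (cases "inj_homs n g1 \<ge> \<tau>")
      case True
      have "entropy r n p g \<ge> 0" using entropy_nonneg[OF p(1) p8(2) g] .
      hence "entropy r n p g1 \<le> (1 + \<epsilon>) * entropy r n p g"
        using ent1 \<epsilon> mult_right_mono[of 1 "1 + \<epsilon>" "entropy r n p g"] by simp
      thus ?thesis using True wg1 by blast
    next
      case False
      define ex where "ex = excess n p U"
      define A where "A = entropy r n p g1"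
      have large1: "inj_homs n g1 \<ge> (1 + \<delta>) * p ^ card E * real n ^ card V" using large ge1 by linarith
      have ex_lo: "ex \<ge> \<delta> * X"
        using large1 I hom1 by (simp add: ex_def X_def algebra_simps)
      have ex_hi: "ex \<le> (1 + 4 * \<delta>) * X"
      proof -
        have "I \<ge> 0" using p by (simp add: I_def)
        thus ?thesis using False hom1 \<tau>2 by (simp add: ex_def X_def mult.assoc)
      qed
      have A: "A > 0"
      proof -
        have "(\<delta> / (real (card E) * real (r ^ r)))\<^sup>2 / 2 * p ^ (2 * card E) * real n ^ r > 0"
          using \<delta> card_E_pos r_pos p np
          by (intro mult_pos_pos divide_pos_pos zero_less_power) auto
        thus ?thesis using entropy_lower_bound[OF p(1) p8(2) n \<delta> wg1 large1] by (simp add: A_def)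
      qed
      have goal: "\<tau> \<le> inj_homs n g1 + \<eta> * X" using \<tau>1 ge1 by (simp add: X_def mult.assoc)
      define UB where "UB d = (if U d < 1 / 4 then 0 else U d)" for d
      show ?thesis
      \<comment> \<open>The difference is the contribution of the terms with at least one factor
        below \<open>1 / 4\<close>: either these carry half of the excess, or the terms with large
        factors only carry more than half.\<close>
      proof (cases "ex - excess n p UB \<ge> ex / 2")
        case True
        define US where "US d = (if U d < 1 / 4 then (1 + \<kappa>) * U d else U d)" for d
        have "excess n p US \<ge> ex + \<kappa> * (ex - excess n p UB)"
          unfolding US_def UB_def ex_def using p \<kappa> U0 by (intro excess_scale) auto
        moreover have "\<kappa> * (ex - excess n p UB) \<ge> \<kappa> * (ex / 2)"
          using True \<kappa> by (intro mult_left_mono) auto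
        moreover have "\<kappa> * (ex / 2) \<ge> \<kappa> * (\<delta> * X / 2)" using ex_lo \<kappa> by (intro mult_left_mono) auto
        moreover have "\<kappa> * (\<delta> * X / 2) \<ge> \<eta> * X"
        proof -
          have "\<eta> * X \<le> (\<kappa> * \<delta> / 2) * X" using X by (intro mult_right_mono) (auto simp: \<eta>_def)
          thus ?thesis by simp
        qed
        ultimately have "inj_homs n (\<lambda>d. p + US d) \<ge> \<tau>"
          unfolding inj_homs_eq_excess I_def[symmetric] using goal hom1 by (simp add: ex_def)
        moreover have "weighting r n (\<lambda>d. p + US d)"
          unfolding weighting_def
        proof (intro ballI conjI)
          fix d assume d: "d \<in> ?R"
          show "0 \<le> p + US d" using p U0[of d] \<kappa> by (simp add: US_def)
          have "(1 + \<kappa>) * U d \<le> 2 * U d" using \<kappa> U0[of d] by (intro mult_right_mono) auto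
          thus "p + US d \<le> 1" using U1[OF d] p8 by (simp add: US_def)
        qed
        moreover have "entropy r n p (\<lambda>d. p + US d) \<le> (1 + \<epsilon>) * A"
          unfolding A_def entropy_def sum_distrib_left
        proof (rule sum_mono)
          fix d assume d: "d \<in> ?R"
          show "rel_entropy p (p + US d) \<le> (1 + \<epsilon>) * rel_entropy p (g1 d)"
          proof (cases "U d < 1 / 4")
            case True
            thus ?thesis using rel_entropy_scale[OF p(1) p8(1) U0[of d], of \<kappa>] \<kappa>
              by (simp add: US_def g1_def \<kappa>_def)
          next
            case False
            have "rel_entropy p (g1 d) \<ge> 0"
              using wg1 d p p8 by (intro rel_entropy_nonneg) (auto simp: weighting_def)
            thus ?thesis using False \<epsilon> by (simp add: US_def g1_def[symmetric] algebra_simps)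
          qed
        qed
        moreover have "(1 + \<epsilon>) * A \<le> (1 + \<epsilon>) * entropy r n p g"
          using ent1 \<epsilon> by (intro mult_left_mono) (auto simp: A_def)
        ultimately show ?thesis by (intro exI[of _ "\<lambda>d. p + US d"]) auto
      next
        case False
        hence exB: "excess n p UB \<ge> \<delta> / 2 * X" using ex_lo by (simp add: algebra_simps)
        define a where "a d = rel_entropy p (p + UB d)" for d
        have UB01: "0 \<le> UB d \<and> UB d \<le> 1 - p" if "d \<in> ?R" for d
          using U0[of d] U1[OF that] p8 by (simp add: UB_def)
        have a0: "0 \<le> a d" if "d \<in> ?R" for d
          unfolding a_def using UB01[OF that] p p8 by (intro rel_entropy_nonneg) auto
        have aA: "(\<Sum>d\<in>?R. a d) \<le> A"
          unfolding A_def entropy_def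
        proof (rule sum_mono)
          fix d assume d: "d \<in> ?R"
          have "rel_entropy p (g1 d) \<ge> 0"
            using wg1 d p p8 by (intro rel_entropy_nonneg) (auto simp: weighting_def)
          thus "a d \<le> rel_entropy p (g1 d)"
            using rel_entropy_self[OF p(1) p8(2)] by (simp add: a_def UB_def g1_def)
        qed
        have "\<exists>S. (\<Sum>d\<in>{d \<in> ?R. d \<subseteq> S}. a d) \<le> \<epsilon> * A \<and>
           real K ^ card V * excess n p (\<lambda>d. if d \<subseteq> S then UB d else 0) \<ge>
           excess n p UB - 2 ^ card E * real (card V) * real K * real n ^ card V / real n"
        proof (rule excess_restrict[OF n _ _ _ a0 aA A \<epsilon>(1) K])
          show "0 \<le> UB d \<and> UB d \<le> 1" if "d \<in> ?R" for d using UB01[OF that] p by linarith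
        qed (use p p8 in auto)
        then obtain S where S: "(\<Sum>d\<in>{d \<in> ?R. d \<subseteq> S}. a d) \<le> \<epsilon> * A"
          "real K ^ card V * excess n p (\<lambda>d. if d \<subseteq> S then UB d else 0) \<ge>
           excess n p UB - 2 ^ card E * real (card V) * real K * real n ^ card V / real n" by blast
        define W where "W d = (if d \<subseteq> S then UB d else 0)" for d
        have W01: "0 \<le> W d" "W d \<le> 1 - p" if "d \<in> ?R" for d
          using UB01[OF that] p8 by (auto simp: W_def)
        have exW: "excess n p W \<ge> 2 * \<eta> * X"
        proof -
          have "2 ^ card E * v * real K * real n ^ card V / real n \<le> \<delta> / 4 * X"
          proof -
            have "4 * 2 ^ card E * v * real K / \<delta> \<le> real n * p ^ card E" using nQ by (simp add: Q_def)
            hence "4 * 2 ^ card E * v * real K \<le> \<delta> * (real n * p ^ card E)"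
              using \<delta> by (simp add: pos_divide_le_eq mult.commute)
            hence "2 ^ card E * v * real K / real n \<le> \<delta> / 4 * p ^ card E"
              using np by (simp add: field_simps)
            hence "2 ^ card E * v * real K / real n * real n ^ card V \<le> \<delta> / 4 * p ^ card E * real n ^ card V"
              by (intro mult_right_mono) auto
            thus ?thesis by (simp add: X_def mult_ac)
          qed
          hence "real K ^ card V * excess n p W \<ge> \<delta> / 4 * X"
            using S(2) exB unfolding W_def v_def by simp
          hence "excess n p W \<ge> \<delta> / 4 * X / real K ^ card V"
            using Kp by (subst pos_divide_le_eq) (simp_all add: mult.commute)
          moreover have "2 * \<eta> * X \<le> 2 * (\<delta> / (8 * real K ^ card V)) * X"
            using X by (intro mult_right_mono mult_left_mono) (auto simp: \<eta>_def)
          moreover have "2 * (\<delta> / (8 * real K ^ card V)) * X = \<delta> / 4 * X / real K ^ card V" by simp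
          ultimately show ?thesis by linarith
        qed
        have inj_lo: "real (card (injections n)) \<ge> real n ^ card V / 2"
        proof -
          have "real n * p ^ card E \<le> real n" using p p8 by (intro mult_left_le) (auto simp: power_le_one)
          hence "2 * v\<^sup>2 \<le> real n" using nQ by (simp add: Q_def)
          hence "v\<^sup>2 / real n \<le> 1 / 2" using np by (simp add: field_simps)
          hence "v\<^sup>2 / real n * real n ^ card V \<le> 1 / 2 * real n ^ card V"
            by (intro mult_right_mono) auto
          moreover have "v\<^sup>2 / real n * real n ^ card V = v\<^sup>2 * real n ^ card V / real n" by simp
          ultimately show ?thesis using card_non_injections_le[OF n] unfolding v_def by linarith
        qed
        have "\<exists>\<sigma>. \<sigma> permutes {1..n} \<and>
          excess n p (\<lambda>d. max (U d) (W (\<sigma> ` d))) \<ge> excess n p U + excess n p W / 2"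
        proof (rule excess_plant)
          show "injections n \<noteq> {}"
          proof
            assume "injections n = {}"
            hence "real n ^ card V / 2 \<le> 0" using inj_lo by simp
            moreover have "real n ^ card V > 0" using np by simp
            ultimately show False by linarith
          qed
          show "W d = 0 \<or> 1 / 4 \<le> W d" for d by (simp add: W_def UB_def)
          fix F assume F: "F \<in> nonempty_parts"
          define t where "t = (\<Sum>x\<in>injections n. \<Prod>e\<in>F. U (x ` e))"
          have "p ^ card (E - F) * t \<le> (\<Sum>F\<in>nonempty_parts. p ^ card (E - F) * (\<Sum>x\<in>injections n. \<Prod>e\<in>F. U (x ` e)))"
            unfolding t_def using F p U0
            by (intro member_le_sum[where f = "\<lambda>F. p ^ card (E - F) * (\<Sum>x\<in>injections n. \<Prod>e\<in>F. U (x ` e))"])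
               (auto intro!: mult_nonneg_nonneg sum_nonneg prod_nonneg)
          also have "\<dots> = ex"
            unfolding ex_def excess_def local_excess_def sum_distrib_left by (rule sum.swap)
          also have "\<dots> \<le> (1 + 4 * \<delta>) * X" by (rule ex_hi)
          \<comment> \<open>Since \<open>F\<close> is nonempty, division by
            \<open>p ^ card (E - F)\<close> leaves at least one factor \<open>p\<close>, and
            \<open>p \<le> p0\<close> supplies the smallness needed for planting.\<close>
          also have "\<dots> \<le> p ^ card (E - F) * ((1 + 4 * \<delta>) * p * real n ^ card V)"
          proof -
            have FE: "F \<subseteq> E" "F \<noteq> {}" "finite F" using nonempty_partD[OF F] by auto
            hence "card F \<ge> 1" by (simp add: One_nat_def Suc_le_eq card_gt_0_iff)
            hence "card (E - F) + 1 \<le> card E"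
              using FE card_mono[OF finite_E FE(1)] by (simp add: card_Diff_subset)
            hence "p ^ card E \<le> p ^ (card (E - F) + 1)" using p p8 by (intro power_decreasing) auto
            hence "p ^ card E * ((1 + 4 * \<delta>) * real n ^ card V) \<le>
               p ^ (card (E - F) + 1) * ((1 + 4 * \<delta>) * real n ^ card V)"
              using \<delta> by (intro mult_right_mono) auto
            moreover have "(1 + 4 * \<delta>) * X = p ^ card E * ((1 + 4 * \<delta>) * real n ^ card V)"
              "p ^ (card (E - F) + 1) * ((1 + 4 * \<delta>) * real n ^ card V) =
                p ^ card (E - F) * ((1 + 4 * \<delta>) * p * real n ^ card V)"
              by (simp_all add: X_def power_add)
            ultimately show ?thesis by linarith
          qed
          finally have "t \<le> (1 + 4 * \<delta>) * p * real n ^ card V" using p by simp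
          hence "4 ^ card E * t \<le> 4 ^ card E * ((1 + 4 * \<delta>) * p * real n ^ card V)" by (intro mult_left_mono) auto
          also have "\<dots> = (4 ^ card E * (1 + 4 * \<delta>) * p) * real n ^ card V" by (simp add: mult_ac)
          also have "\<dots> \<le> 1 / 4 * real n ^ card V"
          proof (intro mult_right_mono)
            have "p \<le> 1 / (4 * 4 ^ card E * (1 + 4 * \<delta>))" using p by (simp add: p0_def)
            hence "p * (4 * 4 ^ card E * (1 + 4 * \<delta>)) \<le> 1" using \<delta> by (subst (asm) pos_le_divide_eq) auto
            thus "4 ^ card E * (1 + 4 * \<delta>) * p \<le> 1 / 4" by (simp add: algebra_simps)
          qed auto
          finally show "4 ^ card E * (\<Sum>x\<in>injections n. \<Prod>e\<in>F. U (x ` e)) \<le> real (card (injections n)) / 2"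
            using inj_lo unfolding t_def by linarith
        qed (use p U0 in auto)
        then obtain \<sigma> where \<sigma>: "\<sigma> permutes {1..n}"
          "excess n p (\<lambda>d. max (U d) (W (\<sigma> ` d))) \<ge> excess n p U + excess n p W / 2" by blast
        have bij: "bij_betw ((`) \<sigma>) ?R ?R" by (rule permutes_r_subsets[OF \<sigma>(1)])
        define M where "M d = max (U d) (W (\<sigma> ` d))" for d
        have sR: "\<sigma> ` d \<in> ?R" if "d \<in> ?R" for d using bij that by (auto simp: bij_betw_def)
        have "inj_homs n (\<lambda>d. p + M d) \<ge> \<tau>"
          unfolding inj_homs_eq_excess I_def[symmetric] using goal hom1 exW \<sigma>(2)
          by (simp add: M_def[symmetric] ex_def)
        moreover have "weighting r n (\<lambda>d. p + M d)"
          unfolding weighting_def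
        proof (intro ballI conjI)
          fix d assume d: "d \<in> ?R"
          have "0 \<le> M d" "M d \<le> 1 - p" using U0[of d] U1[OF d] W01[OF sR[OF d]] by (auto simp: M_def)
          thus "0 \<le> p + M d" "p + M d \<le> 1" using p by auto
        qed
        moreover have "entropy r n p (\<lambda>d. p + M d) \<le> (1 + \<epsilon>) * A"
        proof -
          \<comment> \<open>The maximum of two weights costs at most the sum of their costs, and a
            permutation of the vertices does not change the cost of the planted piece.\<close>
          have "entropy r n p (\<lambda>d. p + M d) \<le> (\<Sum>d\<in>?R. rel_entropy p (g1 d) + rel_entropy p (p + W (\<sigma> ` d)))"
            unfolding entropy_def
          proof (rule sum_mono)
            fix d assume d: "d \<in> ?R"
            have "rel_entropy p (p + W (\<sigma> ` d)) \<ge> 0"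
              using W01[OF sR[OF d]] p p8 by (intro rel_entropy_nonneg) auto
            moreover have "rel_entropy p (g1 d) \<ge> 0"
              using wg1 d p p8 by (intro rel_entropy_nonneg) (auto simp: weighting_def)
            ultimately show "rel_entropy p (p + M d) \<le> rel_entropy p (g1 d) + rel_entropy p (p + W (\<sigma> ` d))"
              by (simp add: M_def max_def g1_def[symmetric])
          qed
          also have "\<dots> = A + (\<Sum>d\<in>?R. rel_entropy p (p + W (\<sigma> ` d)))"
            by (simp add: sum.distrib A_def entropy_def)
          also have "(\<Sum>d\<in>?R. rel_entropy p (p + W (\<sigma> ` d))) = (\<Sum>d\<in>?R. rel_entropy p (p + W d))"
            by (rule sum.reindex_bij_betw[OF bij])
          also have "\<dots> = (\<Sum>d\<in>?R. if d \<subseteq> S then a d else 0)"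
            using rel_entropy_self[OF p(1) p8(2)] by (intro sum.cong) (auto simp: W_def a_def)
          also have "\<dots> = (\<Sum>d\<in>{d \<in> ?R. d \<subseteq> S}. a d)" by (simp add: sum.inter_filter)
          also have "\<dots> \<le> \<epsilon> * A" by (rule S(1))
          finally show ?thesis by (simp add: algebra_simps)
        qed
        moreover have "(1 + \<epsilon>) * A \<le> (1 + \<epsilon>) * entropy r n p g"
          using ent1 \<epsilon> by (intro mult_left_mono) (auto simp: A_def)
        ultimately show ?thesis by (intro exI[of _ "\<lambda>d. p + M d"]) auto
      qed
    qed
  qed
  thus ?thesis using \<eta> p0 by (intro exI[of _ \<eta>] exI[of _ p0] exI[of _ Q]) auto
qed

end

section \<open>The upper tail\<close>

context hypergraph
begin

definition tail_prob :: "nat \<Rightarrow> real \<Rightarrow> real \<Rightarrow> real" where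
  "tail_prob n p \<delta> = measure_pmf.prob (random_hypergraph r n p)
     {D. real (copies V E n D) \<ge>
       (1 + \<delta>) * measure_pmf.expectation (random_hypergraph r n p) (\<lambda>D. real (copies V E n D))}"

text \<open>The number of automorphisms scales both the count and its expectation, so it cancels
  from the event.\<close>

lemma tail_prob_eq:
  assumes p: "0 \<le> p" "p \<le> 1"
  shows "tail_prob n p \<delta> =
    (\<Sum>D\<in>{D \<in> Pow (r_subsets r n). inj_homs n (\<lambda>d. if d \<in> D then 1 else 0) \<ge>
        (1 + \<delta>) * (real (card (injections n)) * p ^ card E)}. subset_weight (r_subsets r n) (\<lambda>_. p) D)"
proof -
  let ?R = "r_subsets r n"
  let ?a = "real (card automorphisms)"
  define \<mu> where "\<mu> = measure_pmf.expectation (random_hypergraph r n p) (\<lambda>D. real (copies V E n D))"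
  have a: "?a > 0" using card_automorphisms_pos by simp
  have "?a * \<mu> = (\<Sum>D\<in>Pow ?R. subset_weight ?R (\<lambda>_. p) D * (?a * real (copies V E n D)))"
    unfolding \<mu>_def expectation_random_hypergraph[OF p] sum_distrib_left by (simp add: mult_ac)
  also have "\<dots> = (\<Sum>D\<in>Pow ?R. subset_weight ?R (\<lambda>_. p) D * inj_homs n (\<lambda>d. if d \<in> D then 1 else 0))"
    by (intro sum.cong refl) (simp add: copies_eq)
  also have "\<dots> = inj_homs n (\<lambda>_. p)" by (rule expectation_inj_homs)
  also have "\<dots> = real (card (injections n)) * p ^ card E" by (simp add: inj_homs_def)
  finally have \<mu>: "?a * \<mu> = real (card (injections n)) * p ^ card E" .
  have "real (copies V E n D) \<ge> (1 + \<delta>) * \<mu> \<longleftrightarrow>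
      inj_homs n (\<lambda>d. if d \<in> D then 1 else 0) \<ge> (1 + \<delta>) * (real (card (injections n)) * p ^ card E)"
    if "D \<subseteq> ?R" for D
  proof -
    have "real (copies V E n D) \<ge> (1 + \<delta>) * \<mu> \<longleftrightarrow> ?a * real (copies V E n D) \<ge> ?a * ((1 + \<delta>) * \<mu>)"
      using a by simp
    also have "?a * ((1 + \<delta>) * \<mu>) = (1 + \<delta>) * (?a * \<mu>)" by simp
    finally show ?thesis unfolding copies_eq[OF that] \<mu> .
  qed
  hence "Pow ?R \<inter> {D. real (copies V E n D) \<ge> (1 + \<delta>) * \<mu>} =
    {D \<in> Pow ?R. inj_homs n (\<lambda>d. if d \<in> D then 1 else 0) \<ge> (1 + \<delta>) * (real (card (injections n)) * p ^ card E)}"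
    by blast
  thus ?thesis unfolding tail_prob_def \<mu>_def[symmetric] prob_random_hypergraph[OF p] by simp
qed

lemma ln_card_tests_le:
  assumes n: "n \<ge> 1"
  shows "ln (real (1 + 2 * card (tests n))) \<le> 4 * real (card E) * real n ^ (r - 1)"
proof -
  define m where "m = card E"
  define N where "N = n ^ (r - 1)"
  have m: "m \<ge> 1" using card_E_pos by (simp add: m_def)
  have N: "N \<ge> 1" using n by (simp add: N_def)
  have two: "(1::nat) \<le> 2 ^ (N * (m - 1))" by simp
  have "1 + 2 * card (tests n) \<le> 1 + 2 * (m * 2 ^ (N * (m - 1)))"
    using card_tests_le[of n] unfolding m_def N_def by linarith
  also have "\<dots> \<le> 3 * m * 2 ^ (N * (m - 1))"
    using mult_le_mono[OF m two] by linarith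
  finally have "real (1 + 2 * card (tests n)) \<le> real (3 * m * 2 ^ (N * (m - 1)))" by (rule of_nat_mono)
  hence "ln (real (1 + 2 * card (tests n))) \<le> ln (real (3 * m * 2 ^ (N * (m - 1))))"
    using m by (subst ln_le_cancel_iff) auto
  also have "\<dots> = ln (real (3 * m)) + real (N * (m - 1)) * ln 2"
    using m by (simp add: ln_mult_pos ln_realpow)
  also have "ln (real (3 * m)) \<le> real (3 * m)" using m by (intro order_trans[OF ln_le_minus_one]) auto
  also have "real (N * (m - 1)) * ln 2 \<le> real (N * m) * 1"
    using ln_2_less_1 by (intro mult_mono of_nat_mono) auto
  also have "real (3 * m) \<le> 3 * real m * real N"
    using N m by simp
  finally show ?thesis by (simp add: m_def N_def algebra_simps)
qed

lemma tail_bounds: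
  fixes \<delta> \<epsilon> :: real
  assumes \<delta>: "\<delta> > 0" and \<epsilon>: "0 < \<epsilon>" "\<epsilon> \<le> 1 / 2"
  shows "\<exists>p0 Q. p0 > 0 \<and> (\<forall>n p. n \<ge> 1 \<longrightarrow> 0 < p \<longrightarrow> p \<le> p0 \<longrightarrow> real n * p ^ (4 * card E) \<ge> Q \<longrightarrow>
     upper_tail_phi r V E n p \<delta> > 0 \<and>
     tail_prob n p \<delta> \<ge> exp (- ((1 + \<epsilon>) * upper_tail_phi r V E n p \<delta>)) \<and>
     tail_prob n p \<delta> \<le> exp (- ((1 - \<epsilon>) * upper_tail_phi r V E n p \<delta>)))"
proof -
  \<comment> \<open>The lower bound loses \<open>1 + \<epsilon>'\<close> for near-optimality, again
    for continuity, \<open>1 - \<epsilon>'\<close> for the tilted probability, and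
    \<open>\<epsilon>' * \<phi>\<close> for an additive \<open>1\<close>. For
    \<open>\<epsilon>' \<le> 1 / 16\<close> all this fits into
    \<open>1 + 8 * \<epsilon>'\<close>.\<close>
  define \<epsilon>' where "\<epsilon>' = \<epsilon> / 8"
  have \<epsilon>': "0 < \<epsilon>'" "\<epsilon>' \<le> 1 / 16" "\<epsilon>' \<le> 1" using \<epsilon> by (auto simp: \<epsilon>'_def)
  \<comment> \<open>Continuity is applied at \<open>\<delta> / 2\<close>, as the weightings met
    below may fall slightly short of \<open>1 + \<delta>\<close>; its cap
    \<open>1 + 4 * (\<delta> / 2)\<close> still leaves room above
    \<open>1 + \<delta>\<close>.\<close>
  have \<delta>2: "\<delta> / 2 > 0" using \<delta> by simp
  obtain \<eta>1 p1 Q1 where \<eta>1: "\<eta>1 > 0" and p1: "p1 > 0" "p1 \<le> 1 / 8" and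
    cont1: "\<And>n p g \<tau>. n \<ge> 1 \<Longrightarrow> 0 < p \<Longrightarrow> p \<le> p1 \<Longrightarrow>
     real n * p ^ card E \<ge> Q1 \<Longrightarrow> weighting r n g \<Longrightarrow>
     inj_homs n g \<ge> (1 + \<delta> / 2) * p ^ card E * real n ^ card V \<Longrightarrow>
     \<tau> \<le> inj_homs n g + \<eta>1 * p ^ card E * real n ^ card V \<Longrightarrow>
     \<tau> \<le> (1 + 4 * (\<delta> / 2)) * p ^ card E * real n ^ card V \<Longrightarrow>
     (\<exists>g'. weighting r n g' \<and> inj_homs n g' \<ge> \<tau> \<and> entropy r n p g' \<le> (1 + \<epsilon>') * entropy r n p g)"
    using entropy_continuity[OF \<delta>2 \<epsilon>'(1,3)] by metis
  define \<eta> where "\<eta> = min \<eta>1 \<delta>"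
  define m where "m = real (card E)"
  define v where "v = real (card V)"
  define C where "C = real (r ^ r)"
  define \<zeta> where "\<zeta> = \<eta> / 8"
  define c0 where "c0 = (\<delta> / 2 / (m * C))\<^sup>2 / 2"
  define c1 where "c1 = 256 * m\<^sup>2 * C\<^sup>2 / \<eta>\<^sup>2 + 1"
  define p0 where "p0 = min p1 (1 / (2 * (1 + \<delta>)))"
  \<comment> \<open>After the thresholds \<open>1\<close> and \<open>Q1\<close>, the entries serve
    in turn to bound non-injective maps by \<open>\<zeta>\<close>, to make the constant weighting
    \<open>1\<close> feasible, to compare \<open>cI\<close> with \<open>n ^ card V\<close>, to bound
    the Chebyshev error, to absorb the additive \<open>1\<close> of the tilting bound, and to absorb
    the number of balls.\<close>
  define Q where "Q = Max {1, Q1, v\<^sup>2 / \<zeta>, 2 * v\<^sup>2, 4 * (1 + \<delta>) * v\<^sup>2 / \<eta>,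
     4 * m\<^sup>2 * C / (\<eta>\<^sup>2 * \<epsilon>'), 1 / (c0 * \<epsilon>'), 4 * m * c1 / (c0 * \<epsilon>')}"
  have \<eta>: "0 < \<eta>" "\<eta> \<le> \<eta>1" "\<eta> \<le> \<delta>" using \<eta>1 \<delta> by (auto simp: \<eta>_def)
  have m: "m > 0" using card_E_pos by (simp add: m_def)
  have C: "C > 0" using r_pos by (simp add: C_def)
  have \<zeta>: "\<zeta> > 0" using \<eta> by (simp add: \<zeta>_def)
  have c0: "c0 > 0" using \<delta> m C by (simp add: c0_def)
  have c1: "c1 > 0" using m C \<eta> by (simp add: c1_def add_nonneg_pos)
  have Q: "Q \<ge> 1" "Q \<ge> Q1" "Q \<ge> v\<^sup>2 / \<zeta>" "Q \<ge> 2 * v\<^sup>2" "Q \<ge> 4 * (1 + \<delta>) * v\<^sup>2 / \<eta>"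
    "Q \<ge> 4 * m\<^sup>2 * C / (\<eta>\<^sup>2 * \<epsilon>')" "Q \<ge> 1 / (c0 * \<epsilon>')" "Q \<ge> 4 * m * c1 / (c0 * \<epsilon>')"
    unfolding Q_def by (rule Max_ge; simp)+
  have p0: "p0 > 0" using p1 \<delta> by (simp add: p0_def)
  have "upper_tail_phi r V E n p \<delta> > 0 \<and>
     tail_prob n p \<delta> \<ge> exp (- ((1 + \<epsilon>) * upper_tail_phi r V E n p \<delta>)) \<and>
     tail_prob n p \<delta> \<le> exp (- ((1 - \<epsilon>) * upper_tail_phi r V E n p \<delta>))"
    if n: "n \<ge> 1" and p: "0 < p" "p \<le> p0" and nQ: "real n * p ^ (4 * card E) \<ge> Q" for n p
  proof -
    let ?R = "r_subsets r n"
    define \<phi> where "\<phi> = upper_tail_phi r V E n p \<delta>"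
    define nv where "nv = real n ^ card V"
    define x where "x = p ^ card E"
    define X where "X = x * nv"
    define P where "P = tail_prob n p \<delta>"
    define cI where "cI = real (card (injections n))"
    have np: "real n \<ge> 1" "real n > 0" using n by auto
    have p8: "p \<le> 1 / 8" "p < 1" "p \<le> p1" using p p1 by (auto simp: p0_def)
    have nv: "nv > 0" using np by (simp add: nv_def)
    have x: "x > 0" using p by (simp add: x_def)
    have X: "X > 0" using x nv by (simp add: X_def)
    have nx: "real n * x \<ge> Q"
    proof -
      have "p ^ (4 * card E) \<le> x" unfolding x_def using p p8 by (intro power_decreasing) auto
      hence "real n * p ^ (4 * card E) \<le> real n * x" using np by (intro mult_left_mono) auto
      thus ?thesis using nQ by linarith
    qed
    have nn: "real n \<ge> Q"
    proof -
      have "x \<le> 1" unfolding x_def using p p8 by (intro power_le_one) auto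
      hence "real n * x \<le> real n" using np by (intro mult_left_le) auto
      thus ?thesis using nx by linarith
    qed
    \<comment> \<open>The scale of the lower bound on \<open>\<phi>\<close>. It is at least
      \<open>n * p ^ (4 * card E)\<close>, because \<open>r \<ge> 1\<close> and
      \<open>x\<^sup>2 = p ^ (2 * card E)\<close>.\<close>
    define Y where "Y = real n ^ r * x\<^sup>2"
    have Y: "Y \<ge> Q"
    proof -
      have "real n ^ 1 \<le> real n ^ r" using np r_pos by (intro power_increasing) auto
      moreover have "p ^ (4 * card E) \<le> x\<^sup>2"
        unfolding x_def power_mult[symmetric] using p p8 by (intro power_decreasing) auto
      ultimately have "real n * p ^ (4 * card E) \<le> Y"
        unfolding Y_def using np p by (intro mult_mono) auto
      thus ?thesis using nQ by linarith
    qed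
    have vz: "v\<^sup>2 * nv / real n \<le> \<zeta> * X"
    proof -
      have "v\<^sup>2 / \<zeta> \<le> real n * x" using Q(3) nx by linarith
      hence "v\<^sup>2 \<le> \<zeta> * (real n * x)" using \<zeta> by (simp add: pos_divide_le_eq mult.commute)
      hence "v\<^sup>2 / real n \<le> \<zeta> * x" using np by (simp add: pos_divide_le_eq mult_ac)
      hence "v\<^sup>2 / real n * nv \<le> \<zeta> * x * nv" using nv by (intro mult_right_mono) auto
      thus ?thesis by (simp add: X_def mult_ac)
    qed
    have homs_inj: "homs n g - \<zeta> * X \<le> inj_homs n g" if "weighting r n g" for g
      using homs_le_inj_homs[OF that n] vz unfolding v_def nv_def by linarith
    have cI_le: "cI \<le> nv" using card_injections_le[of n] by (simp add: cI_def nv_def)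
    have cI_ge: "cI \<ge> nv - v\<^sup>2 * nv / real n"
      using card_non_injections_le[OF n] by (simp add: cI_def nv_def v_def)
    have cont: "\<exists>g'. weighting r n g' \<and> inj_homs n g' \<ge> \<tau> \<and> entropy r n p g' \<le> (1 + \<epsilon>') * entropy r n p g"
      if "weighting r n g" "inj_homs n g \<ge> (1 + \<delta> / 2) * X" "\<tau> \<le> inj_homs n g + \<eta> * X" "\<tau> \<le> (1 + 2 * \<delta>) * X" for g \<tau>
    proof (rule cont1[OF n p(1) p8(3) _ that(1)])
      show "Q1 \<le> real n * p ^ card E" using nx Q(2) unfolding x_def by linarith
      show "(1 + \<delta> / 2) * p ^ card E * real n ^ card V \<le> inj_homs n g"
        using that(2) by (simp add: X_def x_def nv_def mult.assoc)
      have "\<eta> * X \<le> \<eta>1 * X" using \<eta> X by (intro mult_right_mono) auto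
      thus "\<tau> \<le> inj_homs n g + \<eta>1 * p ^ card E * real n ^ card V"
        using that(3) by (simp add: X_def x_def nv_def mult.assoc)
      show "\<tau> \<le> (1 + 4 * (\<delta> / 2)) * p ^ card E * real n ^ card V"
        using that(4) by (simp add: X_def x_def nv_def mult.assoc)
    qed
    have ent_lo: "c0 * Y \<le> entropy r n p g" if "weighting r n g" "inj_homs n g \<ge> (1 + \<delta> / 2) * X" for g
    proof -
      have "(\<delta> / 2 / (real (card E) * real (r ^ r)))\<^sup>2 / 2 * p ^ (2 * card E) * real n ^ r \<le> entropy r n p g"
        using that by (intro entropy_lower_bound p p8 n \<delta>2) (simp_all add: X_def x_def nv_def mult.assoc)
      moreover have "p ^ (2 * card E) = x\<^sup>2" by (simp add: x_def power_mult[symmetric] mult.commute)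
      ultimately show ?thesis by (simp add: c0_def m_def C_def Y_def mult_ac)
    qed
    define \<Phi> where "\<Phi> = {entropy r n p g | g. weighting r n g \<and> homs n g / real n ^ card V \<ge> (1 + \<delta>) * p ^ card E}"
    have \<phi>_def': "\<phi> = Inf \<Phi>" unfolding \<phi>_def \<Phi>_def by (rule upper_tail_phi_eq)
    have feas: "homs n g / real n ^ card V \<ge> (1 + \<delta>) * p ^ card E \<longleftrightarrow> homs n g \<ge> (1 + \<delta>) * X" for g
      using nv unfolding nv_def[symmetric] x_def[symmetric] X_def by (simp add: pos_le_divide_eq mult.assoc)
    have feas_inj: "inj_homs n g \<ge> (1 + \<delta> - \<zeta>) * X"
      if "weighting r n g" "homs n g \<ge> (1 + \<delta>) * X" for g
      using homs_inj[OF that(1)] that(2) by (simp add: algebra_simps)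
    have mono_X: "a * X \<le> b * X" if "a \<le> b" for a b using X that by (intro mult_right_mono) auto
    have ne: "\<Phi> \<noteq> {}"
    proof -
      have w: "weighting r n (\<lambda>_. 1)" by (simp add: weighting_def)
      have "v\<^sup>2 / real n \<le> 1 / 2" using nn Q(4) np by (simp add: field_simps)
      hence "v\<^sup>2 / real n * nv \<le> 1 / 2 * nv" using nv by (intro mult_right_mono) auto
      hence "cI \<ge> nv / 2" using cI_ge by simp
      moreover have "inj_homs n (\<lambda>_. 1) = cI" by (simp add: inj_homs_def cI_def)
      moreover have "(1 + \<delta>) * X \<le> nv / 2"
      proof -
        have "x \<le> p ^ 1" unfolding x_def using p p8 card_E_pos by (intro power_decreasing) auto
        hence "x \<le> 1 / (2 * (1 + \<delta>))" using p by (simp add: p0_def)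
        hence "(1 + \<delta>) * x \<le> 1 / 2" using \<delta> by (simp add: field_simps)
        hence "(1 + \<delta>) * x * nv \<le> 1 / 2 * nv" using nv by (intro mult_right_mono) auto
        thus ?thesis by (simp add: X_def mult.assoc)
      qed
      ultimately have "homs n (\<lambda>_. 1) \<ge> (1 + \<delta>) * X" using inj_homs_le_homs[OF w] by linarith
      thus ?thesis unfolding \<Phi>_def feas using w by blast
    qed
    have bdd: "bdd_below \<Phi>"
      unfolding \<Phi>_def using entropy_nonneg[OF p(1) p8(2)] by (auto intro!: bdd_belowI[of _ 0])
    have \<phi>_lo: "\<phi> \<ge> c0 * Y"
      unfolding \<phi>_def'
    proof (rule cInf_greatest[OF ne])
      fix t assume "t \<in> \<Phi>"
      then obtain g where g: "t = entropy r n p g" "weighting r n g" "homs n g \<ge> (1 + \<delta>) * X"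
        unfolding \<Phi>_def feas by blast
      have "(1 + \<delta> / 2) * X \<le> (1 + \<delta> - \<zeta>) * X" using \<eta> by (intro mono_X) (simp add: \<zeta>_def)
      hence "inj_homs n g \<ge> (1 + \<delta> / 2) * X" using feas_inj[OF g(2,3)] by linarith
      thus "c0 * Y \<le> t" using ent_lo[OF g(2)] g(1) by simp
    qed
    have \<phi>_pos: "\<phi> > 0"
    proof -
      have "c0 * Y > 0" using c0 Y Q(1) by simp
      thus ?thesis using \<phi>_lo by linarith
    qed
    have \<phi>_le: "\<phi> \<le> entropy r n p g" if "weighting r n g" "inj_homs n g \<ge> (1 + \<delta>) * X" for g
    proof -
      have "homs n g \<ge> (1 + \<delta>) * X" using inj_homs_le_homs[OF that(1)] that(2) by linarith
      hence "entropy r n p g \<in> \<Phi>" unfolding \<Phi>_def feas using that(1) by blast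
      thus ?thesis unfolding \<phi>_def' using bdd by (rule cInf_lower)
    qed
    have one_le: "1 \<le> \<epsilon>' * \<phi>"
    proof -
      have "1 / (c0 * \<epsilon>') \<le> Y" using Q(7) Y by linarith
      hence "1 \<le> Y * (c0 * \<epsilon>')" using c0 \<epsilon>' by (simp add: pos_divide_le_eq)
      also have "\<dots> = \<epsilon>' * (c0 * Y)" by simp
      also have "\<dots> \<le> \<epsilon>' * \<phi>" using \<phi>_lo \<epsilon>' by (intro mult_left_mono) auto
      finally show ?thesis .
    qed
    define S where "S = {D \<in> Pow ?R. inj_homs n (\<lambda>d. if d \<in> D then 1 else 0) \<ge> (1 + \<delta>) * (cI * x)}"
    have P_eq: "P = (\<Sum>D\<in>S. subset_weight ?R (\<lambda>_. p) D)"
      unfolding P_def S_def cI_def x_def using p p8 by (intro tail_prob_eq) auto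
    have lower: "P \<ge> exp (- ((1 + \<epsilon>) * \<phi>))"
    proof -
      have "Inf \<Phi> < (1 + \<epsilon>') * \<phi>" using \<phi>_pos \<epsilon>' by (simp add: \<phi>_def'[symmetric])
      then obtain t where "t \<in> \<Phi>" "t < (1 + \<epsilon>') * \<phi>" using cInf_lessD[OF ne] by blast
      then obtain g where g: "weighting r n g" "homs n g \<ge> (1 + \<delta>) * X" "entropy r n p g < (1 + \<epsilon>') * \<phi>"
        unfolding \<Phi>_def feas by blast
      have gi: "inj_homs n g \<ge> (1 + \<delta> - \<zeta>) * X" by (rule feas_inj[OF g(1,2)])
      \<comment> \<open>The surplus \<open>\<eta> / 2 * X\<close> over the threshold is the room
        needed for Chebyshev under the tilted law; continuity gains it even after the loss
        \<open>\<zeta> * X\<close> from non-injective maps.\<close>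
      have "\<exists>g'. weighting r n g' \<and> inj_homs n g' \<ge> (1 + \<delta> + \<eta> / 2) * X \<and>
         entropy r n p g' \<le> (1 + \<epsilon>') * entropy r n p g"
      proof (rule cont[OF g(1)])
        have "(1 + \<delta> / 2) * X \<le> (1 + \<delta> - \<zeta>) * X" using \<eta> by (intro mono_X) (simp add: \<zeta>_def)
        thus "inj_homs n g \<ge> (1 + \<delta> / 2) * X" using gi by linarith
        have "(1 + \<delta> + \<eta> / 2) * X \<le> (1 + \<delta> - \<zeta> + \<eta>) * X" using \<eta> by (intro mono_X) (simp add: \<zeta>_def)
        thus "(1 + \<delta> + \<eta> / 2) * X \<le> inj_homs n g + \<eta> * X" using gi by (simp add: algebra_simps)
        show "(1 + \<delta> + \<eta> / 2) * X \<le> (1 + 2 * \<delta>) * X" using \<eta> \<delta> by (intro mono_X) simp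
      qed
      then obtain g' where g': "weighting r n g'" "inj_homs n g' \<ge> (1 + \<delta> + \<eta> / 2) * X"
        "entropy r n p g' \<le> (1 + \<epsilon>') * entropy r n p g" by blast
      define \<tau> where "\<tau> = (1 + \<delta>) * (cI * x)"
      define a where "a = (\<Sum>D\<in>S. subset_weight ?R g' D)"
      have "\<tau> \<le> (1 + \<delta>) * X"
        unfolding \<tau>_def X_def using cI_le x \<delta> by (simp add: mult_ac mult_left_mono)
      hence gap: "inj_homs n g' - \<tau> \<ge> \<eta> / 2 * X" using g'(2) by (simp add: algebra_simps)
      have gap0: "\<eta> / 2 * X > 0" using \<eta> X by simp
      have gap1: "inj_homs n g' - \<tau> > 0" using gap gap0 by linarith
      have a_ge: "a \<ge> 1 - \<epsilon>'"
      proof -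
        have "1 - m\<^sup>2 * C * real n ^ (card V - r) * nv / (inj_homs n g' - \<tau>)\<^sup>2 \<le> a"
          using tilted_prob_ge[OF g'(1), of \<tau>] gap gap0
          unfolding a_def S_def \<tau>_def m_def C_def nv_def by simp
        moreover have "m\<^sup>2 * C * real n ^ (card V - r) * nv / (inj_homs n g' - \<tau>)\<^sup>2 \<le>
            m\<^sup>2 * C * real n ^ (card V - r) * nv / (\<eta> / 2 * X)\<^sup>2"
          using gap gap0 gap1 m C nv np
          by (intro divide_left_mono power_mono mult_nonneg_nonneg mult_pos_pos[OF zero_less_power zero_less_power]
              less_imp_le[OF gap0]) auto
        moreover have "m\<^sup>2 * C * real n ^ (card V - r) * nv / (\<eta> / 2 * X)\<^sup>2 = 4 * m\<^sup>2 * C / \<eta>\<^sup>2 / Y"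
        proof -
          have "nv = real n ^ (card V - r) * real n ^ r"
            unfolding nv_def power_add[symmetric] using r_le_card_V by simp
          thus ?thesis using np x \<eta> by (simp add: X_def Y_def power2_eq_square field_simps)
        qed
        moreover have "4 * m\<^sup>2 * C / \<eta>\<^sup>2 / Y \<le> \<epsilon>'"
        proof -
          have "4 * m\<^sup>2 * C / (\<eta>\<^sup>2 * \<epsilon>') \<le> Y" using Q(6) Y by linarith
          hence "4 * m\<^sup>2 * C \<le> Y * (\<eta>\<^sup>2 * \<epsilon>')" using \<eta> \<epsilon>' by (simp add: pos_divide_le_eq)
          hence "4 * m\<^sup>2 * C / \<eta>\<^sup>2 \<le> \<epsilon>' * Y" using \<eta> by (simp add: pos_divide_le_eq mult_ac)
          moreover have "Y > 0" using Y Q(1) by linarith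
          ultimately show ?thesis by (subst pos_divide_le_eq) auto
        qed
        ultimately show ?thesis by linarith
      qed
      have "S \<noteq> {}" using a_ge \<epsilon>' unfolding a_def by auto
      hence P_pos: "P > 0"
        unfolding P_eq using subset_weight_pos[OF p(1) p8(2)] by (intro sum_pos) (auto simp: S_def)
      have "- a * ln P - 1 \<le> entropy r n p g'"
        unfolding a_def P_eq entropy_def using g'(1)
        by (intro entropy_ge_tilted_prob p p8) (auto simp: S_def weighting_def)
      also have "\<dots> \<le> (1 + \<epsilon>') * ((1 + \<epsilon>') * \<phi>)"
        using g'(3) g(3) \<epsilon>' by (intro order_trans[OF g'(3)] mult_left_mono) auto
      finally have 1: "a * (- ln P) \<le> ((1 + \<epsilon>')\<^sup>2 + \<epsilon>') * \<phi>"
        using one_le by (simp add: power2_eq_square algebra_simps)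
      have "- ln P \<le> (1 + \<epsilon>) * \<phi>"
      proof (rule ccontr)
        assume "\<not> ?thesis"
        hence neg: "(1 + \<epsilon>) * \<phi> < - ln P" by simp
        have "(1 - \<epsilon>') * ((1 + \<epsilon>) * \<phi>) \<le> a * ((1 + \<epsilon>) * \<phi>)"
          using a_ge \<phi>_pos \<epsilon> by (intro mult_right_mono) auto
        also have "\<dots> < a * (- ln P)" using neg a_ge \<epsilon>' by (intro mult_strict_left_mono) auto
        also note 1
        finally have "((1 - \<epsilon>') * (1 + \<epsilon>)) * \<phi> < ((1 + \<epsilon>')\<^sup>2 + \<epsilon>') * \<phi>" by (simp add: mult.assoc)
        hence lt: "(1 - \<epsilon>') * (1 + \<epsilon>) < (1 + \<epsilon>')\<^sup>2 + \<epsilon>'" using \<phi>_pos by simp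
        have "\<epsilon> = 8 * \<epsilon>'" by (simp add: \<epsilon>'_def)
        hence "4 * \<epsilon>' < 9 * (\<epsilon>' * \<epsilon>')" using lt by (simp add: power2_eq_square algebra_simps)
        moreover have "\<epsilon>' * \<epsilon>' \<le> \<epsilon>' * (1 / 16)" using \<epsilon>' by (intro mult_left_mono) auto
        ultimately show False using \<epsilon>' by linarith
      qed
      hence "exp (- ((1 + \<epsilon>) * \<phi>)) \<le> exp (ln P)" by simp
      thus ?thesis using P_pos by simp
    qed
    have upper: "P \<le> exp (- ((1 - \<epsilon>) * \<phi>))"
    proof -
      define \<tau> where "\<tau> = (1 + \<delta>) * (cI * x)"
      \<comment> \<open>Chosen so that the loss \<open>2 * card E * \<epsilon>0 * n ^ card V\<close>
        of the covering bound equals \<open>\<eta> / 8 * X\<close>.\<close>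
      define \<epsilon>0 where "\<epsilon>0 = \<eta> * x / (16 * m)"
      define k where "k = nat \<lfloor>C\<^sup>2 / \<epsilon>0\<^sup>2\<rfloor> + 1"
      define L where "L = \<phi> / (1 + \<epsilon>')"
      have \<epsilon>0: "\<epsilon>0 > 0" using \<eta> x m by (simp add: \<epsilon>0_def)
      have k1: "real k > C\<^sup>2 / \<epsilon>0\<^sup>2" unfolding k_def by linarith
      have k2: "real k \<le> C\<^sup>2 / \<epsilon>0\<^sup>2 + 1"
      proof -
        have "C\<^sup>2 / \<epsilon>0\<^sup>2 \<ge> 0" by simp
        thus ?thesis unfolding k_def by linarith
      qed
      have \<tau>_ge: "\<tau> \<ge> (1 + \<delta> - \<eta> / 4) * X"
      proof -
        have "4 * (1 + \<delta>) * v\<^sup>2 / \<eta> \<le> real n" using Q(5) nn by linarith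
        hence "4 * (1 + \<delta>) * v\<^sup>2 \<le> real n * \<eta>" using \<eta> by (simp add: pos_divide_le_eq)
        hence "(1 + \<delta>) * (v\<^sup>2 / real n) \<le> \<eta> / 4" using np by (simp add: field_simps)
        hence "(1 + \<delta>) * (v\<^sup>2 / real n) * X \<le> \<eta> / 4 * X" by (rule mono_X)
        moreover have "(1 + \<delta>) * ((nv - v\<^sup>2 * nv / real n) * x) \<le> \<tau>"
          unfolding \<tau>_def using cI_ge x \<delta> by (intro mult_left_mono mult_right_mono) auto
        moreover have "(1 + \<delta>) * ((nv - v\<^sup>2 * nv / real n) * x) = (1 + \<delta>) * X - (1 + \<delta>) * (v\<^sup>2 / real n) * X"
          by (simp add: X_def algebra_simps)
        moreover have "(1 + \<delta> - \<eta> / 4) * X = (1 + \<delta>) * X - \<eta> / 4 * X" by (simp add: algebra_simps)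
        ultimately show ?thesis by linarith
      qed
      have "(\<Sum>D\<in>{D \<in> Pow ?R. homs n (\<lambda>d. if d \<in> D then 1 else 0) \<ge> \<tau>}. subset_weight ?R (\<lambda>_. p) D)
          \<le> real ((1 + 2 * card (tests n)) ^ k) * exp (- L)"
      proof (rule upper_tail_cover_bound[OF p(1) p8(2) n \<epsilon>0])
        show "(real (r ^ r))\<^sup>2 < real k * \<epsilon>0\<^sup>2"
          using k1 \<epsilon>0 unfolding C_def[symmetric] by (simp add: pos_divide_less_eq)
        fix y assume y: "weighting r n y" and hy: "\<tau> - 2 * real (card E) * \<epsilon>0 * real n ^ card V \<le> homs n y"
        have "2 * real (card E) * \<epsilon>0 * real n ^ card V = \<eta> / 8 * X"
          using m by (simp add: \<epsilon>0_def m_def[symmetric] nv_def[symmetric] X_def)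
        hence "homs n y \<ge> (1 + \<delta> - \<eta> / 4) * X - \<eta> / 8 * X" using hy \<tau>_ge by linarith
        hence "inj_homs n y \<ge> (1 + \<delta> - \<eta> / 4) * X - \<eta> / 8 * X - \<zeta> * X" using homs_inj[OF y] by linarith
        \<comment> \<open>The three losses are \<open>\<eta> / 4\<close> from \<open>cI\<close>
          falling short of \<open>n ^ card V\<close>, \<open>\<eta> / 8\<close> from the radius of
          the balls and \<open>\<zeta> = \<eta> / 8\<close> from non-injective maps.\<close>
        hence yi: "inj_homs n y \<ge> (1 + \<delta> - \<eta> / 2) * X" by (simp add: \<zeta>_def algebra_simps)
        have "\<exists>g'. weighting r n g' \<and> inj_homs n g' \<ge> (1 + \<delta>) * X \<and> entropy r n p g' \<le> (1 + \<epsilon>') * entropy r n p y"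
        proof (rule cont[OF y])
          have "(1 + \<delta> / 2) * X \<le> (1 + \<delta> - \<eta> / 2) * X" using \<eta> by (intro mono_X) simp
          thus "inj_homs n y \<ge> (1 + \<delta> / 2) * X" using yi by linarith
          have "(1 + \<delta>) * X \<le> (1 + \<delta> - \<eta> / 2 + \<eta>) * X" using \<eta> by (intro mono_X) simp
          thus "(1 + \<delta>) * X \<le> inj_homs n y + \<eta> * X" using yi by (simp add: algebra_simps)
          show "(1 + \<delta>) * X \<le> (1 + 2 * \<delta>) * X" using \<delta> by (intro mono_X) simp
        qed
        then obtain g' where g': "weighting r n g'" "inj_homs n g' \<ge> (1 + \<delta>) * X"
          "entropy r n p g' \<le> (1 + \<epsilon>') * entropy r n p y" by blast
        have "\<phi> \<le> (1 + \<epsilon>') * entropy r n p y" using \<phi>_le[OF g'(1,2)] g'(3) by linarith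
        thus "L \<le> entropy r n p y" unfolding L_def using \<epsilon>' by (simp add: pos_divide_le_eq mult.commute)
      qed
      moreover have "P \<le> (\<Sum>D\<in>{D \<in> Pow ?R. homs n (\<lambda>d. if d \<in> D then 1 else 0) \<ge> \<tau>}. subset_weight ?R (\<lambda>_. p) D)"
        unfolding P_eq
      proof (rule sum_mono2)
        show "S \<subseteq> {D \<in> Pow ?R. homs n (\<lambda>d. if d \<in> D then 1 else 0) \<ge> \<tau>}"
        proof
          fix D assume D: "D \<in> S"
          have "weighting r n (\<lambda>d. if d \<in> D then 1 else 0)" by (simp add: weighting_def)
          from inj_homs_le_homs[OF this] show "D \<in> {D \<in> Pow ?R. homs n (\<lambda>d. if d \<in> D then 1 else 0) \<ge> \<tau>}"
            using D unfolding S_def \<tau>_def by fastforce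
        qed
      qed (auto intro: less_imp_le[OF subset_weight_pos[OF p(1) p8(2)]])
      moreover have "real ((1 + 2 * card (tests n)) ^ k) * exp (- L) \<le> exp (\<epsilon>' * \<phi>) * exp (- L)"
      proof (intro mult_right_mono)
        have "ln (real (1 + 2 * card (tests n)) ^ k) = real k * ln (real (1 + 2 * card (tests n)))"
          by (rule ln_realpow)
        also have "\<dots> \<le> (c1 / x\<^sup>2) * (4 * m * real n ^ (r - 1))"
        proof (rule mult_mono)
          have "x \<le> 1" unfolding x_def using p p8 by (intro power_le_one) auto
          hence "x\<^sup>2 \<le> 1" using x by (simp add: power_le_one)
          hence "1 \<le> 1 / x\<^sup>2" using x by simp
          moreover have "C\<^sup>2 / \<epsilon>0\<^sup>2 = 256 * m\<^sup>2 * C\<^sup>2 / \<eta>\<^sup>2 / x\<^sup>2"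
            using m x \<eta> by (simp add: \<epsilon>0_def power_divide power_mult_distrib)
          ultimately have "real k \<le> 256 * m\<^sup>2 * C\<^sup>2 / \<eta>\<^sup>2 / x\<^sup>2 + 1 / x\<^sup>2" using k2 by linarith
          thus "real k \<le> c1 / x\<^sup>2" by (simp add: c1_def add_divide_distrib)
          show "ln (real (1 + 2 * card (tests n))) \<le> 4 * m * real n ^ (r - 1)"
            using ln_card_tests_le[OF n] by (simp add: m_def)
        qed (use c1 in auto)
        \<comment> \<open>The logarithm of the number of balls is of order
          \<open>n ^ (r - 1) / x\<^sup>2\<close>, against \<open>n ^ r * x\<^sup>2\<close> for
          \<open>\<phi>\<close>. The quotient is \<open>n * x ^ 4 = n * p ^ (4 * card E)\<close>,
          the quantity assumed large.\<close>
        also have "\<dots> \<le> \<epsilon>' * (c0 * Y)"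
        proof -
          have "4 * m * c1 / (c0 * \<epsilon>') \<le> real n * p ^ (4 * card E)" using Q(8) nQ by linarith
          moreover have "p ^ (4 * card E) = x\<^sup>2 * x\<^sup>2"
            by (simp add: x_def power_mult[symmetric] power_add[symmetric] mult.commute)
          ultimately have "4 * m * c1 \<le> (real n * (x\<^sup>2 * x\<^sup>2)) * (c0 * \<epsilon>')"
            using c0 \<epsilon>' by (simp add: pos_divide_le_eq)
          hence "4 * m * c1 / x\<^sup>2 \<le> \<epsilon>' * c0 * x\<^sup>2 * real n" using x by (simp add: pos_divide_le_eq mult_ac)
          hence "4 * m * c1 / x\<^sup>2 * real n ^ (r - 1) \<le> \<epsilon>' * c0 * x\<^sup>2 * real n * real n ^ (r - 1)"
            using np by (intro mult_right_mono) auto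
          moreover have "real n ^ r = real n * real n ^ (r - 1)"
            using r_pos by (simp add: power_eq_if)
          ultimately show ?thesis unfolding Y_def by (simp add: mult_ac)
        qed
        also have "\<dots> \<le> \<epsilon>' * \<phi>" using \<phi>_lo \<epsilon>' by (intro mult_left_mono) auto
        finally have "exp (ln (real (1 + 2 * card (tests n)) ^ k)) \<le> exp (\<epsilon>' * \<phi>)"
          by (simp only: exp_le_cancel_iff)
        moreover have "real (1 + 2 * card (tests n)) ^ k > 0" by (intro zero_less_power) simp
        ultimately show "real ((1 + 2 * card (tests n)) ^ k) \<le> exp (\<epsilon>' * \<phi>)"
          by (simp only: exp_ln of_nat_power)
      qed auto
      moreover have "exp (\<epsilon>' * \<phi>) * exp (- L) \<le> exp (- ((1 - \<epsilon>) * \<phi>))"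
      proof -
        have "1 - \<epsilon>' \<le> 1 / (1 + \<epsilon>')"
          using \<epsilon>' by (subst pos_le_divide_eq) (auto simp: algebra_simps)
        hence "(1 - \<epsilon>') * \<phi> \<le> 1 / (1 + \<epsilon>') * \<phi>" using \<phi>_pos by (intro mult_right_mono) auto
        hence "(1 - \<epsilon>') * \<phi> \<le> L" by (simp add: L_def)
        moreover have "2 * \<epsilon>' * \<phi> \<le> \<epsilon> * \<phi>" using \<phi>_pos \<epsilon> by (intro mult_right_mono) (auto simp: \<epsilon>'_def)
        ultimately have "\<epsilon>' * \<phi> - L \<le> - ((1 - \<epsilon>) * \<phi>)" by (simp add: algebra_simps)
        thus ?thesis by (simp add: exp_add[symmetric])
      qed
      ultimately show ?thesis by linarith
    qed
    show ?thesis using \<phi>_pos lower upper unfolding \<phi>_def P_def by blast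
  qed
  thus ?thesis using p0 by (intro exI[of _ p0] exI[of _ Q]) auto
qed

end

text \<open>The power \<open>4 * m\<close> turns the exponent \<open>1 / (6 * m)\<close> into
  \<open>2 / 3\<close>, and the logarithm is at least \<open>1\<close> from \<open>n = 3\<close> on,
  so the sequence eventually exceeds \<open>n powr (1 / 3)\<close>.\<close>

lemma powr_lower_bound_tendsto:
  fixes p :: "nat \<Rightarrow> real" and m :: nat
  assumes m: "m \<ge> 1"
    and p: "\<forall>\<^sub>F n in sequentially. p n > real n powr (- 1 / (6 * real m)) * ln (real n)"
  shows "filterlim (\<lambda>n. real n * p n ^ (4 * m)) at_top sequentially"
proof -
  have lim: "filterlim (\<lambda>n. exp (1 / 3 * ln (real n))) at_top sequentially"
    by (intro filterlim_compose[OF exp_at_top] filterlim_tendsto_pos_mult_at_top[OF tendsto_const]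
        filterlim_compose[OF ln_at_top filterlim_real_sequentially]) simp
  show ?thesis
  proof (rule filterlim_at_top_mono[OF lim])
    show "\<forall>\<^sub>F n in sequentially. exp (1 / 3 * ln (real n)) \<le> real n * p n ^ (4 * m)"
      using p eventually_ge_at_top[of 3]
    proof eventually_elim
      case (elim n)
      have n: "real n > 0" using elim by simp
      have "exp 1 \<le> real n" using elim exp_le by (metis of_nat_le_iff of_nat_numeral order_trans)
      hence "ln (exp 1) \<le> ln (real n)" using n by (subst ln_le_cancel_iff) auto
      hence "1 \<le> ln (real n)" by simp
      hence "real n powr (- 1 / (6 * real m)) * 1 \<le> real n powr (- 1 / (6 * real m)) * ln (real n)"
        by (intro mult_left_mono) auto
      hence "real n powr (- 1 / (6 * real m)) \<le> p n" using elim(1) by linarith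
      hence "(real n powr (- 1 / (6 * real m))) ^ (4 * m) \<le> p n ^ (4 * m)" by (intro power_mono) auto
      moreover have "(real n powr (- 1 / (6 * real m))) ^ (4 * m) = real n powr (- 2 / 3)"
      proof -
        have "(real n powr (- 1 / (6 * real m))) ^ (4 * m) = (real n powr (- 1 / (6 * real m))) powr real (4 * m)"
          using n by (intro powr_realpow[symmetric]) simp
        also have "\<dots> = real n powr (- 1 / (6 * real m) * real (4 * m))" by (rule powr_powr)
        also have "- 1 / (6 * real m) * real (4 * m) = - 2 / 3" using m by (simp add: field_simps)
        finally show ?thesis .
      qed
      ultimately have "real n * real n powr (- 2 / 3) \<le> real n * p n ^ (4 * m)"
        using n by (intro mult_left_mono) auto
      moreover have "real n * real n powr (- 2 / 3) = real n powr (1 / 3)"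
        using n powr_add[of "real n" 1 "- 2 / 3"] by simp
      moreover have "real n powr (1 / 3) = exp (1 / 3 * ln (real n))" using n by (simp add: powr_def)
      ultimately show ?case by simp
    qed
  qed
qed

theorem theorem2p1:
  fixes r :: nat and V :: "'a set" and E :: "'a set set"
    and \<delta> :: real and p :: "nat \<Rightarrow> real"
  assumes "r \<ge> 1"
    and "uniform_hypergraph r V E"
    and "E \<noteq> {}"
    and "\<delta> > 0"
    and "\<And>n. 0 \<le> p n \<and> p n \<le> 1"
    and "\<forall>\<^sub>F n in sequentially. p n > real n powr (- 1 / (6 * real (card E))) * ln (real n)"
    and "p \<longlonglongrightarrow> 0"
  shows "\<exists>\<epsilon> :: nat \<Rightarrow> real. \<epsilon> \<longlonglongrightarrow> 0 \<and>
    (\<forall>\<^sub>F n in sequentially.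
       measure_pmf.prob (random_hypergraph r n (p n))
         {D. real (copies V E n D) \<ge>
               (1 + \<delta>) * measure_pmf.expectation (random_hypergraph r n (p n))
                           (\<lambda>D. real (copies V E n D))}
       = exp (- (1 + \<epsilon> n) * upper_tail_phi r V E n (p n) \<delta>))"
proof -
  interpret hypergraph r V E
    using assms(1-3) by unfold_locales
  define \<phi> where "\<phi> n = upper_tail_phi r V E n (p n) \<delta>" for n
  define P where "P n = tail_prob n (p n) \<delta>" for n
  have lim: "filterlim (\<lambda>n. real n * p n ^ (4 * card E)) at_top sequentially"
    by (rule powr_lower_bound_tendsto[OF card_E_pos assms(6)])
  have pos: "\<forall>\<^sub>F n in sequentially. 0 < p n"
    using assms(6) eventually_ge_at_top[of 1]
  proof eventually_elim
    case (elim n)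
    have "0 \<le> real n powr (- 1 / (6 * real (card E))) * ln (real n)"
      using elim(2) by (intro mult_nonneg_nonneg) auto
    thus ?case using elim(1) by linarith
  qed
  have main: "\<forall>\<^sub>F n in sequentially. \<phi> n > 0 \<and> P n \<ge> exp (- ((1 + e) * \<phi> n)) \<and> P n \<le> exp (- ((1 - e) * \<phi> n))"
    if e: "0 < e" "e \<le> 1 / 2" for e :: real
  proof -
    obtain p0 Q where pQ: "p0 > 0" "\<And>n q. n \<ge> 1 \<Longrightarrow> 0 < q \<Longrightarrow> q \<le> p0 \<Longrightarrow> real n * q ^ (4 * card E) \<ge> Q \<Longrightarrow>
     upper_tail_phi r V E n q \<delta> > 0 \<and>
     tail_prob n q \<delta> \<ge> exp (- ((1 + e) * upper_tail_phi r V E n q \<delta>)) \<and>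
     tail_prob n q \<delta> \<le> exp (- ((1 - e) * upper_tail_phi r V E n q \<delta>))"
      using tail_bounds[OF assms(4) e] by metis
    have "\<forall>\<^sub>F n in sequentially. p n < p0" using order_tendstoD(2)[OF assms(7) pQ(1)] .
    moreover have "\<forall>\<^sub>F n in sequentially. real n * p n ^ (4 * card E) \<ge> Q"
      using lim by (simp add: filterlim_at_top)
    ultimately show ?thesis using pos eventually_ge_at_top[of 1]
    proof eventually_elim
      case (elim n)
      show ?case unfolding \<phi>_def P_def using elim by (intro pQ(2)) auto
    qed
  qed
  \<comment> \<open>The solution of the required equation wherever \<open>P n > 0\<close> and
    \<open>\<phi> n > 0\<close>, which hold for all large \<open>n\<close>; the two tail bounds then
    confine it to \<open>[- e, e]\<close> eventually, for every small \<open>e\<close>.\<close>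
  define \<epsilon> where "\<epsilon> n = - ln (P n) / \<phi> n - 1" for n
  have "\<epsilon> \<longlonglongrightarrow> 0"
  proof (rule tendstoI)
    fix e0 :: real assume e0: "e0 > 0"
    define e where "e = min (e0 / 2) (1 / 2)"
    have e: "0 < e" "e \<le> 1 / 2" "e < e0" using e0 by (auto simp: e_def)
    show "\<forall>\<^sub>F n in sequentially. dist (\<epsilon> n) 0 < e0"
      using main[OF e(1,2)]
    proof eventually_elim
      case (elim n)
      have Pn: "P n > 0" using elim by (meson exp_gt_zero less_le_trans)
      have "ln (exp (- ((1 + e) * \<phi> n))) \<le> ln (P n)" using elim Pn by (subst ln_le_cancel_iff) auto
      hence 1: "- ln (P n) \<le> (1 + e) * \<phi> n" by simp
      have "ln (P n) \<le> ln (exp (- ((1 - e) * \<phi> n)))" using elim Pn by (subst ln_le_cancel_iff) auto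
      hence 2: "- ln (P n) \<ge> (1 - e) * \<phi> n" by simp
      have "- ln (P n) / \<phi> n \<le> 1 + e" using 1 elim by (subst pos_divide_le_eq) auto
      moreover have "- ln (P n) / \<phi> n \<ge> 1 - e" using 2 elim by (subst pos_le_divide_eq) auto
      ultimately have "\<bar>\<epsilon> n\<bar> \<le> e" unfolding \<epsilon>_def by linarith
      thus ?case using e(3) by (simp add: dist_real_def)
    qed
  qed
  moreover have "\<forall>\<^sub>F n in sequentially. P n = exp (- (1 + \<epsilon> n) * \<phi> n)"
    using main[of "1 / 2", simplified]
  proof eventually_elim
    case (elim n)
    have Pn: "P n > 0" using elim by (meson exp_gt_zero less_le_trans)
    have "- (1 + \<epsilon> n) * \<phi> n = ln (P n)" using elim by (simp add: \<epsilon>_def)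
    thus ?case using Pn by simp
  qed
  ultimately show ?thesis
    unfolding P_def \<phi>_def tail_prob_def by blast
qed

end
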